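(* Let $R$ be a commutative ring, $G$ a group and $\alpha=(D_g,\alpha_g)_{g\in G}$ a unital partial action of $G$ on $R$, with $D_g=R1_g$. Let $\Theta:G\to \mathbf{PicS}_{R^\alpha}(R)$, $\Theta(g)=[(D_g)_{g^{-1}}]$, be the associated unital partial representation. Let $\alpha^*$ be the induced partial action of $G$ on $\mathbf{PicS}_R(R)$, and let $\mathcal{C}(\Theta/R)$ be the set of isomorphism classes $[\Delta(\Gamma)]$ of partial generalized crossed products of partial representations $\Gamma:G\to\mathbf{PicS}(R)$ satisfying $\Gamma_g\,|\,(D_g)_{g^{-1}}$ and $\Gamma_g\otimes_R\Gamma_{g^{-1}}\simeq D_g$ as $R$-bimodules for all $g\in G$. Then $$\mathcal{C}(\Theta/R)=\{[\Delta(\Gamma)] : \text{there exists } f\in Z^1(G,\alpha^*,\mathbf{PicS}_R(R)) \text{ such that } \Gamma=f\Theta\},$$ where on the right-hand side $\Delta(\Gamma)$ ranges over all partial generalized crossed products whose underlying partial representation is of the form $(f\Theta)(g)=f(g)\Theta(g)$, $g\in G$.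
   Context: All rings are associative with unity. A unital partial action $\alpha=(D_g,\alpha_g)_{g\in G}$ of $G$ on a commutative ring $R$ consists of ideals $D_g=R1_g$ generated by idempotents $1_g$ and ring isomorphisms $\alpha_g:D_{g^{-1}}\to D_g$ such that $D_1=R$, $\alpha_1=\mathrm{id}$, $\alpha_h^{-1}(D_h\cap D_{g^{-1}})\subseteq D_{(gh)^{-1}}$ and $\alpha_g\circ\alpha_h=\alpha_{gh}$ on $\alpha_h^{-1}(D_h\cap D_{g^{-1}})$. $R^\alpha=\{r\in R:\alpha_g(r1_{g^{-1}})=r1_g\ \forall g\in G\}$. An $R$-bimodule $P$ is partially invertible if it is finitely generated projective as a left and as a right $R$-module and the maps $R\to \mathrm{End}(P_R)$, $r\mapsto(p\mapsto rp)$, and $R\to\mathrm{End}({}_RP)$, $r\mapsto (p\mapsto pr)$, are surjective. $\mathbf{PicS}(R)$ is the monoid of isomorphism classes of partially invertible $R$-bimodules under $\otimes_R$; for a subring $k\subseteq R$, $\mathbf{PicS}_k(R)$ is the submonoid of classes of bimodules central over $k$ (i.e. $xp=px$ for $x\in k$). $\mathbf{Pic}_R(R')$ denotes the group of classes of invertible bimodules central over $R$. $(D_g)_{g^{-1}}$ is the set $D_g$ with $R$-actions $r*d=rd$, $d*r=d\,\alpha_g(r1_{g^{-1}})$. The map $\Theta:g\mapsto[(D_g)_{g^{-1}}]$ is a unital partial representation. The partial action $\alpha^*=(\mathcal X_g,\alpha_g^* )_{g\in G}$ on the monoid $\mathbf{PicS}_R(R)$: $\mathcal X_g=\mathbf{PicS}_R(R)[D_g]$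 and $\alpha^*_g:\mathcal X_{g^{-1}}\to\mathcal X_g$, $[P]\mapsto[P_g]$, where $P_g=P$ as a set, with central $R$-bimodule structure $r\bullet p=\alpha_{g^{-1}}(r1_g)p$. $Z^1(G,\alpha^*,\mathbf{PicS}_R(R))$ is the set of functions $f:G\to\mathbf{PicS}_R(R)$ with $f(g)$ an invertible element of the monoid $\mathcal X_g$ (whose identity is $[D_g]$) and $\alpha_g^*(f(h)[D_{g^{-1}}])f(g)=f(gh)[D_g]$ for all $g,h\in G$. A partial representation of $G$ in a monoid is a map $\theta$ with $\theta_1=1$, $\theta_g\theta_h\theta_{h^{-1}}=\theta_{gh}\theta_{h^{-1}}$ and $\theta_{g^{-1}}\theta_g\theta_h=\theta_{g^{-1}}\theta_{gh}$. Let $\Gamma:G\to\mathbf{PicS}(R)$, $\Gamma(g)=[\Gamma_g]$, be a partial representation with $\Gamma_g\otimes_R\Gamma_{g^{-1}}\simeq R1_g$ for all $g$. A factor set for $\Gamma$ is a family of $R$-bimodule isomorphisms $f^\Gamma_{g,h}:\Gamma_g\otimes_R\Gamma_h\to 1_g\Gamma_{gh}$ such that $f^\Gamma_{gh,l}(f^\Gamma_{g,h}(a\otimes b)\otimes c)=f^\Gamma_{g,hl}(a\otimes f^\Gamma_{h,l}(b\otimes c))$ for all $a\in\Gamma_g,b\in\Gamma_h,c\in\Gamma_l$. The associated partial generalized crossed product is $\Delta(\Gamma)=\bigoplus_{g\in G}\Gamma_g$ with multiplication $u_gu_h=f^\Gamma_{g,h}(u_g\otimes u_h)$; it is an associative unital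 ring, and $\iota:R\to\Gamma_1$, $r\mapsto r1_{\Delta(\Gamma)}$, is an isomorphism of rings and of $R$-bimodules. An isomorphism $\Delta(\Omega)\to\Delta(\Gamma)$ of partial generalized crossed products is a family of $R$-bimodule isomorphisms $F_g:\Omega_g\to\Gamma_g$ with $F_1\circ\iota=\iota'$ (where $\iota,\iota'$ are the corresponding maps for $\Omega,\Gamma$) and $F_{gh}\circ f^\Omega_{g,h}=f^\Gamma_{g,h}\circ(F_g\otimes F_h)$. $[\Delta(\Gamma)]$ is the isomorphism class. For $R$-bimodules, $M|N$ means that $M$ is isomorphic as an $R$-bimodule to a direct summand of $N^{(n)}$ for some $n\in\mathbb N$. *)

theory Defs
  imports "HOL-Algebra.Algebra"
begin

section \<open>Bimodules over a commutative ring\<close>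

text \<open>A bimodule extends the library's record of left modules by a right action. As for modules,
  the inherited fields \<open>mult\<close> and \<open>one\<close> carry no meaning.\<close>

record ('a, 'b) bimodule = "('a, 'b) module" +
  rsmult :: "['b, 'a] \<Rightarrow> 'b" (infixl \<open>\<triangleleft>\<index>\<close> 70)

text \<open>Over a commutative ring a right module is the same thing as a left module, so the right
  structure of a bimodule is again treated by the library locale \<open>module\<close>.\<close>

definition right_module :: "('a, 'b, 'm) bimodule_scheme \<Rightarrow> ('a, 'b, 'm) bimodule_scheme"
  where "right_module M = M\<lparr>smult := \<lambda>r x. x \<triangleleft>\<^bsub>M\<^esub> r\<rparr>"

locale bimodule = module R M
  for R (structure) and M :: "('a, 'b, 'm) bimodule_scheme" (structure) +
  assumes right_module: "module R (right_module M)"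
    and left_right_assoc:
      "\<lbrakk>a \<in> carrier R; b \<in> carrier R; x \<in> carrier M\<rbrakk>
        \<Longrightarrow> (a \<odot>\<^bsub>M\<^esub> x) \<triangleleft>\<^bsub>M\<^esub> b = a \<odot>\<^bsub>M\<^esub> (x \<triangleleft>\<^bsub>M\<^esub> b)"

definition mod_hom ::
  "('a, 'p) ring_scheme \<Rightarrow> ('a, 'b, 'm) module_scheme \<Rightarrow> ('a, 'c, 'n) module_scheme \<Rightarrow> ('b \<Rightarrow> 'c) set"
  where "mod_hom R M N = {h \<in> carrier M \<rightarrow> carrier N.
    (\<forall>x\<in>carrier M. \<forall>y\<in>carrier M. h (x \<oplus>\<^bsub>M\<^esub> y) = h x \<oplus>\<^bsub>N\<^esub> h y) \<and>
    (\<forall>r\<in>carrier R. \<forall>x\<in>carrier M. h (r \<odot>\<^bsub>M\<^esub> x) = r \<odot>\<^bsub>N\<^esub> h x)}"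

definition mod_iso ::
  "('a, 'p) ring_scheme \<Rightarrow> ('a, 'b, 'm) module_scheme \<Rightarrow> ('a, 'c, 'n) module_scheme \<Rightarrow> ('b \<Rightarrow> 'c) set"
  where "mod_iso R M N = {h \<in> mod_hom R M N. bij_betw h (carrier M) (carrier N)}"

definition bimod_iso ::
  "('a, 'p) ring_scheme \<Rightarrow> ('a, 'b, 'm) bimodule_scheme \<Rightarrow> ('a, 'c, 'n) bimodule_scheme \<Rightarrow> ('b \<Rightarrow> 'c) set"
  where "bimod_iso R M N =
    mod_iso R M N \<inter> mod_iso R (right_module M) (right_module N)"

definition bimodule_isomorphic ::
  "('a, 'p) ring_scheme \<Rightarrow> ('a, 'b, 'm) bimodule_scheme \<Rightarrow> ('a, 'c, 'n) bimodule_scheme \<Rightarrow> bool"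
  where "bimodule_isomorphic R M N \<longleftrightarrow> bimod_iso R M N \<noteq> {}"

text \<open>An ideal of \<open>R\<close> as a central bimodule; for the ideal \<open>carrier R\<close> this is the regular bimodule.\<close>

definition ideal_bimodule :: "('a, 'p) ring_scheme \<Rightarrow> 'a set \<Rightarrow> ('a, 'a) bimodule"
  where "ideal_bimodule R I = \<lparr>carrier = I, monoid.mult = (\<otimes>\<^bsub>R\<^esub>), one = \<one>\<^bsub>R\<^esub>, ring.zero = \<zero>\<^bsub>R\<^esub>, add = (\<oplus>\<^bsub>R\<^esub>),
    smult = (\<otimes>\<^bsub>R\<^esub>), rsmult = (\<otimes>\<^bsub>R\<^esub>)\<rparr>"

definition direct_power :: "nat \<Rightarrow> ('a, 'b, 'm) bimodule_scheme \<Rightarrow> ('a, nat \<Rightarrow> 'b) bimodule"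
  where "direct_power n M = \<lparr>carrier = {..<n} \<rightarrow>\<^sub>E carrier M, monoid.mult = undefined, one = undefined,
    ring.zero = (\<lambda>i\<in>{..<n}. \<zero>\<^bsub>M\<^esub>), add = (\<lambda>u v. \<lambda>i\<in>{..<n}. u i \<oplus>\<^bsub>M\<^esub> v i),
    smult = (\<lambda>r u. \<lambda>i\<in>{..<n}. r \<odot>\<^bsub>M\<^esub> u i), rsmult = (\<lambda>u r. \<lambda>i\<in>{..<n}. u i \<triangleleft>\<^bsub>M\<^esub> r)\<rparr>"

definition complementary :: "('b, 'm) ring_scheme \<Rightarrow> 'b set \<Rightarrow> 'b set \<Rightarrow> bool"
  where "complementary N K L \<longleftrightarrow> K \<inter> L = {\<zero>\<^bsub>N\<^esub>} \<and> K <+>\<^bsub>N\<^esub> L = carrier N"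

text \<open>\<open>M | N\<close>: the bimodule \<open>M\<close> is isomorphic to a direct summand of some \<open>N\<^sup>n\<close>.\<close>

definition bimodule_divides ::
  "('a, 'p) ring_scheme \<Rightarrow> ('a, 'b, 'm) bimodule_scheme \<Rightarrow> ('a, 'c, 'n) bimodule_scheme \<Rightarrow> bool"
  where "bimodule_divides R M N \<longleftrightarrow> (\<exists>n K L. let N' = direct_power n N in
    submodule K R N' \<and> submodule K R (right_module N') \<and>
    submodule L R N' \<and> submodule L R (right_module N') \<and>
    complementary N' K L \<and> bimodule_isomorphic R M (N'\<lparr>carrier := K\<rparr>))"

text \<open>Finitely generated projective: isomorphic to a direct summand of some \<open>R\<^sup>n\<close>.\<close>

definition fg_projective :: "('a, 'p) ring_scheme \<Rightarrow> ('a, 'b, 'm) module_scheme \<Rightarrow> bool"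
  where "fg_projective R M \<longleftrightarrow> (\<exists>n K L. let F = direct_power n (ideal_bimodule R (carrier R)) in
    submodule K R F \<and> submodule L R F \<and> complementary F K L \<and>
    mod_iso R M (F\<lparr>carrier := K\<rparr>) \<noteq> {})"

definition partially_invertible :: "('a, 'p) ring_scheme \<Rightarrow> ('a, 'b, 'm) bimodule_scheme \<Rightarrow> bool"
  where "partially_invertible R P \<longleftrightarrow> bimodule R P \<and>
    fg_projective R P \<and> fg_projective R (right_module P) \<and>
    (\<forall>h\<in>mod_hom R (right_module P) (right_module P).
      \<exists>r\<in>carrier R. \<forall>p\<in>carrier P. h p = r \<odot>\<^bsub>P\<^esub> p) \<and>
    (\<forall>h\<in>mod_hom R P P. \<exists>r\<in>carrier R. \<forall>p\<in>carrier P. h p = p \<triangleleft>\<^bsub>P\<^esub> r)"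

definition central_over :: "'a set \<Rightarrow> ('a, 'b, 'm) bimodule_scheme \<Rightarrow> bool"
  where "central_over k P \<longleftrightarrow> (\<forall>x\<in>k. \<forall>p\<in>carrier P. x \<odot>\<^bsub>P\<^esub> p = p \<triangleleft>\<^bsub>P\<^esub> x)"


section \<open>Tensor products\<close>

text \<open>\<open>M \<otimes>\<^sub>R N\<close> is the free abelian group on \<open>carrier M \<times> carrier N\<close> modulo the subgroup generated by
  the bilinearity and balancing relations; its elements are cosets.\<close>

definition tensor_relations ::
  "('a, 'p) ring_scheme \<Rightarrow> ('a, 'b, 'm) bimodule_scheme \<Rightarrow> ('a, 'c, 'n) bimodule_scheme
    \<Rightarrow> ('b \<times> 'c \<Rightarrow>\<^sub>0 int) set"
  where "tensor_relations R M N =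
    {frag_of (x \<oplus>\<^bsub>M\<^esub> x', y) - frag_of (x, y) - frag_of (x', y) | x x' y.
      x \<in> carrier M \<and> x' \<in> carrier M \<and> y \<in> carrier N} \<union>
    {frag_of (x, y \<oplus>\<^bsub>N\<^esub> y') - frag_of (x, y) - frag_of (x, y') | x y y'.
      x \<in> carrier M \<and> y \<in> carrier N \<and> y' \<in> carrier N} \<union>
    {frag_of (x \<triangleleft>\<^bsub>M\<^esub> r, y) - frag_of (x, r \<odot>\<^bsub>N\<^esub> y) | x r y.
      x \<in> carrier M \<and> r \<in> carrier R \<and> y \<in> carrier N}"

definition tensor_free ::
  "('a, 'b, 'm) bimodule_scheme \<Rightarrow> ('a, 'c, 'n) bimodule_scheme \<Rightarrow> ('b \<times> 'c \<Rightarrow>\<^sub>0 int) monoid"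
  where "tensor_free M N = free_Abelian_group (carrier M \<times> carrier N)"

definition tensor_kernel ::
  "('a, 'p) ring_scheme \<Rightarrow> ('a, 'b, 'm) bimodule_scheme \<Rightarrow> ('a, 'c, 'n) bimodule_scheme
    \<Rightarrow> ('b \<times> 'c \<Rightarrow>\<^sub>0 int) set"
  where "tensor_kernel R M N = generate (tensor_free M N) (tensor_relations R M N)"

definition pure_tensor ::
  "('a, 'p) ring_scheme \<Rightarrow> ('a, 'b, 'm) bimodule_scheme \<Rightarrow> ('a, 'c, 'n) bimodule_scheme
    \<Rightarrow> 'b \<Rightarrow> 'c \<Rightarrow> ('b \<times> 'c \<Rightarrow>\<^sub>0 int) set"
  where "pure_tensor R M N x y = tensor_kernel R M N #>\<^bsub>tensor_free M N\<^esub> frag_of (x, y)"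

text \<open>\<open>tensor_map R M' N' h k\<close> is the map \<open>h \<otimes> k : M \<otimes> N \<rightarrow> M' \<otimes> N'\<close>: a coset is mapped to the coset
  of the image of any of its elements.\<close>

definition tensor_map ::
  "('a, 'p) ring_scheme \<Rightarrow> ('a, 'd, 'm) bimodule_scheme \<Rightarrow> ('a, 'e, 'n) bimodule_scheme
    \<Rightarrow> ('b \<Rightarrow> 'd) \<Rightarrow> ('c \<Rightarrow> 'e) \<Rightarrow> ('b \<times> 'c \<Rightarrow>\<^sub>0 int) set \<Rightarrow> ('d \<times> 'e \<Rightarrow>\<^sub>0 int) set"
  where "tensor_map R M' N' h k T =
    tensor_kernel R M' N' <#>\<^bsub>tensor_free M' N'\<^esub> frag_extend (\<lambda>(x, y). frag_of (h x, k y)) ` T"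

definition tensor ::
  "('a, 'p) ring_scheme \<Rightarrow> ('a, 'b, 'm) bimodule_scheme \<Rightarrow> ('a, 'c, 'n) bimodule_scheme
    \<Rightarrow> ('a, ('b \<times> 'c \<Rightarrow>\<^sub>0 int) set) bimodule"
  where "tensor R M N = (let Q = tensor_free M N Mod tensor_kernel R M N in
    \<lparr>carrier = carrier Q, monoid.mult = undefined, one = undefined, ring.zero = \<one>\<^bsub>Q\<^esub>, add = (\<otimes>\<^bsub>Q\<^esub>),
     smult = (\<lambda>r. tensor_map R M N (\<lambda>x. r \<odot>\<^bsub>M\<^esub> x) (\<lambda>y. y)),
     rsmult = (\<lambda>t r. tensor_map R M N (\<lambda>x. x) (\<lambda>y. y \<triangleleft>\<^bsub>N\<^esub> r) t)\<rparr>)"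


section \<open>The monoid of partially invertible bimodules\<close>

text \<open>Every bimodule that is finitely generated as a left module is isomorphic to one whose elements
  are cosets in some \<open>R\<^sup>n\<close>, that is, subsets of \<open>nat \<Rightarrow> 'a\<close>. Isomorphism classes are therefore
  formed inside this one type; the class of a bimodule \<open>P\<close> on an arbitrary type is the set of
  all bimodules on \<open>(nat \<Rightarrow> 'a) set\<close> that are isomorphic to \<open>P\<close>.\<close>

type_synonym 'a std_bimodule = "('a, (nat \<Rightarrow> 'a) set) bimodule"

definition bimodule_class ::
  "('a, 'p) ring_scheme \<Rightarrow> ('a, 'b, 'm) bimodule_scheme \<Rightarrow> 'a std_bimodule set"
  where "bimodule_class R P = {Q. bimodule R Q \<and> bimodule_isomorphic R Q P}"

definition class_tensor ::
  "('a, 'p) ring_scheme \<Rightarrow> 'a std_bimodule set \<Rightarrow> 'a std_bimodule set \<Rightarrow> 'a std_bimodule set"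
  where "class_tensor R U V =
    {Z. bimodule R Z \<and> (\<exists>P\<in>U. \<exists>Q\<in>V. bimodule_isomorphic R Z (tensor R P Q))}"

definition PicS :: "('a, 'p) ring_scheme \<Rightarrow> 'a std_bimodule set monoid"
  where "PicS R = \<lparr>carrier = {bimodule_class R P | P :: 'a std_bimodule. partially_invertible R P},
    monoid.mult = class_tensor R, one = bimodule_class R (ideal_bimodule R (carrier R))\<rparr>"

definition PicS_over :: "'a set \<Rightarrow> ('a, 'p) ring_scheme \<Rightarrow> 'a std_bimodule set monoid"
  where "PicS_over k R = (PicS R)\<lparr>carrier :=
    {bimodule_class R P | P :: 'a std_bimodule. partially_invertible R P \<and> central_over k P}\<rparr>"


section \<open>Unital partial actions\<close>

text \<open>The partial action is given by the idempotents \<open>e g\<close> (the \<open>1\<^sub>g\<close> of the usual notation) and the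
  maps \<open>\<alpha> g\<close>; the ideal \<open>D\<^sub>g\<close> is \<open>PIdl (e g)\<close>, a ring with unit \<open>e g\<close>.\<close>

locale unital_partial_action = G: group G + R: cring R
  for G :: "('g, 'q) monoid_scheme" (structure) and R :: "('a, 'p) ring_scheme" (structure) +
  fixes e :: "'g \<Rightarrow> 'a" and \<alpha> :: "'g \<Rightarrow> 'a \<Rightarrow> 'a"
  assumes e_closed: "g \<in> carrier G \<Longrightarrow> e g \<in> carrier R"
    and e_idem: "g \<in> carrier G \<Longrightarrow> e g \<otimes>\<^bsub>R\<^esub> e g = e g"
    and act_iso: "g \<in> carrier G \<Longrightarrow>
      \<alpha> g \<in> ring_iso (R\<lparr>carrier := PIdl\<^bsub>R\<^esub> (e (inv\<^bsub>G\<^esub> g)), one := e (inv\<^bsub>G\<^esub> g)\<rparr>)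
                    (R\<lparr>carrier := PIdl\<^bsub>R\<^esub> (e g), one := e g\<rparr>)"
    and dom_one: "PIdl\<^bsub>R\<^esub> (e \<one>\<^bsub>G\<^esub>) = carrier R"
    and act_one: "r \<in> carrier R \<Longrightarrow> \<alpha> \<one>\<^bsub>G\<^esub> r = r"
    and act_dom: "\<lbrakk>g \<in> carrier G; h \<in> carrier G; r \<in> PIdl\<^bsub>R\<^esub> (e (inv\<^bsub>G\<^esub> h));
        \<alpha> h r \<in> PIdl\<^bsub>R\<^esub> (e h) \<inter> PIdl\<^bsub>R\<^esub> (e (inv\<^bsub>G\<^esub> g))\<rbrakk>
      \<Longrightarrow> r \<in> PIdl\<^bsub>R\<^esub> (e (inv\<^bsub>G\<^esub> (g \<otimes>\<^bsub>G\<^esub> h)))"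
    and act_mult: "\<lbrakk>g \<in> carrier G; h \<in> carrier G; r \<in> PIdl\<^bsub>R\<^esub> (e (inv\<^bsub>G\<^esub> h));
        \<alpha> h r \<in> PIdl\<^bsub>R\<^esub> (e h) \<inter> PIdl\<^bsub>R\<^esub> (e (inv\<^bsub>G\<^esub> g))\<rbrakk>
      \<Longrightarrow> \<alpha> g (\<alpha> h r) = \<alpha> (g \<otimes>\<^bsub>G\<^esub> h) r"

definition invariants ::
  "('g, 'q) monoid_scheme \<Rightarrow> ('a, 'p) ring_scheme \<Rightarrow> ('g \<Rightarrow> 'a) \<Rightarrow> ('g \<Rightarrow> 'a \<Rightarrow> 'a) \<Rightarrow> 'a set"
  where "invariants G R e \<alpha> =
    {r \<in> carrier R. \<forall>g\<in>carrier G. \<alpha> g (r \<otimes>\<^bsub>R\<^esub> e (inv\<^bsub>G\<^esub> g)) = r \<otimes>\<^bsub>R\<^esub> e g}"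

text \<open>\<open>D\<^sub>g\<close> as a central bimodule, and the twisted bimodule \<open>(D\<^sub>g)\<^bsub>g\<inverse>\<^esub>\<close>.\<close>

definition dom_bimodule :: "('a, 'p) ring_scheme \<Rightarrow> ('g \<Rightarrow> 'a) \<Rightarrow> 'g \<Rightarrow> ('a, 'a) bimodule"
  where "dom_bimodule R e g = ideal_bimodule R (PIdl\<^bsub>R\<^esub> (e g))"

definition twisted_dom ::
  "('g, 'q) monoid_scheme \<Rightarrow> ('a, 'p) ring_scheme \<Rightarrow> ('g \<Rightarrow> 'a) \<Rightarrow> ('g \<Rightarrow> 'a \<Rightarrow> 'a) \<Rightarrow> 'g
    \<Rightarrow> ('a, 'a) bimodule"
  where "twisted_dom G R e \<alpha> g =
    (dom_bimodule R e g)\<lparr>rsmult := \<lambda>d r. d \<otimes>\<^bsub>R\<^esub> \<alpha> g (r \<otimes>\<^bsub>R\<^esub> e (inv\<^bsub>G\<^esub> g))\<rparr>"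

text \<open>The twisted bimodules are central over \<open>R\<^sup>\<alpha>\<close>, so that the classes \<open>\<Theta>(g)\<close> below lie in
  \<open>PicS_over (invariants G R e \<alpha>) R\<close>.\<close>

lemma (in unital_partial_action) twisted_dom_central:
  assumes g: "g \<in> carrier G"
  shows "central_over (invariants G R e \<alpha>) (twisted_dom G R e \<alpha> g)"
  unfolding central_over_def
proof (intro ballI)
  fix x d
  assume x: "x \<in> invariants G R e \<alpha>" and d: "d \<in> carrier (twisted_dom G R e \<alpha> g)"
  have xR: "x \<in> carrier R" and ax: "\<alpha> g (x \<otimes>\<^bsub>R\<^esub> e (inv\<^bsub>G\<^esub> g)) = x \<otimes>\<^bsub>R\<^esub> e g"
    using x g by (auto simp: invariants_def)
  obtain c where c: "c \<in> carrier R" "d = c \<otimes>\<^bsub>R\<^esub> e g"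
    using d by (auto simp: twisted_dom_def dom_bimodule_def ideal_bimodule_def cgenideal_def)
  have "d \<otimes>\<^bsub>R\<^esub> (x \<otimes>\<^bsub>R\<^esub> e g) = x \<otimes>\<^bsub>R\<^esub> (c \<otimes>\<^bsub>R\<^esub> (e g \<otimes>\<^bsub>R\<^esub> e g))"
    using c xR e_closed[OF g] by (simp add: R.m_ac)
  then have "d \<otimes>\<^bsub>R\<^esub> (x \<otimes>\<^bsub>R\<^esub> e g) = x \<otimes>\<^bsub>R\<^esub> d"
    using c e_idem[OF g] by simp
  then show "x \<odot>\<^bsub>twisted_dom G R e \<alpha> g\<^esub> d = d \<triangleleft>\<^bsub>twisted_dom G R e \<alpha> g\<^esub> x"
    by (simp add: twisted_dom_def dom_bimodule_def ideal_bimodule_def ax)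
qed

definition Theta ::
  "('g, 'q) monoid_scheme \<Rightarrow> ('a, 'p) ring_scheme \<Rightarrow> ('g \<Rightarrow> 'a) \<Rightarrow> ('g \<Rightarrow> 'a \<Rightarrow> 'a) \<Rightarrow> 'g
    \<Rightarrow> 'a std_bimodule set"
  where "Theta G R e \<alpha> g = bimodule_class R (twisted_dom G R e \<alpha> g)"


section \<open>The partial action on the Picard monoid and its 1-cocycles\<close>

text \<open>The monoid \<open>\<U>\<^sub>g = PicS\<^sub>R(R) [D\<^sub>g]\<close>.\<close>

definition PicS_ideal ::
  "('a, 'p) ring_scheme \<Rightarrow> ('g \<Rightarrow> 'a) \<Rightarrow> 'g \<Rightarrow> 'a std_bimodule set monoid"
  where "PicS_ideal R e g = (PicS R)\<lparr>
    carrier := {U \<otimes>\<^bsub>PicS R\<^esub> bimodule_class R (dom_bimodule R e g) | U.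
                  U \<in> carrier (PicS_over (carrier R) R)},
    one := bimodule_class R (dom_bimodule R e g)\<rparr>"

definition twist ::
  "('g, 'q) monoid_scheme \<Rightarrow> ('a, 'p) ring_scheme \<Rightarrow> ('g \<Rightarrow> 'a) \<Rightarrow> ('g \<Rightarrow> 'a \<Rightarrow> 'a) \<Rightarrow> 'g
    \<Rightarrow> ('a, 'b, 'm) bimodule_scheme \<Rightarrow> ('a, 'b, 'm) bimodule_scheme"
  where "twist G R e \<alpha> g P = P\<lparr>
    smult := \<lambda>r p. \<alpha> (inv\<^bsub>G\<^esub> g) (r \<otimes>\<^bsub>R\<^esub> e g) \<odot>\<^bsub>P\<^esub> p,
    rsmult := \<lambda>p r. \<alpha> (inv\<^bsub>G\<^esub> g) (r \<otimes>\<^bsub>R\<^esub> e g) \<odot>\<^bsub>P\<^esub> p\<rparr>"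

text \<open>\<open>\<alpha>\<^sup>*\<^sub>g [P] = [P\<^sub>g]\<close>; meaningful for classes in \<open>\<U>\<^bsub>g\<inverse>\<^esub>\<close>.\<close>

definition act_star ::
  "('g, 'q) monoid_scheme \<Rightarrow> ('a, 'p) ring_scheme \<Rightarrow> ('g \<Rightarrow> 'a) \<Rightarrow> ('g \<Rightarrow> 'a \<Rightarrow> 'a) \<Rightarrow> 'g
    \<Rightarrow> 'a std_bimodule set \<Rightarrow> 'a std_bimodule set"
  where "act_star G R e \<alpha> g U = (\<Union>P\<in>U. bimodule_class R (twist G R e \<alpha> g P))"

definition Z1 ::
  "('g, 'q) monoid_scheme \<Rightarrow> ('a, 'p) ring_scheme \<Rightarrow> ('g \<Rightarrow> 'a) \<Rightarrow> ('g \<Rightarrow> 'a \<Rightarrow> 'a)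
    \<Rightarrow> ('g \<Rightarrow> 'a std_bimodule set) set"
  where "Z1 G R e \<alpha> = {f \<in> carrier G \<rightarrow>\<^sub>E carrier (PicS_over (carrier R) R).
    (\<forall>g\<in>carrier G. f g \<in> Units (PicS_ideal R e g)) \<and>
    (\<forall>g\<in>carrier G. \<forall>h\<in>carrier G.
      act_star G R e \<alpha> g (f h \<otimes>\<^bsub>PicS R\<^esub> bimodule_class R (dom_bimodule R e (inv\<^bsub>G\<^esub> g))) \<otimes>\<^bsub>PicS R\<^esub> f g
        = f (g \<otimes>\<^bsub>G\<^esub> h) \<otimes>\<^bsub>PicS R\<^esub> bimodule_class R (dom_bimodule R e g))}"


section \<open>Partial generalized crossed products\<close>

definition partial_representation ::
  "('g, 'q) monoid_scheme \<Rightarrow> ('m, 's) monoid_scheme \<Rightarrow> ('g \<Rightarrow> 'm) \<Rightarrow> bool"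
  where "partial_representation G S \<theta> \<longleftrightarrow> \<theta> \<in> carrier G \<rightarrow> carrier S \<and> \<theta> \<one>\<^bsub>G\<^esub> = \<one>\<^bsub>S\<^esub> \<and>
    (\<forall>g\<in>carrier G. \<forall>h\<in>carrier G.
      \<theta> g \<otimes>\<^bsub>S\<^esub> \<theta> h \<otimes>\<^bsub>S\<^esub> \<theta> (inv\<^bsub>G\<^esub> h) = \<theta> (g \<otimes>\<^bsub>G\<^esub> h) \<otimes>\<^bsub>S\<^esub> \<theta> (inv\<^bsub>G\<^esub> h) \<and>
      \<theta> (inv\<^bsub>G\<^esub> g) \<otimes>\<^bsub>S\<^esub> \<theta> g \<otimes>\<^bsub>S\<^esub> \<theta> h = \<theta> (inv\<^bsub>G\<^esub> g) \<otimes>\<^bsub>S\<^esub> \<theta> (g \<otimes>\<^bsub>G\<^esub> h))"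

text \<open>The data of a crossed product: the bimodules \<open>\<Gamma>\<^sub>g\<close> and the maps
  \<open>f\<^bsub>g,h\<^esub> : \<Gamma>\<^sub>g \<otimes> \<Gamma>\<^sub>h \<rightarrow> \<Gamma>\<^bsub>gh\<^esub>\<close>.\<close>

record ('g, 'a, 'b) crossed =
  component :: "'g \<Rightarrow> ('a, 'b) bimodule"
  fset :: "'g \<Rightarrow> 'g \<Rightarrow> ('b \<times> 'b \<Rightarrow>\<^sub>0 int) set \<Rightarrow> 'b"

definition factor_set ::
  "('g, 'q) monoid_scheme \<Rightarrow> ('a, 'p) ring_scheme \<Rightarrow> ('g \<Rightarrow> 'a) \<Rightarrow> ('g, 'a, 'b) crossed \<Rightarrow> bool"
  where "factor_set G R i C \<longleftrightarrow>
    (\<forall>g\<in>carrier G. \<forall>h\<in>carrier G.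
      fset C g h \<in> bimod_iso R (tensor R (component C g) (component C h))
        ((component C (g \<otimes>\<^bsub>G\<^esub> h))\<lparr>carrier :=
          {i g \<odot>\<^bsub>component C (g \<otimes>\<^bsub>G\<^esub> h)\<^esub> x | x. x \<in> carrier (component C (g \<otimes>\<^bsub>G\<^esub> h))}\<rparr>)) \<and>
    (\<forall>g\<in>carrier G. \<forall>h\<in>carrier G. \<forall>l\<in>carrier G.
      \<forall>a\<in>carrier (component C g). \<forall>b\<in>carrier (component C h). \<forall>c\<in>carrier (component C l).
      fset C (g \<otimes>\<^bsub>G\<^esub> h) l (pure_tensor R (component C (g \<otimes>\<^bsub>G\<^esub> h)) (component C l)
          (fset C g h (pure_tensor R (component C g) (component C h) a b)) c)
      = fset C g (h \<otimes>\<^bsub>G\<^esub> l) (pure_tensor R (component C g) (component C (h \<otimes>\<^bsub>G\<^esub> l))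
          a (fset C h l (pure_tensor R (component C h) (component C l) b c))))"

text \<open>The family \<open>i\<close> is the family of idempotents \<open>1\<^sub>g\<close> of the partial representation \<open>\<Gamma>\<close> itself:
  \<open>\<Gamma>\<^sub>g \<otimes> \<Gamma>\<^bsub>g\<inverse>\<^esub> \<simeq> R 1\<^sub>g\<close>. These isomorphisms determine it uniquely, because the idempotent \<open>1\<^sub>g\<close> is
  determined by the annihilator of \<open>R 1\<^sub>g\<close>.\<close>

definition crossed_product ::
  "('g, 'q) monoid_scheme \<Rightarrow> ('a, 'p) ring_scheme
    \<Rightarrow> ('g, 'a, (nat \<Rightarrow> 'a) set) crossed \<Rightarrow> bool"
  where "crossed_product G R C \<longleftrightarrow>
    (\<forall>g\<in>carrier G. partially_invertible R (component C g)) \<and>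
    partial_representation G (PicS R) (\<lambda>g. bimodule_class R (component C g)) \<and>
    (\<exists>i. (\<forall>g\<in>carrier G. i g \<in> carrier R \<and> i g \<otimes>\<^bsub>R\<^esub> i g = i g \<and>
            bimodule_isomorphic R (tensor R (component C g) (component C (inv\<^bsub>G\<^esub> g))) (dom_bimodule R i g)) \<and>
         factor_set G R i C)"

text \<open>The ring \<open>\<Delta>(\<Gamma>) = \<Oplus>\<^sub>g \<Gamma>\<^sub>g\<close>. The \<open>k\<close>-component of a product \<open>u v\<close> is the sum of
  \<open>u\<^sub>g v\<^bsub>g\<inverse>k\<^esub>\<close> over the support of \<open>u\<close>.\<close>

definition crossed_support :: "('g, 'q) monoid_scheme \<Rightarrow> ('g, 'a, 'b) crossed \<Rightarrow> ('g \<Rightarrow> 'b) \<Rightarrow> 'g set"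
  where "crossed_support G C u = {g \<in> carrier G. u g \<noteq> \<zero>\<^bsub>component C g\<^esub>}"

definition crossed_carrier :: "('g, 'q) monoid_scheme \<Rightarrow> ('g, 'a, 'b) crossed \<Rightarrow> ('g \<Rightarrow> 'b) set"
  where "crossed_carrier G C =
    {u \<in> (\<Pi>\<^sub>E g\<in>carrier G. carrier (component C g)). finite (crossed_support G C u)}"

definition crossed_mult ::
  "('g, 'q) monoid_scheme \<Rightarrow> ('a, 'p) ring_scheme \<Rightarrow> ('g, 'a, 'b) crossed
    \<Rightarrow> ('g \<Rightarrow> 'b) \<Rightarrow> ('g \<Rightarrow> 'b) \<Rightarrow> 'g \<Rightarrow> 'b"
  where "crossed_mult G R C u v = (\<lambda>k\<in>carrier G.
    \<Oplus>\<^bsub>component C k\<^esub>g\<in>crossed_support G C u. let h = inv\<^bsub>G\<^esub> g \<otimes>\<^bsub>G\<^esub> k in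
      fset C g h (pure_tensor R (component C g) (component C h) (u g) (v h)))"

definition crossed_ring ::
  "('g, 'q) monoid_scheme \<Rightarrow> ('a, 'p) ring_scheme \<Rightarrow> ('g, 'a, 'b) crossed \<Rightarrow> ('g \<Rightarrow> 'b) ring"
  where "crossed_ring G R C = \<lparr>carrier = crossed_carrier G C, monoid.mult = crossed_mult G R C,
    one = (THE w. w \<in> crossed_carrier G C \<and> (\<forall>u\<in>crossed_carrier G C.
             crossed_mult G R C w u = u \<and> crossed_mult G R C u w = u)),
    ring.zero = (\<lambda>g\<in>carrier G. \<zero>\<^bsub>component C g\<^esub>),
    add = (\<lambda>u v. \<lambda>g\<in>carrier G. u g \<oplus>\<^bsub>component C g\<^esub> v g)\<rparr>"

text \<open>The map \<open>\<iota> : R \<rightarrow> \<Gamma>\<^sub>1, r \<mapsto> r 1\<^bsub>\<Delta>(\<Gamma>)\<^esub>\<close>; the identity of \<open>\<Delta>(\<Gamma>)\<close> lives in degree one.\<close>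

definition crossed_iota ::
  "('g, 'q) monoid_scheme \<Rightarrow> ('a, 'p) ring_scheme \<Rightarrow> ('g, 'a, 'b) crossed \<Rightarrow> 'a \<Rightarrow> 'b"
  where "crossed_iota G R C r = r \<odot>\<^bsub>component C \<one>\<^bsub>G\<^esub>\<^esub> (\<one>\<^bsub>crossed_ring G R C\<^esub> \<one>\<^bsub>G\<^esub>)"

definition crossed_iso ::
  "('g, 'q) monoid_scheme \<Rightarrow> ('a, 'p) ring_scheme \<Rightarrow> ('g, 'a, 'b) crossed \<Rightarrow> ('g, 'a, 'c) crossed
    \<Rightarrow> ('g \<Rightarrow> 'b \<Rightarrow> 'c) \<Rightarrow> bool"
  where "crossed_iso G R C C' F \<longleftrightarrow>
    (\<forall>g\<in>carrier G. F g \<in> bimod_iso R (component C g) (component C' g)) \<and>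
    (\<forall>r\<in>carrier R. F \<one>\<^bsub>G\<^esub> (crossed_iota G R C r) = crossed_iota G R C' r) \<and>
    (\<forall>g\<in>carrier G. \<forall>h\<in>carrier G. \<forall>t\<in>carrier (tensor R (component C g) (component C h)).
      F (g \<otimes>\<^bsub>G\<^esub> h) (fset C g h t)
        = fset C' g h (tensor_map R (component C' g) (component C' h) (F g) (F h) t))"

definition crossed_class ::
  "('g, 'q) monoid_scheme \<Rightarrow> ('a, 'p) ring_scheme \<Rightarrow> ('g, 'a, (nat \<Rightarrow> 'a) set) crossed
    \<Rightarrow> ('g, 'a, (nat \<Rightarrow> 'a) set) crossed set"
  where "crossed_class G R C =
    {C'. crossed_product G R C' \<and> (\<exists>F. crossed_iso G R C' C F)}"

definition C_Theta ::
  "('g, 'q) monoid_scheme \<Rightarrow> ('a, 'p) ring_scheme \<Rightarrow> ('g \<Rightarrow> 'a) \<Rightarrow> ('g \<Rightarrow> 'a \<Rightarrow> 'a)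
    \<Rightarrow> ('g, 'a, (nat \<Rightarrow> 'a) set) crossed set set"
  where "C_Theta G R e \<alpha> = {crossed_class G R C | C. crossed_product G R C \<and>
    (\<forall>g\<in>carrier G.
      bimodule_divides R (component C g) (twisted_dom G R e \<alpha> g) \<and>
      bimodule_isomorphic R (tensor R (component C g) (component C (inv\<^bsub>G\<^esub> g))) (dom_bimodule R e g))}"

end

theory Submission
  imports Defs
begin

text \<open>Write \<open>\<tau>\<^sub>g(r) = \<alpha>\<^sub>g(r 1\<^bsub>g\<inverse>\<^esub>)\<close>. A finitely generated projective bimodule \<open>M\<close> divides \<open>(D\<^sub>g)\<^bsub>g\<inverse>\<^esub>\<close> exactly
  if \<open>1\<^sub>g x = x\<close> and \<open>x r = \<tau>\<^sub>g(r) x\<close> for all \<open>x \<in> M\<close>, that is, if \<open>M\<close> is determined by its left module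
  structure. Hence \<open>f(g)\<close> is obtained from \<open>\<Gamma>\<^sub>g\<close> by replacing the right action with the left one, and
  \<open>\<Gamma>\<^sub>g\<close> is recovered as \<open>f(g) \<otimes> (D\<^sub>g)\<^bsub>g\<inverse>\<^esub>\<close>. The swap \<open>y \<otimes> x \<mapsto> x \<otimes> y\<close> identifies
  \<open>\<alpha>\<^sup>*\<^sub>g(f(h) [D\<^bsub>g\<inverse>\<^esub>]) f(g)\<close> with \<open>\<Gamma>\<^sub>g \<otimes> \<Gamma>\<^sub>h\<close> as left modules, so that the cocycle identity is the factor set
  isomorphism \<open>\<Gamma>\<^sub>g \<otimes> \<Gamma>\<^sub>h \<simeq> 1\<^sub>g \<Gamma>\<^bsub>gh\<^esub>\<close>; for \<open>h = g\<inverse>\<close> it is equivalent to \<open>\<Gamma>\<^sub>g \<otimes> \<Gamma>\<^bsub>g\<inverse>\<^esub> \<simeq> D\<^sub>g\<close>.\<close>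

section \<open>Bimodules and their isomorphisms\<close>

text \<open>The criterion for divisibility holds because in a power of (D_g)_{g^{-1}} right
  multiplication by r is left multiplication by tau_g(r) in every coordinate, which passes to
  summands. Conversely, a splitting of R^n into left modules whose first part is fixed by 1_g can be
  cut down to D_g^n, where it is automatically a splitting of bimodules. The swap reverses the
  factors because r x \<otimes> y = x \<otimes> tau_{g^{-1}}(r) y: a scalar moved across Gamma_g
  arrives at the second factor as exactly the action by which f(h) is twisted. Two obstacles shape
  the proof. The idempotents of a crossed product are only known to exist; they are identified with
  1_g because an isomorphism of R i with R j forces i j = j and j i = i. Isomorphism classes are
  sets of bimodules on one fixed type and could be empty, so passing from equal classes to
  isomorphic bimodules needs a representative on that type. The way back from f to Gamma also uses
  f(1) = [R], which comes from Gamma being a partial representation.\<close>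

lemma abelian_group_if_comm_group:
  assumes "comm_group Q" "carrier A = carrier Q" "add A = monoid.mult Q" "ring.zero A = \<one>\<^bsub>Q\<^esub>"
  shows "abelian_group A"
proof -
  interpret Q: comm_group Q by fact
  show ?thesis
    by (rule abelian_groupI) (use assms Q.l_inv_ex in \<open>auto simp: Q.m_ac\<close>)
qed

text \<open>Changing the actions of a module leaves its additive group alone; this carries the group
  axioms over to the record with the new actions.\<close>

lemma abelian_group_cong:
  assumes "abelian_group M" "carrier N = carrier M" "add N = add M" "ring.zero N = ring.zero M"
  shows "abelian_group N"
  using abelian_group_if_comm_group[OF abelian_group.a_comm_group[OF assms(1)], of N] assms by simp

lemma carrier_right_module [simp]: "carrier (right_module M) = carrier M"
  and add_right_module [simp]: "add (right_module M) = add M"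
  and zero_right_module [simp]: "ring.zero (right_module M) = ring.zero M"
  and smult_right_module [simp]: "r \<odot>\<^bsub>right_module M\<^esub> x = x \<triangleleft>\<^bsub>M\<^esub> r"
  by (simp_all add: right_module_def)

context bimodule
begin

lemma rsmult_closed [simp, intro]:
  "\<lbrakk>x \<in> carrier M; a \<in> carrier R\<rbrakk> \<Longrightarrow> x \<triangleleft>\<^bsub>M\<^esub> a \<in> carrier M"
  using module.smult_closed[OF right_module, of a x] by simp

lemma rsmult_add_right:
  "\<lbrakk>x \<in> carrier M; a \<in> carrier R; b \<in> carrier R\<rbrakk> \<Longrightarrow> x \<triangleleft>\<^bsub>M\<^esub> (a \<oplus> b) = x \<triangleleft>\<^bsub>M\<^esub> a \<oplus>\<^bsub>M\<^esub> x \<triangleleft>\<^bsub>M\<^esub> b"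
  using module.smult_l_distr[OF right_module, of a b x] by simp

lemma rsmult_add_left:
  "\<lbrakk>x \<in> carrier M; y \<in> carrier M; a \<in> carrier R\<rbrakk> \<Longrightarrow> (x \<oplus>\<^bsub>M\<^esub> y) \<triangleleft>\<^bsub>M\<^esub> a = x \<triangleleft>\<^bsub>M\<^esub> a \<oplus>\<^bsub>M\<^esub> y \<triangleleft>\<^bsub>M\<^esub> a"
  using module.smult_r_distr[OF right_module, of a x y] by simp

lemma rsmult_mult:
  "\<lbrakk>x \<in> carrier M; a \<in> carrier R; b \<in> carrier R\<rbrakk> \<Longrightarrow> x \<triangleleft>\<^bsub>M\<^esub> (a \<otimes> b) = (x \<triangleleft>\<^bsub>M\<^esub> b) \<triangleleft>\<^bsub>M\<^esub> a"
  using module.smult_assoc1[OF right_module, of a b x] by simp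

lemma rsmult_one [simp]: "x \<in> carrier M \<Longrightarrow> x \<triangleleft>\<^bsub>M\<^esub> \<one> = x"
  using module.smult_one[OF right_module, of x] by simp

end

lemma bimoduleI:
  fixes R (structure) and M (structure)
  assumes "cring R" "abelian_group M"
    and "\<And>a x. \<lbrakk>a \<in> carrier R; x \<in> carrier M\<rbrakk> \<Longrightarrow> a \<odot>\<^bsub>M\<^esub> x \<in> carrier M"
    and "\<And>a b x. \<lbrakk>a \<in> carrier R; b \<in> carrier R; x \<in> carrier M\<rbrakk> \<Longrightarrow>
      (a \<oplus> b) \<odot>\<^bsub>M\<^esub> x = (a \<odot>\<^bsub>M\<^esub> x) \<oplus>\<^bsub>M\<^esub> (b \<odot>\<^bsub>M\<^esub> x)"
    and "\<And>a x y. \<lbrakk>a \<in> carrier R; x \<in> carrier M; y \<in> carrier M\<rbrakk> \<Longrightarrow>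
      a \<odot>\<^bsub>M\<^esub> (x \<oplus>\<^bsub>M\<^esub> y) = (a \<odot>\<^bsub>M\<^esub> x) \<oplus>\<^bsub>M\<^esub> (a \<odot>\<^bsub>M\<^esub> y)"
    and "\<And>a b x. \<lbrakk>a \<in> carrier R; b \<in> carrier R; x \<in> carrier M\<rbrakk> \<Longrightarrow>
      (a \<otimes> b) \<odot>\<^bsub>M\<^esub> x = a \<odot>\<^bsub>M\<^esub> (b \<odot>\<^bsub>M\<^esub> x)"
    and "\<And>x. x \<in> carrier M \<Longrightarrow> \<one> \<odot>\<^bsub>M\<^esub> x = x"
    and "\<And>a x. \<lbrakk>a \<in> carrier R; x \<in> carrier M\<rbrakk> \<Longrightarrow> x \<triangleleft>\<^bsub>M\<^esub> a \<in> carrier M"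
    and "\<And>a b x. \<lbrakk>a \<in> carrier R; b \<in> carrier R; x \<in> carrier M\<rbrakk> \<Longrightarrow>
      x \<triangleleft>\<^bsub>M\<^esub> (a \<oplus> b) = (x \<triangleleft>\<^bsub>M\<^esub> a) \<oplus>\<^bsub>M\<^esub> (x \<triangleleft>\<^bsub>M\<^esub> b)"
    and "\<And>a x y. \<lbrakk>a \<in> carrier R; x \<in> carrier M; y \<in> carrier M\<rbrakk> \<Longrightarrow>
      (x \<oplus>\<^bsub>M\<^esub> y) \<triangleleft>\<^bsub>M\<^esub> a = (x \<triangleleft>\<^bsub>M\<^esub> a) \<oplus>\<^bsub>M\<^esub> (y \<triangleleft>\<^bsub>M\<^esub> a)"
    and "\<And>a b x. \<lbrakk>a \<in> carrier R; b \<in> carrier R; x \<in> carrier M\<rbrakk> \<Longrightarrow>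
      x \<triangleleft>\<^bsub>M\<^esub> (a \<otimes> b) = (x \<triangleleft>\<^bsub>M\<^esub> b) \<triangleleft>\<^bsub>M\<^esub> a"
    and "\<And>x. x \<in> carrier M \<Longrightarrow> x \<triangleleft>\<^bsub>M\<^esub> \<one> = x"
    and "\<And>a b x. \<lbrakk>a \<in> carrier R; b \<in> carrier R; x \<in> carrier M\<rbrakk> \<Longrightarrow>
      (a \<odot>\<^bsub>M\<^esub> x) \<triangleleft>\<^bsub>M\<^esub> b = a \<odot>\<^bsub>M\<^esub> (x \<triangleleft>\<^bsub>M\<^esub> b)"
  shows "bimodule R M"
proof (intro bimodule.intro bimodule_axioms.intro)
  show "module R M"
    by (rule moduleI) (use assms in auto)
  show "module R (right_module M)"
    by (rule moduleI) (use assms in \<open>auto intro: abelian_group_cong\<close>)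
qed (use assms in auto)

lemma bimod_isoI:
  assumes "\<And>x. x \<in> carrier M \<Longrightarrow> h x \<in> carrier N"
    and "\<And>x y. \<lbrakk>x \<in> carrier M; y \<in> carrier M\<rbrakk> \<Longrightarrow> h (x \<oplus>\<^bsub>M\<^esub> y) = h x \<oplus>\<^bsub>N\<^esub> h y"
    and "\<And>r x. \<lbrakk>r \<in> carrier R; x \<in> carrier M\<rbrakk> \<Longrightarrow> h (r \<odot>\<^bsub>M\<^esub> x) = r \<odot>\<^bsub>N\<^esub> h x"
    and "\<And>r x. \<lbrakk>r \<in> carrier R; x \<in> carrier M\<rbrakk> \<Longrightarrow> h (x \<triangleleft>\<^bsub>M\<^esub> r) = h x \<triangleleft>\<^bsub>N\<^esub> r"
    and "bij_betw h (carrier M) (carrier N)"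
  shows "h \<in> bimod_iso R M N"
  using assms by (auto simp: bimod_iso_def mod_iso_def mod_hom_def)

lemma bimod_isoD:
  assumes "h \<in> bimod_iso R M N"
  shows "\<And>x. x \<in> carrier M \<Longrightarrow> h x \<in> carrier N"
    and "\<And>x y. \<lbrakk>x \<in> carrier M; y \<in> carrier M\<rbrakk> \<Longrightarrow> h (x \<oplus>\<^bsub>M\<^esub> y) = h x \<oplus>\<^bsub>N\<^esub> h y"
    and "\<And>r x. \<lbrakk>r \<in> carrier R; x \<in> carrier M\<rbrakk> \<Longrightarrow> h (r \<odot>\<^bsub>M\<^esub> x) = r \<odot>\<^bsub>N\<^esub> h x"
    and "\<And>r x. \<lbrakk>r \<in> carrier R; x \<in> carrier M\<rbrakk> \<Longrightarrow> h (x \<triangleleft>\<^bsub>M\<^esub> r) = h x \<triangleleft>\<^bsub>N\<^esub> r"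
    and "bij_betw h (carrier M) (carrier N)"
  using assms by (auto simp: bimod_iso_def mod_iso_def mod_hom_def)

lemma bimodule_isomorphicE:
  assumes "bimodule_isomorphic R M N"
  obtains h where "h \<in> bimod_iso R M N"
  using assms unfolding bimodule_isomorphic_def by blast

lemma bimodule_isomorphicI: "h \<in> bimod_iso R M N \<Longrightarrow> bimodule_isomorphic R M N"
  unfolding bimodule_isomorphic_def by blast

lemma bimodule_isomorphic_trans:
  assumes "bimodule_isomorphic R L M" "bimodule_isomorphic R M N"
  shows "bimodule_isomorphic R L N"
proof -
  obtain h k where h: "h \<in> bimod_iso R L M" and k: "k \<in> bimod_iso R M N"
    using assms by (auto elim!: bimodule_isomorphicE)
  have "(\<lambda>x. k (h x)) \<in> bimod_iso R L N"
    by (rule bimod_isoI)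
      (simp_all add: bimod_isoD[OF h] bimod_isoD[OF k]
        bij_betw_trans[OF bimod_isoD(5)[OF h] bimod_isoD(5)[OF k], unfolded comp_def])
  then show ?thesis by (rule bimodule_isomorphicI)
qed

text \<open>The identity map, for two records that need agree only on their carriers. It serves
  wherever one action has two formulas that coincide on the elements of the bimodule.\<close>

lemma bimodule_isomorphic_same:
  assumes "carrier M = carrier N"
    and "\<And>x y. \<lbrakk>x \<in> carrier M; y \<in> carrier M\<rbrakk> \<Longrightarrow> x \<oplus>\<^bsub>M\<^esub> y = x \<oplus>\<^bsub>N\<^esub> y"
    and "\<And>r x. \<lbrakk>r \<in> carrier R; x \<in> carrier M\<rbrakk> \<Longrightarrow> r \<odot>\<^bsub>M\<^esub> x = r \<odot>\<^bsub>N\<^esub> x"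
    and "\<And>r x. \<lbrakk>r \<in> carrier R; x \<in> carrier M\<rbrakk> \<Longrightarrow> x \<triangleleft>\<^bsub>M\<^esub> r = x \<triangleleft>\<^bsub>N\<^esub> r"
  shows "bimodule_isomorphic R M N"
  by (rule bimodule_isomorphicI[of "\<lambda>x. x"], rule bimod_isoI)
    (use assms in \<open>auto simp: bij_betw_def inj_on_def\<close>)

lemma bimodule_isomorphic_refl: "bimodule_isomorphic R M M"
  by (rule bimodule_isomorphic_same) auto

text \<open>Every identity for the inverse map is tested by applying the injective h. Only the
  source has to be a bimodule, since the operations of N on the image of h are determined by those
  of M.\<close>

lemma bimod_iso_inv_into:
  assumes "bimodule R M" "h \<in> bimod_iso R M N"
  shows "inv_into (carrier M) h \<in> bimod_iso R N M"
proof -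
  interpret M: bimodule R M by fact
  note hD = bimod_isoD[OF assms(2)]
  let ?k = "inv_into (carrier M) h"
  have inj: "inj_on h (carrier M)" and surj: "h ` carrier M = carrier N"
    using hD(5) by (auto simp: bij_betw_def)
  have hk: "h (?k y) = y" "?k y \<in> carrier M" if "y \<in> carrier N" for y
    using that surj by (auto intro: f_inv_into_f inv_into_into)
  have eq: "?k y = x" if "x \<in> carrier M" "y = h x" for x y
    using inj that by simp
  show ?thesis
  proof (rule bimod_isoI)
    show "bij_betw ?k (carrier N) (carrier M)"
      using hD(5) by (rule bij_betw_inv_into)
  qed (auto intro!: eq simp: hk hD)
qed

lemma bimodule_isomorphic_sym:
  "\<lbrakk>bimodule R M; bimodule_isomorphic R M N\<rbrakk> \<Longrightarrow> bimodule_isomorphic R N M"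
  by (meson bimod_iso_inv_into bimodule_isomorphicE bimodule_isomorphicI)

lemma hom_add_monoid_iff:
  "h \<in> hom (add_monoid A) (add_monoid B) \<longleftrightarrow> h \<in> carrier A \<rightarrow> carrier B \<and>
    (\<forall>x\<in>carrier A. \<forall>y\<in>carrier A. h (x \<oplus>\<^bsub>A\<^esub> y) = h x \<oplus>\<^bsub>B\<^esub> h y)"
  by (auto simp: hom_def)

section \<open>The universal property of the tensor product\<close>

lemma tensor_free_simps [simp]:
  "x \<in> carrier (tensor_free M N) \<longleftrightarrow> Poly_Mapping.keys x \<subseteq> carrier M \<times> carrier N"
  "x \<otimes>\<^bsub>tensor_free M N\<^esub> y = x + y"
  "\<one>\<^bsub>tensor_free M N\<^esub> = 0"
  by (simp_all add: tensor_free_def)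

lemma comm_group_tensor_free: "comm_group (tensor_free M N)"
  unfolding tensor_free_def by (rule abelian_free_Abelian_group)

lemma tensor_relations_subset:
  assumes "bimodule R M" "bimodule R N"
  shows "tensor_relations R M N \<subseteq> carrier (tensor_free M N)"
proof -
  interpret M: bimodule R M by fact
  interpret N: bimodule R N by fact
  show ?thesis
    by (auto simp: tensor_relations_def dest!: subsetD[OF keys_diff])
qed

lemma tensor_kernel_subgroup:
  assumes "bimodule R M" "bimodule R N"
  shows "subgroup (tensor_kernel R M N) (tensor_free M N)"
  unfolding tensor_kernel_def
  by (rule group.generate_is_subgroup[OF comm_group.axioms(2)[OF comm_group_tensor_free]
        tensor_relations_subset[OF assms]])

lemma tensor_kernel_normal:
  assumes "bimodule R M" "bimodule R N"
  shows "tensor_kernel R M N \<lhd> tensor_free M N"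
  by (rule comm_group.subgroup_imp_normal[OF comm_group_tensor_free tensor_kernel_subgroup[OF assms]])

lemma tensor_coset_eqI:
  assumes "bimodule R M" "bimodule R N"
    and "a \<in> carrier (tensor_free M N)" "b \<in> carrier (tensor_free M N)" "a - b \<in> tensor_kernel R M N"
  shows "tensor_kernel R M N #>\<^bsub>tensor_free M N\<^esub> a = tensor_kernel R M N #>\<^bsub>tensor_free M N\<^esub> b"
proof -
  interpret F: comm_group "tensor_free M N" by (rule comm_group_tensor_free)
  have "a \<otimes>\<^bsub>tensor_free M N\<^esub> inv\<^bsub>tensor_free M N\<^esub> b = a - b"
    using assms(4) by (simp add: tensor_free_def)
  then have "a \<in> tensor_kernel R M N #>\<^bsub>tensor_free M N\<^esub> b"
    using assms subgroup.rcos_module_rev[OF tensor_kernel_subgroup[OF assms(1,2)] F.group_axioms]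
    by metis
  then show ?thesis
    using assms(4) F.repr_independence tensor_kernel_subgroup[OF assms(1,2)] by metis
qed

lemma carrier_tensor:
  "carrier (tensor R M N) =
    (\<lambda>c. tensor_kernel R M N #>\<^bsub>tensor_free M N\<^esub> c) ` carrier (tensor_free M N)"
  by (simp add: tensor_def Let_def carrier_FactGroup)

lemma add_tensor_coset:
  assumes "bimodule R M" "bimodule R N"
    and "a \<in> carrier (tensor_free M N)" "b \<in> carrier (tensor_free M N)"
  shows "(tensor_kernel R M N #>\<^bsub>tensor_free M N\<^esub> a) \<oplus>\<^bsub>tensor R M N\<^esub>
     (tensor_kernel R M N #>\<^bsub>tensor_free M N\<^esub> b) = tensor_kernel R M N #>\<^bsub>tensor_free M N\<^esub> (a + b)"
  using normal.rcos_sum[OF tensor_kernel_normal[OF assms(1,2)] assms(3,4)]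
  by (simp add: tensor_def Let_def)

lemma abelian_group_tensor:
  assumes "bimodule R M" "bimodule R N"
  shows "abelian_group (tensor R M N)"
  by (rule abelian_group_if_comm_group[OF
        comm_group.abelian_FactGroup[OF comm_group_tensor_free tensor_kernel_subgroup[OF assms]]])
    (simp_all add: tensor_def Let_def)

lemma hom_tensor_iff:
  "h \<in> hom (add_monoid (tensor R M N)) B \<longleftrightarrow> h \<in> hom (tensor_free M N Mod tensor_kernel R M N) B"
  by (simp add: hom_def tensor_def Let_def)

section \<open>Pure tensors and induction over tensors\<close>

lemma pure_tensor_closed:
  assumes "x \<in> carrier M" "y \<in> carrier N"
  shows "pure_tensor R M N x y \<in> carrier (tensor R M N)"
  using assms by (auto simp: carrier_tensor pure_tensor_def)

text \<open>This fact and the next stay at the level of carrier membership: some later proofs switch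
  off the rewriting of membership into a condition on keys and use them instead.\<close>

lemma keys_frag_of_pair:
  "\<lbrakk>x \<in> carrier M; y \<in> carrier N\<rbrakk> \<Longrightarrow> frag_of (x, y) \<in> carrier (tensor_free M N)"
  by simp

lemma frag_add_closed:
  "\<lbrakk>a \<in> carrier (tensor_free M N); b \<in> carrier (tensor_free M N)\<rbrakk> \<Longrightarrow> a + b \<in> carrier (tensor_free M N)"
  by (metis comm_group_tensor_free comm_group_def comm_monoid_def monoid.m_closed tensor_free_simps(2))

lemma pure_tensor_add_left:
  assumes "bimodule R M" "bimodule R N" "x \<in> carrier M" "x' \<in> carrier M" "y \<in> carrier N"
  shows "pure_tensor R M N (x \<oplus>\<^bsub>M\<^esub> x') y
    = pure_tensor R M N x y \<oplus>\<^bsub>tensor R M N\<^esub> pure_tensor R M N x' y"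
proof -
  interpret M: bimodule R M by fact
  have "frag_of (x \<oplus>\<^bsub>M\<^esub> x', y) - (frag_of (x, y) + frag_of (x', y)) \<in> tensor_kernel R M N"
    unfolding tensor_kernel_def diff_diff_add[symmetric]
    by (rule generate.incl) (use assms in \<open>auto simp: tensor_relations_def\<close>)
  then have "tensor_kernel R M N #>\<^bsub>tensor_free M N\<^esub> frag_of (x \<oplus>\<^bsub>M\<^esub> x', y)
      = tensor_kernel R M N #>\<^bsub>tensor_free M N\<^esub> (frag_of (x, y) + frag_of (x', y))"
    by (rule tensor_coset_eqI[OF assms(1,2), rotated 2])
      (use assms in \<open>auto intro!: frag_add_closed simp del: tensor_free_simps(1) simp: keys_frag_of_pair\<close>)
  then show ?thesis
    by (simp add: pure_tensor_def add_tensor_coset assms)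
qed

lemma pure_tensor_add_right:
  assumes "bimodule R M" "bimodule R N" "x \<in> carrier M" "y \<in> carrier N" "y' \<in> carrier N"
  shows "pure_tensor R M N x (y \<oplus>\<^bsub>N\<^esub> y')
    = pure_tensor R M N x y \<oplus>\<^bsub>tensor R M N\<^esub> pure_tensor R M N x y'"
proof -
  interpret N: bimodule R N by fact
  have "frag_of (x, y \<oplus>\<^bsub>N\<^esub> y') - (frag_of (x, y) + frag_of (x, y')) \<in> tensor_kernel R M N"
    unfolding tensor_kernel_def diff_diff_add[symmetric]
    by (rule generate.incl) (use assms in \<open>auto simp: tensor_relations_def\<close>)
  then have "tensor_kernel R M N #>\<^bsub>tensor_free M N\<^esub> frag_of (x, y \<oplus>\<^bsub>N\<^esub> y')
      = tensor_kernel R M N #>\<^bsub>tensor_free M N\<^esub> (frag_of (x, y) + frag_of (x, y'))"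
    by (rule tensor_coset_eqI[OF assms(1,2), rotated 2])
      (use assms in \<open>auto intro!: frag_add_closed simp del: tensor_free_simps(1) simp: keys_frag_of_pair\<close>)
  then show ?thesis
    by (simp add: pure_tensor_def add_tensor_coset assms)
qed

lemma pure_tensor_balanced:
  assumes "bimodule R M" "bimodule R N" "x \<in> carrier M" "y \<in> carrier N" "r \<in> carrier R"
  shows "pure_tensor R M N (x \<triangleleft>\<^bsub>M\<^esub> r) y = pure_tensor R M N x (r \<odot>\<^bsub>N\<^esub> y)"
proof -
  interpret M: bimodule R M by fact
  interpret N: bimodule R N by fact
  have "frag_of (x \<triangleleft>\<^bsub>M\<^esub> r, y) - frag_of (x, r \<odot>\<^bsub>N\<^esub> y) \<in> tensor_kernel R M N"
    unfolding tensor_kernel_def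
    by (rule generate.incl) (use assms in \<open>auto simp: tensor_relations_def\<close>)
  then show ?thesis
    unfolding pure_tensor_def using assms
    by (intro tensor_coset_eqI) auto
qed

text \<open>Zero and negatives need no cases of their own: 0 \<otimes> y is zero and -(x \<otimes>
  y) = (-x) \<otimes> y, so the sums of pure tensors already form a group.\<close>

lemma tensor_induct [consumes 3, case_names pure add]:
  assumes "bimodule R M" "bimodule R N" "t \<in> carrier (tensor R M N)"
    and pure: "\<And>x y. \<lbrakk>x \<in> carrier M; y \<in> carrier N\<rbrakk> \<Longrightarrow> P (pure_tensor R M N x y)"
    and add: "\<And>s t. \<lbrakk>s \<in> carrier (tensor R M N); t \<in> carrier (tensor R M N); P s; P t\<rbrakk>
      \<Longrightarrow> P (s \<oplus>\<^bsub>tensor R M N\<^esub> t)"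
  shows "P t"
proof -
  interpret M: bimodule R M by fact
  interpret N: bimodule R N by fact
  interpret T: abelian_group "tensor R M N" by (rule abelian_group_tensor) fact+
  have zero_pure: "pure_tensor R M N \<zero>\<^bsub>M\<^esub> y = \<zero>\<^bsub>tensor R M N\<^esub>" if "y \<in> carrier N" for y
  proof -
    \<comment> \<open>0 \<otimes> y equals its own double and therefore cancels to zero.\<close>
    have "pure_tensor R M N \<zero>\<^bsub>M\<^esub> y \<oplus>\<^bsub>tensor R M N\<^esub> pure_tensor R M N \<zero>\<^bsub>M\<^esub> y = pure_tensor R M N \<zero>\<^bsub>M\<^esub> y"
      using pure_tensor_add_left[OF assms(1,2), of "\<zero>\<^bsub>M\<^esub>" "\<zero>\<^bsub>M\<^esub>" y] that by simp
    then show ?thesis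
      using that pure_tensor_closed[of "\<zero>\<^bsub>M\<^esub>" M y N R] by simp
  qed
  have minus_pure: "\<ominus>\<^bsub>tensor R M N\<^esub> pure_tensor R M N x y = pure_tensor R M N (\<ominus>\<^bsub>M\<^esub> x) y"
    if "x \<in> carrier M" "y \<in> carrier N" for x y
  proof (rule T.minus_equality)
    show "pure_tensor R M N (\<ominus>\<^bsub>M\<^esub> x) y \<oplus>\<^bsub>tensor R M N\<^esub> pure_tensor R M N x y = \<zero>\<^bsub>tensor R M N\<^esub>"
      using that by (simp add: pure_tensor_add_left[OF assms(1,2), symmetric] M.l_neg zero_pure)
  qed (use that in \<open>auto intro: pure_tensor_closed\<close>)
  let ?q = "\<lambda>c. tensor_kernel R M N #>\<^bsub>tensor_free M N\<^esub> c"
  have q_closed: "?q c \<in> carrier (tensor R M N)" if "Poly_Mapping.keys c \<subseteq> carrier M \<times> carrier N" for c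
    using that by (auto simp: carrier_tensor)
  have q_zero: "?q 0 = \<zero>\<^bsub>tensor R M N\<^esub>"
    using group.coset_mult_one[OF comm_group.axioms(2)[OF comm_group_tensor_free],
        OF subgroup.subset[OF tensor_kernel_subgroup[OF assms(1,2)]]]
    by (simp add: tensor_def Let_def)
  have q_diff: "?q (c - d) = ?q c \<ominus>\<^bsub>tensor R M N\<^esub> ?q d"
    if c: "Poly_Mapping.keys c \<subseteq> carrier M \<times> carrier N"
    and d: "Poly_Mapping.keys d \<subseteq> carrier M \<times> carrier N" for c d
  proof -
    have cd: "Poly_Mapping.keys (c - d) \<subseteq> carrier M \<times> carrier N"
      using c d keys_diff[of c d] by blast
    have "?q (c - d) \<oplus>\<^bsub>tensor R M N\<^esub> ?q d = ?q c"
      using add_tensor_coset[OF assms(1,2), of "c - d" d] cd d by simp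
    then show ?thesis
      using q_closed[OF cd] q_closed[OF d] q_closed[OF c] T.add.inv_solve_right
      by (simp add: a_minus_def)
  qed
  obtain c where c: "Poly_Mapping.keys c \<subseteq> carrier M \<times> carrier N" "t = ?q c"
    using assms(3) by (auto simp: carrier_tensor)
  \<comment> \<open>The induction principle of the free abelian group passes through differences, so
    the claim is carried for the coset of c and for its negative together.\<close>
  have "P (?q c) \<and> P (\<ominus>\<^bsub>tensor R M N\<^esub> ?q c)"
    using c(1)
  proof (induction c rule: free_Abelian_group_induct[consumes 1, case_names zero diff frag])
    case zero
    show ?case
      using pure[of "\<zero>\<^bsub>M\<^esub>" "\<zero>\<^bsub>N\<^esub>"] T.add.inv_one by (simp add: q_zero zero_pure a_inv_def)
  next
    case (diff c d)
    have "\<ominus>\<^bsub>tensor R M N\<^esub> ?q (c - d) = ?q d \<oplus>\<^bsub>tensor R M N\<^esub> \<ominus>\<^bsub>tensor R M N\<^esub> ?q c"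
      using diff q_closed by (simp add: q_diff T.minus_add T.a_comm a_minus_def T.minus_minus)
    then show ?case
      using diff q_closed by (simp add: add q_diff a_minus_def)
  next
    case (frag a)
    then show ?case
      using pure minus_pure by (auto simp flip: pure_tensor_def)
  qed
  then show ?thesis
    using c by simp
qed

text \<open>The extension of \<phi> to the free abelian group vanishes on the three families of
  relations, hence on the subgroup they generate, and so factors through the quotient. Only
  additivity is asserted; compatibility with the actions is treated in
  \<open>tensor_bimod_isoI\<close>.\<close>

lemma tensor_lift:
  assumes "bimodule R M" "bimodule R N" "abelian_group A"
    and closed: "\<And>x y. \<lbrakk>x \<in> carrier M; y \<in> carrier N\<rbrakk> \<Longrightarrow> \<phi> x y \<in> carrier A"
    and add_left: "\<And>x x' y. \<lbrakk>x \<in> carrier M; x' \<in> carrier M; y \<in> carrier N\<rbrakk> \<Longrightarrow>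
      \<phi> (x \<oplus>\<^bsub>M\<^esub> x') y = \<phi> x y \<oplus>\<^bsub>A\<^esub> \<phi> x' y"
    and add_right: "\<And>x y y'. \<lbrakk>x \<in> carrier M; y \<in> carrier N; y' \<in> carrier N\<rbrakk> \<Longrightarrow>
      \<phi> x (y \<oplus>\<^bsub>N\<^esub> y') = \<phi> x y \<oplus>\<^bsub>A\<^esub> \<phi> x y'"
    and balanced: "\<And>x r y. \<lbrakk>x \<in> carrier M; r \<in> carrier R; y \<in> carrier N\<rbrakk> \<Longrightarrow>
      \<phi> (x \<triangleleft>\<^bsub>M\<^esub> r) y = \<phi> x (r \<odot>\<^bsub>N\<^esub> y)"
  obtains h where "h \<in> hom (add_monoid (tensor R M N)) (add_monoid A)"
    and "\<And>x y. \<lbrakk>x \<in> carrier M; y \<in> carrier N\<rbrakk> \<Longrightarrow> h (pure_tensor R M N x y) = \<phi> x y"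
proof -
  interpret M: bimodule R M by fact
  interpret N: bimodule R N by fact
  interpret A: abelian_group A by fact
  have "case_prod \<phi> ` (carrier M \<times> carrier N) \<subseteq> carrier A"
    using closed by auto
  then obtain f where f: "f \<in> hom (tensor_free M N) (add_monoid A)"
    and f_of: "\<And>p. p \<in> carrier M \<times> carrier N \<Longrightarrow> f (frag_of p) = case_prod \<phi> p"
    unfolding tensor_free_def by (rule A.add.free_Abelian_group_universal) blast
  interpret f: group_hom "tensor_free M N" "add_monoid A" f
    by (intro group_hom.intro group_hom_axioms.intro f A.add.group_axioms
        comm_group.axioms(2)[OF comm_group_tensor_free])
  have keys_diff': "Poly_Mapping.keys (a - b) \<subseteq> S"
    if "Poly_Mapping.keys a \<subseteq> S" "Poly_Mapping.keys b \<subseteq> S" for a b :: "'x \<Rightarrow>\<^sub>0 int" and S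
    using that keys_diff[of a b] by blast
  have f_diff: "f (a - b) = f a \<ominus>\<^bsub>A\<^esub> f b"
    if "Poly_Mapping.keys a \<subseteq> carrier M \<times> carrier N" "Poly_Mapping.keys b \<subseteq> carrier M \<times> carrier N" for a b
  proof -
    have ab: "Poly_Mapping.keys (a - b) \<subseteq> carrier M \<times> carrier N"
      using that by (rule keys_diff')
    have "f (a - b) \<oplus>\<^bsub>A\<^esub> f b = f a"
      using f.hom_mult[of "a - b" b] ab that by simp
    moreover have "f (a - b) \<in> carrier A" "f b \<in> carrier A" "f a \<in> carrier A"
      using f.hom_closed ab that by simp_all
    ultimately show ?thesis
      using A.add.inv_solve_right by (simp add: a_minus_def)
  qed
  have rel: "f c = \<zero>\<^bsub>A\<^esub>" if "c \<in> tensor_relations R M N" for c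
  proof -
    \<comment> \<open>The extension sends the relations to a + b - a - b or to a - a; these are the
      two cancellations required.\<close>
    have sub2: "a \<oplus>\<^bsub>A\<^esub> b \<ominus>\<^bsub>A\<^esub> a \<ominus>\<^bsub>A\<^esub> b = \<zero>\<^bsub>A\<^esub>" if "a \<in> carrier A" "b \<in> carrier A" for a b
      using that by (simp add: a_minus_def A.a_comm[of a b] A.a_assoc A.r_neg)
    have sub1: "a \<ominus>\<^bsub>A\<^esub> a = \<zero>\<^bsub>A\<^esub>" if "a \<in> carrier A" for a
      using that by (simp add: a_minus_def A.r_neg)
    from that consider
      (left) x x' y where "x \<in> carrier M" "x' \<in> carrier M" "y \<in> carrier N"
        "c = frag_of (x \<oplus>\<^bsub>M\<^esub> x', y) - frag_of (x, y) - frag_of (x', y)"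
    | (right) x y y' where "x \<in> carrier M" "y \<in> carrier N" "y' \<in> carrier N"
        "c = frag_of (x, y \<oplus>\<^bsub>N\<^esub> y') - frag_of (x, y) - frag_of (x, y')"
    | (balanced) x r y where "x \<in> carrier M" "r \<in> carrier R" "y \<in> carrier N"
        "c = frag_of (x \<triangleleft>\<^bsub>M\<^esub> r, y) - frag_of (x, r \<odot>\<^bsub>N\<^esub> y)"
      unfolding tensor_relations_def by (elim UnE CollectE exE conjE)
    then show ?thesis
    proof cases
      case left
      then show ?thesis
        by (simp add: f_diff keys_diff' f_of add_left sub2 closed)
    next
      case right
      then show ?thesis
        by (simp add: f_diff keys_diff' f_of add_right sub2 closed)
    next
      case balanced
      then show ?thesis
        by (simp add: f_diff keys_diff' f_of assms(7) sub1 closed)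
    qed
  qed
  have ker: "f c = \<zero>\<^bsub>A\<^esub>" if "c \<in> tensor_kernel R M N" for c
  proof -
    have "tensor_kernel R M N \<subseteq> kernel (tensor_free M N) (add_monoid A) f"
      unfolding tensor_kernel_def
      by (rule f.G.generate_subgroup_incl[OF _ f.subgroup_kernel])
        (use rel tensor_relations_subset[OF assms(1,2)] in \<open>auto simp: kernel_def simp del: tensor_free_simps(1)\<close>)
    then show ?thesis
      using that by (auto simp: kernel_def)
  qed
  have "\<exists>h. h \<in> hom (tensor_free M N Mod tensor_kernel R M N) (add_monoid A) \<and>
      (\<forall>c\<in>carrier (tensor_free M N). h (tensor_kernel R M N #>\<^bsub>tensor_free M N\<^esub> c) = f c)"
  proof -
    have eq: "f c = f d" if "c \<in> carrier (tensor_free M N)" "d \<in> carrier (tensor_free M N)"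
      "tensor_kernel R M N #>\<^bsub>tensor_free M N\<^esub> c = tensor_kernel R M N #>\<^bsub>tensor_free M N\<^esub> d" for c d
    proof -
      have "c \<in> tensor_kernel R M N #>\<^bsub>tensor_free M N\<^esub> d"
        using f.G.rcos_self[OF that(1) tensor_kernel_subgroup[OF assms(1,2)]] that(3) by simp
      then obtain k where k: "k \<in> tensor_kernel R M N" "c = k + d"
        by (auto simp: r_coset_def)
      then have "k \<in> carrier (tensor_free M N)"
        using subgroup.mem_carrier[OF tensor_kernel_subgroup[OF assms(1,2)]] by blast
      then show ?thesis
        using f.hom_mult[of k d] that ker[OF k(1)] k(2) f.hom_closed[of d] by simp
    qed
    show ?thesis
      using FactGroup_universal[OF f tensor_kernel_normal[OF assms(1,2)] eq] by metis
  qed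
  then obtain h where h: "h \<in> hom (add_monoid (tensor R M N)) (add_monoid A)"
    and "\<And>c. c \<in> carrier (tensor_free M N) \<Longrightarrow> h (tensor_kernel R M N #>\<^bsub>tensor_free M N\<^esub> c) = f c"
    unfolding hom_tensor_iff by blast
  then have "h (pure_tensor R M N x y) = \<phi> x y" if "x \<in> carrier M" "y \<in> carrier N" for x y
    using that f_of by (simp add: pure_tensor_def)
  with h show thesis by (rule that)
qed

section \<open>The bimodule structure of the tensor product\<close>

text \<open>The induced map of free groups sends each defining relation to one of the same kind, so
  it maps kernel to kernel and \<open>tensor_map\<close> does not depend on the representative. This
  requires h to respect the right action and k the left one, because these are the actions that meet
  in the balancing relation.\<close>

lemma tensor_map_coset:
  assumes "bimodule R M" "bimodule R N" "bimodule R M'" "bimodule R N'"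
    and h: "h \<in> mod_hom R (right_module M) (right_module M')" and k: "k \<in> mod_hom R N N'"
    and c: "c \<in> carrier (tensor_free M N)"
  shows "tensor_map R M' N' h k (tensor_kernel R M N #>\<^bsub>tensor_free M N\<^esub> c) =
    tensor_kernel R M' N' #>\<^bsub>tensor_free M' N'\<^esub> frag_extend (\<lambda>(x, y). frag_of (h x, k y)) c"
    and "frag_extend (\<lambda>(x, y). frag_of (h x, k y)) c \<in> carrier (tensor_free M' N')"
proof -
  interpret F: comm_group "tensor_free M N" by (rule comm_group_tensor_free)
  interpret F': comm_group "tensor_free M' N'" by (rule comm_group_tensor_free)
  interpret K': subgroup "tensor_kernel R M' N'" "tensor_free M' N'"
    by (rule tensor_kernel_subgroup) fact+
  let ?g = "frag_extend (\<lambda>(x, y). frag_of (h x, k y))"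
  let ?K = "tensor_kernel R M N" and ?K' = "tensor_kernel R M' N'"
  have closed: "?g d \<in> carrier (tensor_free M' N')" if "d \<in> carrier (tensor_free M N)" for d
  proof -
    have "Poly_Mapping.keys (case p of (x, y) \<Rightarrow> frag_of (h x, k y)) \<subseteq> carrier M' \<times> carrier N'"
      if "p \<in> carrier M \<times> carrier N" for p
      using h k that by (auto simp: mod_hom_def)
    then show ?thesis
      using that keys_frag_extend[of "\<lambda>(x, y). frag_of (h x, k y)" d] by simp blast
  qed
  show "?g c \<in> carrier (tensor_free M' N')"
    using closed c by blast
  have rel: "?g d \<in> tensor_relations R M' N'" if "d \<in> tensor_relations R M N" for d
    using that unfolding tensor_relations_def[of R M N]
  proof (elim UnE CollectE exE conjE)
    fix x x' y
    assume *: "d = frag_of (x \<oplus>\<^bsub>M\<^esub> x', y) - frag_of (x, y) - frag_of (x', y)"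
      "x \<in> carrier M" "x' \<in> carrier M" "y \<in> carrier N"
    have "?g d = frag_of (h x \<oplus>\<^bsub>M'\<^esub> h x', k y) - frag_of (h x, k y) - frag_of (h x', k y)"
      "h x \<in> carrier M'" "h x' \<in> carrier M'" "k y \<in> carrier N'"
      using * h k by (auto simp: frag_extend_diff mod_hom_def)
    then show "?g d \<in> tensor_relations R M' N'"
      unfolding tensor_relations_def by blast
  next
    fix x y y'
    assume *: "d = frag_of (x, y \<oplus>\<^bsub>N\<^esub> y') - frag_of (x, y) - frag_of (x, y')"
      "x \<in> carrier M" "y \<in> carrier N" "y' \<in> carrier N"
    have "?g d = frag_of (h x, k y \<oplus>\<^bsub>N'\<^esub> k y') - frag_of (h x, k y) - frag_of (h x, k y')"
      "h x \<in> carrier M'" "k y \<in> carrier N'" "k y' \<in> carrier N'"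
      using * h k by (auto simp: frag_extend_diff mod_hom_def)
    then show "?g d \<in> tensor_relations R M' N'"
      unfolding tensor_relations_def by blast
  next
    fix x r y
    assume *: "d = frag_of (x \<triangleleft>\<^bsub>M\<^esub> r, y) - frag_of (x, r \<odot>\<^bsub>N\<^esub> y)"
      "x \<in> carrier M" "r \<in> carrier R" "y \<in> carrier N"
    have "?g d = frag_of (h x \<triangleleft>\<^bsub>M'\<^esub> r, k y) - frag_of (h x, r \<odot>\<^bsub>N'\<^esub> k y)"
      "h x \<in> carrier M'" "r \<in> carrier R" "k y \<in> carrier N'"
      using * h k by (auto simp: frag_extend_diff mod_hom_def)
    then show "?g d \<in> tensor_relations R M' N'"
      unfolding tensor_relations_def by blast
  qed
  note rels = tensor_relations_subset[OF assms(1,2)] tensor_relations_subset[OF assms(3,4)]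
  have ker: "?g d \<in> ?K'" if "d \<in> ?K" for d
    using that unfolding tensor_kernel_def[of R M N]
  proof (induction rule: generate.induct)
    case one
    then show ?case
      using K'.one_closed by simp
  next
    case (incl d)
    then show ?case
      unfolding tensor_kernel_def by (intro generate.incl rel)
  next
    case (inv d)
    then have "inv\<^bsub>tensor_free M N\<^esub> d = - d" and "?g d \<in> ?K'"
      using rels(1) rel unfolding tensor_kernel_def
      by (auto simp: tensor_free_def subset_iff intro: generate.incl)
    moreover from this have "inv\<^bsub>tensor_free M' N'\<^esub> (?g d) = - ?g d"
      using K'.mem_carrier by (auto simp: tensor_free_def)
    ultimately show ?case
      using K'.m_inv_closed[of "?g d"] by (simp add: frag_extend_minus)
  next
    case (eng a b)
    then show ?case
      using K'.m_closed[of "?g a" "?g b"] by (simp add: frag_extend_add)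
  qed
  \<comment> \<open>Zero lies in the kernel, so c lies in its own coset; the second inclusion below
    rests on this.\<close>
  have zero: "0 \<in> ?K"
    using subgroup.one_closed[OF tensor_kernel_subgroup[OF assms(1,2)]] by simp
  show "tensor_map R M' N' h k (?K #>\<^bsub>tensor_free M N\<^esub> c) = ?K' #>\<^bsub>tensor_free M' N'\<^esub> ?g c"
  proof
    show "tensor_map R M' N' h k (?K #>\<^bsub>tensor_free M N\<^esub> c) \<subseteq> ?K' #>\<^bsub>tensor_free M' N'\<^esub> ?g c"
    proof
      fix t assume "t \<in> tensor_map R M' N' h k (?K #>\<^bsub>tensor_free M N\<^esub> c)"
      then obtain a b where ab: "a \<in> ?K'" "b \<in> ?K" "t = a + ?g (b + c)"
        by (auto simp: tensor_map_def set_mult_def r_coset_def)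
      then have "t = (a + ?g b) + ?g c" "a + ?g b \<in> ?K'"
        using K'.m_closed[OF ab(1) ker[OF ab(2)]] by (simp_all add: frag_extend_add add.assoc)
      then show "t \<in> ?K' #>\<^bsub>tensor_free M' N'\<^esub> ?g c"
        by (auto simp: r_coset_def)
    qed
    show "?K' #>\<^bsub>tensor_free M' N'\<^esub> ?g c \<subseteq> tensor_map R M' N' h k (?K #>\<^bsub>tensor_free M N\<^esub> c)"
    proof
      fix t assume "t \<in> ?K' #>\<^bsub>tensor_free M' N'\<^esub> ?g c"
      then obtain a where a: "a \<in> ?K'" "t = a + ?g c"
        by (auto simp: r_coset_def)
      have "c \<in> ?K #>\<^bsub>tensor_free M N\<^esub> c"
        using zero by (force simp: r_coset_def)
      then show "t \<in> tensor_map R M' N' h k (?K #>\<^bsub>tensor_free M N\<^esub> c)"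
        using a by (auto simp: tensor_map_def set_mult_def)
    qed
  qed
qed

lemma tensor_map_pure:
  assumes "bimodule R M" "bimodule R N" "bimodule R M'" "bimodule R N'"
    and "h \<in> mod_hom R (right_module M) (right_module M')" "k \<in> mod_hom R N N'"
    and "x \<in> carrier M" "y \<in> carrier N"
  shows "tensor_map R M' N' h k (pure_tensor R M N x y) = pure_tensor R M' N' (h x) (k y)"
  using tensor_map_coset(1)[OF assms(1-6), of "frag_of (x, y)"] assms(7,8)
  by (simp add: pure_tensor_def)

lemma tensor_map_hom:
  assumes "bimodule R M" "bimodule R N" "bimodule R M'" "bimodule R N'"
    and "h \<in> mod_hom R (right_module M) (right_module M')" "k \<in> mod_hom R N N'"
  shows "tensor_map R M' N' h k \<in> hom (add_monoid (tensor R M N)) (add_monoid (tensor R M' N'))"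
  unfolding hom_add_monoid_iff unfolding carrier_tensor
  by (auto simp: tensor_map_coset[OF assms] add_tensor_coset[OF assms(1,2)]
      add_tensor_coset[OF assms(3,4)] frag_extend_add frag_add_closed
      simp del: tensor_free_simps(1))

lemma tensor_smult: "r \<odot>\<^bsub>tensor R M N\<^esub> t = tensor_map R M N (\<lambda>x. r \<odot>\<^bsub>M\<^esub> x) (\<lambda>y. y) t"
  and tensor_rsmult: "t \<triangleleft>\<^bsub>tensor R M N\<^esub> r = tensor_map R M N (\<lambda>x. x) (\<lambda>y. y \<triangleleft>\<^bsub>N\<^esub> r) t"
  by (simp_all add: tensor_def Let_def)

lemma mod_hom_id: "(\<lambda>x. x) \<in> mod_hom R M M"
  by (simp add: mod_hom_def)

text \<open>Associativity of the two actions makes left multiplication a map of right modules, hence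
  a legitimate first factor of \<open>tensor_map\<close>; the next lemma is the dual for the second
  factor.\<close>

lemma (in bimodule) mod_hom_smult:
  "r \<in> carrier R \<Longrightarrow> (\<lambda>x. r \<odot>\<^bsub>M\<^esub> x) \<in> mod_hom R (right_module M) (right_module M)"
  by (simp add: mod_hom_def smult_r_distr left_right_assoc)

lemma (in bimodule) mod_hom_rsmult:
  "r \<in> carrier R \<Longrightarrow> (\<lambda>x. x \<triangleleft>\<^bsub>M\<^esub> r) \<in> mod_hom R M M"
  by (simp add: mod_hom_def rsmult_add_left left_right_assoc)

lemma tensor_smult_pure:
  assumes "bimodule R M" "bimodule R N" "x \<in> carrier M" "y \<in> carrier N" "r \<in> carrier R"
  shows "r \<odot>\<^bsub>tensor R M N\<^esub> pure_tensor R M N x y = pure_tensor R M N (r \<odot>\<^bsub>M\<^esub> x) y"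
  unfolding tensor_smult using assms
  by (intro tensor_map_pure mod_hom_id bimodule.mod_hom_smult)

lemma tensor_rsmult_pure:
  assumes "bimodule R M" "bimodule R N" "x \<in> carrier M" "y \<in> carrier N" "r \<in> carrier R"
  shows "pure_tensor R M N x y \<triangleleft>\<^bsub>tensor R M N\<^esub> r = pure_tensor R M N x (y \<triangleleft>\<^bsub>N\<^esub> r)"
  unfolding tensor_rsmult using assms
  by (intro tensor_map_pure mod_hom_id bimodule.mod_hom_rsmult)

text \<open>Both actions are additive by \<open>tensor_map_hom\<close>, so the remaining axioms are
  checked on pure tensors, where the left action touches only the first factor and the right action
  only the second.\<close>

lemma bimodule_tensor:
  assumes "bimodule R M" "bimodule R N"
  shows "bimodule R (tensor R M N)"
proof -
  interpret M: bimodule R M by fact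
  interpret N: bimodule R N by fact
  interpret T: abelian_group "tensor R M N" by (rule abelian_group_tensor) fact+
  let ?T = "tensor R M N"
  have L: "(\<lambda>t. r \<odot>\<^bsub>?T\<^esub> t) \<in> hom (add_monoid ?T) (add_monoid ?T)" if "r \<in> carrier R" for r
    unfolding tensor_smult using assms that
    by (intro tensor_map_hom mod_hom_id M.mod_hom_smult)
  have Rt: "(\<lambda>t. t \<triangleleft>\<^bsub>?T\<^esub> r) \<in> hom (add_monoid ?T) (add_monoid ?T)" if "r \<in> carrier R" for r
    unfolding tensor_rsmult using assms that
    by (intro tensor_map_hom mod_hom_id N.mod_hom_rsmult)
  have closed: "r \<odot>\<^bsub>?T\<^esub> t \<in> carrier ?T" "t \<triangleleft>\<^bsub>?T\<^esub> r \<in> carrier ?T"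
    if "r \<in> carrier R" "t \<in> carrier ?T" for r t
    using L[OF that(1)] Rt[OF that(1)] that(2) by (auto simp: hom_def)
  have add: "r \<odot>\<^bsub>?T\<^esub> (s \<oplus>\<^bsub>?T\<^esub> t) = r \<odot>\<^bsub>?T\<^esub> s \<oplus>\<^bsub>?T\<^esub> r \<odot>\<^bsub>?T\<^esub> t"
    "(s \<oplus>\<^bsub>?T\<^esub> t) \<triangleleft>\<^bsub>?T\<^esub> r = s \<triangleleft>\<^bsub>?T\<^esub> r \<oplus>\<^bsub>?T\<^esub> t \<triangleleft>\<^bsub>?T\<^esub> r"
    if "r \<in> carrier R" "s \<in> carrier ?T" "t \<in> carrier ?T" for r s t
    using L[OF that(1)] Rt[OF that(1)] that by (auto simp: hom_def)
  note pures = tensor_smult_pure[OF assms] tensor_rsmult_pure[OF assms]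
    pure_tensor_add_left[OF assms] pure_tensor_add_right[OF assms]
    pure_tensor_closed[of _ M _ N R]
  show ?thesis
  proof (rule bimoduleI)
    fix a b t assume a: "a \<in> carrier R" and b: "b \<in> carrier R" and t: "t \<in> carrier ?T"
    show "(a \<oplus>\<^bsub>R\<^esub> b) \<odot>\<^bsub>?T\<^esub> t = a \<odot>\<^bsub>?T\<^esub> t \<oplus>\<^bsub>?T\<^esub> b \<odot>\<^bsub>?T\<^esub> t"
      using assms t
    proof (induction t rule: tensor_induct)
      case (pure x y)
      then show ?case using a b by (simp add: pures M.smult_l_distr)
    next
      case (add s t)
      then show ?case using a b by (simp add: \<open>\<And>t s r. _ \<Longrightarrow> _ \<Longrightarrow> _ \<Longrightarrow> r \<odot>\<^bsub>?T\<^esub> (s \<oplus>\<^bsub>?T\<^esub> t) = _\<close> closed T.a_ac)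
    qed
    show "t \<triangleleft>\<^bsub>?T\<^esub> (a \<oplus>\<^bsub>R\<^esub> b) = t \<triangleleft>\<^bsub>?T\<^esub> a \<oplus>\<^bsub>?T\<^esub> t \<triangleleft>\<^bsub>?T\<^esub> b"
      using assms t
    proof (induction t rule: tensor_induct)
      case (pure x y)
      then show ?case using a b by (simp add: pures N.rsmult_add_right)
    next
      case (add s t)
      then show ?case using a b by (simp add: \<open>\<And>t s r. _ \<Longrightarrow> _ \<Longrightarrow> _ \<Longrightarrow> (s \<oplus>\<^bsub>?T\<^esub> t) \<triangleleft>\<^bsub>?T\<^esub> r = _\<close> closed T.a_ac)
    qed
    show "(a \<otimes>\<^bsub>R\<^esub> b) \<odot>\<^bsub>?T\<^esub> t = a \<odot>\<^bsub>?T\<^esub> (b \<odot>\<^bsub>?T\<^esub> t)"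
      using assms t
    proof (induction t rule: tensor_induct)
      case (pure x y)
      then show ?case using a b by (simp add: pures M.smult_assoc1)
    next
      case (add s t)
      then show ?case using a b by (simp add: \<open>\<And>t s r. _ \<Longrightarrow> _ \<Longrightarrow> _ \<Longrightarrow> r \<odot>\<^bsub>?T\<^esub> (s \<oplus>\<^bsub>?T\<^esub> t) = _\<close> closed)
    qed
    show "t \<triangleleft>\<^bsub>?T\<^esub> (a \<otimes>\<^bsub>R\<^esub> b) = t \<triangleleft>\<^bsub>?T\<^esub> b \<triangleleft>\<^bsub>?T\<^esub> a"
      using assms t
    proof (induction t rule: tensor_induct)
      case (pure x y)
      then show ?case using a b by (simp add: pures N.rsmult_mult)
    next
      case (add s t)
      then show ?case using a b by (simp add: \<open>\<And>t s r. _ \<Longrightarrow> _ \<Longrightarrow> _ \<Longrightarrow> (s \<oplus>\<^bsub>?T\<^esub> t) \<triangleleft>\<^bsub>?T\<^esub> r = _\<close> closed)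
    qed
    show "a \<odot>\<^bsub>?T\<^esub> t \<triangleleft>\<^bsub>?T\<^esub> b = a \<odot>\<^bsub>?T\<^esub> (t \<triangleleft>\<^bsub>?T\<^esub> b)"
      using assms t
    proof (induction t rule: tensor_induct)
      case (pure x y)
      then show ?case using a b by (simp add: pures)
    next
      case (add s t)
      then show ?case using a b by (simp add: \<open>\<And>t s r. _ \<Longrightarrow> _ \<Longrightarrow> _ \<Longrightarrow> (s \<oplus>\<^bsub>?T\<^esub> t) \<triangleleft>\<^bsub>?T\<^esub> r = _\<close>
          \<open>\<And>t s r. _ \<Longrightarrow> _ \<Longrightarrow> _ \<Longrightarrow> r \<odot>\<^bsub>?T\<^esub> (s \<oplus>\<^bsub>?T\<^esub> t) = _\<close> closed)
    qed
  next
    fix t assume t: "t \<in> carrier ?T"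
    show "\<one>\<^bsub>R\<^esub> \<odot>\<^bsub>?T\<^esub> t = t"
      using assms t
    proof (induction t rule: tensor_induct)
      case (add s t)
      then show ?case by (simp add: \<open>\<And>t s r. _ \<Longrightarrow> _ \<Longrightarrow> _ \<Longrightarrow> r \<odot>\<^bsub>?T\<^esub> (s \<oplus>\<^bsub>?T\<^esub> t) = _\<close>)
    qed (simp add: pures)
    show "t \<triangleleft>\<^bsub>?T\<^esub> \<one>\<^bsub>R\<^esub> = t"
      using assms t
    proof (induction t rule: tensor_induct)
      case (add s t)
      then show ?case by (simp add: \<open>\<And>t s r. _ \<Longrightarrow> _ \<Longrightarrow> _ \<Longrightarrow> (s \<oplus>\<^bsub>?T\<^esub> t) \<triangleleft>\<^bsub>?T\<^esub> r = _\<close>)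
    qed (simp add: pures)
  qed (auto simp: closed add M.is_cring T.abelian_group_axioms)
qed

text \<open>An additive inverse k makes h bijective, and then linearity is asked of h alone. On the
  tensor side all identities are additive, so pure tensors suffice; on the side of Q there is no
  such generating set, so \<open>hk\<close> ranges over all of Q.\<close>

lemma tensor_bimod_isoI:
  assumes "bimodule R M" "bimodule R N" "bimodule R Q"
    and h: "h \<in> hom (add_monoid (tensor R M N)) (add_monoid Q)"
    and k: "k \<in> hom (add_monoid Q) (add_monoid (tensor R M N))"
    and kh: "\<And>x y. \<lbrakk>x \<in> carrier M; y \<in> carrier N\<rbrakk> \<Longrightarrow> k (h (pure_tensor R M N x y)) = pure_tensor R M N x y"
    and hk: "\<And>q. q \<in> carrier Q \<Longrightarrow> h (k q) = q"
    and left: "\<And>r x y. \<lbrakk>r \<in> carrier R; x \<in> carrier M; y \<in> carrier N\<rbrakk> \<Longrightarrow>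
      h (pure_tensor R M N (r \<odot>\<^bsub>M\<^esub> x) y) = r \<odot>\<^bsub>Q\<^esub> h (pure_tensor R M N x y)"
    and right: "\<And>r x y. \<lbrakk>r \<in> carrier R; x \<in> carrier M; y \<in> carrier N\<rbrakk> \<Longrightarrow>
      h (pure_tensor R M N x (y \<triangleleft>\<^bsub>N\<^esub> r)) = h (pure_tensor R M N x y) \<triangleleft>\<^bsub>Q\<^esub> r"
  shows "h \<in> bimod_iso R (tensor R M N) Q"
proof -
  interpret Q: bimodule R Q by fact
  interpret T: bimodule R "tensor R M N" by (rule bimodule_tensor) fact+
  note h' = h[unfolded hom_add_monoid_iff] and k' = k[unfolded hom_add_monoid_iff]
  have h_closed: "h t \<in> carrier Q" if "t \<in> carrier (tensor R M N)" for t
    using h' that by blast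
  have h_add: "h (s \<oplus>\<^bsub>tensor R M N\<^esub> t) = h s \<oplus>\<^bsub>Q\<^esub> h t"
    if "s \<in> carrier (tensor R M N)" "t \<in> carrier (tensor R M N)" for s t
    using h' that by blast
  have kh': "k (h t) = t" if "t \<in> carrier (tensor R M N)" for t
    using assms(1,2) that
  proof (induction t rule: tensor_induct)
    case (add s t)
    then show ?case using k' h_closed by (simp add: h_add)
  qed (simp add: kh)
  show ?thesis
  proof (rule bimod_isoI)
    show "bij_betw h (carrier (tensor R M N)) (carrier Q)"
      by (rule bij_betw_byWitness[where f' = k]) (use h' k' kh' hk in auto)
    fix r t assume r: "r \<in> carrier R" and t: "t \<in> carrier (tensor R M N)"
    show "h (r \<odot>\<^bsub>tensor R M N\<^esub> t) = r \<odot>\<^bsub>Q\<^esub> h t"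
      using assms(1,2) t
    proof (induction t rule: tensor_induct)
      case (add s t)
      then show ?case using r by (simp add: h_add T.smult_r_distr Q.smult_r_distr h_closed)
    qed (simp add: tensor_smult_pure assms r left)
    show "h (t \<triangleleft>\<^bsub>tensor R M N\<^esub> r) = h t \<triangleleft>\<^bsub>Q\<^esub> r"
      using assms(1,2) t
    proof (induction t rule: tensor_induct)
      case (add s t)
      then show ?case using r by (simp add: h_add T.rsmult_add_left Q.rsmult_add_left h_closed)
    qed (simp add: tensor_rsmult_pure assms r right)
  qed (auto simp: h_closed h_add)
qed

lemma tensor_isomorphic:
  assumes "bimodule R M" "bimodule R N" "bimodule R M'" "bimodule R N'"
    and "bimodule_isomorphic R M M'" "bimodule_isomorphic R N N'"
  shows "bimodule_isomorphic R (tensor R M N) (tensor R M' N')"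
proof -
  interpret M: bimodule R M by fact
  interpret N: bimodule R N by fact
  interpret M': bimodule R M' by fact
  interpret N': bimodule R N' by fact
  obtain h k where h: "h \<in> bimod_iso R M M'" and k: "k \<in> bimod_iso R N N'"
    using assms by (auto elim!: bimodule_isomorphicE)
  note h' = bimod_iso_inv_into[OF assms(1) h] and k' = bimod_iso_inv_into[OF assms(2) k]
  let ?h' = "inv_into (carrier M) h" and ?k' = "inv_into (carrier N) k"
  have hom: "h \<in> mod_hom R (right_module M) (right_module M')" "k \<in> mod_hom R N N'"
    "?h' \<in> mod_hom R (right_module M') (right_module M)" "?k' \<in> mod_hom R N' N"
    using h k h' k' by (auto simp: bimod_iso_def mod_iso_def)
  have inv: "h (?h' x) = x" if "x \<in> carrier M'" for x
    using bimod_isoD(5)[OF h] that by (auto simp: bij_betw_def f_inv_into_f)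
  have inv': "k (?k' x) = x" if "x \<in> carrier N'" for x
    using bimod_isoD(5)[OF k] that by (auto simp: bij_betw_def f_inv_into_f)
  have inv2: "?h' (h x) = x" if "x \<in> carrier M" for x
    using bimod_isoD(5)[OF h] that by (auto simp: bij_betw_def)
  have inv2': "?k' (k x) = x" if "x \<in> carrier N" for x
    using bimod_isoD(5)[OF k] that by (auto simp: bij_betw_def)
  note pure = tensor_map_pure[OF assms(1-4) hom(1,2)]
    tensor_map_pure[OF assms(3,4,1,2) hom(3,4)]
  note homs = tensor_map_hom[OF assms(1-4) hom(1,2)] tensor_map_hom[OF assms(3,4,1,2) hom(3,4)]
  show ?thesis
  proof (rule bimodule_isomorphicI, rule tensor_bimod_isoI[OF assms(1,2) bimodule_tensor[OF assms(3,4)] homs])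
    fix q assume "q \<in> carrier (tensor R M' N')"
    with assms(3,4) show "tensor_map R M' N' h k (tensor_map R M N ?h' ?k' q) = q"
    proof (induction q rule: tensor_induct)
      case (pure x y)
      then show ?case
        using bimod_isoD(1)[OF h'] bimod_isoD(1)[OF k']
        by (simp add: tensor_map_pure[OF assms(1-4) hom(1,2)]
          tensor_map_pure[OF assms(3,4,1,2) hom(3,4)] inv inv')
    next
      case (add s t)
      then show ?case
        using homs unfolding hom_add_monoid_iff by (simp add: Pi_iff)
    qed
  qed (simp_all add: pure bimod_isoD[OF h] bimod_isoD[OF k] inv2 inv2' assms tensor_smult_pure tensor_rsmult_pure)
qed

section \<open>Isomorphism classes\<close>

lemma bimodule_class_eqI:
  assumes "bimodule_isomorphic R P Q" "bimodule_isomorphic R Q P"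
  shows "bimodule_class R P = bimodule_class R Q"
  using assms by (auto simp: bimodule_class_def intro: bimodule_isomorphic_trans)

lemma bimodule_class_eqI':
  assumes "bimodule R P" "bimodule_isomorphic R P Q"
  shows "bimodule_class R P = bimodule_class R Q"
  using assms bimodule_class_eqI bimodule_isomorphic_sym by blast

text \<open>A common member Z of the two classes links P to Q. If the classes were empty, their
  equality would carry no information.\<close>

lemma bimodule_class_eqD:
  assumes "bimodule_class R P = bimodule_class R Q" "bimodule_class R P \<noteq> {}"
  shows "bimodule_isomorphic R P Q"
proof -
  obtain Z where Z: "Z \<in> bimodule_class R P"
    using assms(2) by blast
  then have "Z \<in> bimodule_class R Q"
    using assms(1) by simp
  with Z have "bimodule R Z" "bimodule_isomorphic R Z P" "bimodule_isomorphic R Z Q"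
    by (simp_all add: bimodule_class_def)
  then show ?thesis
    by (meson bimodule_isomorphic_sym bimodule_isomorphic_trans)
qed

lemma bimodule_class_self: "bimodule R P \<Longrightarrow> P \<in> bimodule_class R P"
  by (simp add: bimodule_class_def bimodule_isomorphic_refl)

text \<open>Independence of representatives is \<open>tensor_isomorphic\<close>. Nonemptiness
  supplies a representative of each factor on the standard type; the product with an empty class
  would be empty.\<close>

lemma class_tensor_bimodule_class:
  assumes "bimodule R P" "bimodule R Q" "bimodule_class R P \<noteq> {}" "bimodule_class R Q \<noteq> {}"
  shows "class_tensor R (bimodule_class R P) (bimodule_class R Q) = bimodule_class R (tensor R P Q)"
proof -
  have iso: "bimodule_isomorphic R (tensor R P' Q') (tensor R P Q)"
    "bimodule_isomorphic R (tensor R P Q) (tensor R P' Q')"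
    if "P' \<in> bimodule_class R P" "Q' \<in> bimodule_class R Q" for P' Q'
  proof -
    from that have P'Q': "bimodule R P'" "bimodule R Q'" "bimodule_isomorphic R P' P"
      "bimodule_isomorphic R Q' Q"
      by (simp_all add: bimodule_class_def)
    then show 1: "bimodule_isomorphic R (tensor R P' Q') (tensor R P Q)"
      using assms(1,2) by (intro tensor_isomorphic)
    show "bimodule_isomorphic R (tensor R P Q) (tensor R P' Q')"
      by (rule bimodule_isomorphic_sym[OF bimodule_tensor 1]) fact+
  qed
  obtain P' Q' where PQ: "P' \<in> bimodule_class R P" "Q' \<in> bimodule_class R Q"
    using assms(3,4) by blast
  show ?thesis
  proof (intro subset_antisym subsetI)
    fix Z assume "Z \<in> class_tensor R (bimodule_class R P) (bimodule_class R Q)"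
    then show "Z \<in> bimodule_class R (tensor R P Q)"
      using bimodule_isomorphic_trans[OF _ iso(1)]
      unfolding class_tensor_def bimodule_class_def[of R "tensor R P Q"] by auto
  next
    fix Z assume "Z \<in> bimodule_class R (tensor R P Q)"
    then show "Z \<in> class_tensor R (bimodule_class R P) (bimodule_class R Q)"
      using bimodule_isomorphic_trans[OF _ iso(2)[OF PQ], of Z] PQ
      unfolding class_tensor_def bimodule_class_def[of R "tensor R P Q"] by auto
  qed
qed

text \<open>Moves a bimodule along an injection to another type; this brings bimodules whose
  elements are ring elements to the type on which isomorphism classes are formed.\<close>

definition transport :: "('b \<Rightarrow> 'c) \<Rightarrow> ('a, 'b, 'm) bimodule_scheme \<Rightarrow> ('a, 'c) bimodule"
  where "transport j M = (let k = inv_into (carrier M) j in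
    \<lparr>carrier = j ` carrier M, monoid.mult = undefined, one = undefined, ring.zero = j \<zero>\<^bsub>M\<^esub>,
     add = (\<lambda>x y. j (k x \<oplus>\<^bsub>M\<^esub> k y)), smult = (\<lambda>r x. j (r \<odot>\<^bsub>M\<^esub> k x)),
     rsmult = (\<lambda>x r. j (k x \<triangleleft>\<^bsub>M\<^esub> r))\<rparr>)"

lemma transport:
  assumes "bimodule R M" "inj_on j (carrier M)"
  shows bimodule_transport: "bimodule R (transport j M)"
    and transport_isomorphic: "bimodule_isomorphic R (transport j M) M"
proof -
  interpret M: bimodule R M by fact
  have [simp]: "inv_into (carrier M) j (j x) = x" if "x \<in> carrier M" for x
    using assms(2) that by simp
  have "abelian_group (transport j M)"
  proof (rule abelian_groupI)
    fix x assume "x \<in> carrier (transport j M)"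
    then obtain x' where "x' \<in> carrier M" "x = j x'"
      by (auto simp: transport_def Let_def)
    then show "\<exists>y\<in>carrier (transport j M). y \<oplus>\<^bsub>transport j M\<^esub> x = \<zero>\<^bsub>transport j M\<^esub>"
      by (intro bexI[of _ "j (\<ominus>\<^bsub>M\<^esub> x')"]) (simp_all add: transport_def Let_def M.M.l_neg)
  qed (auto simp: transport_def Let_def M.M.a_ac)
  then show b: "bimodule R (transport j M)"
    by (intro bimoduleI)
      (auto simp: transport_def Let_def M.is_cring M.smult_l_distr M.smult_r_distr M.smult_assoc1
        M.rsmult_add_left M.rsmult_add_right M.rsmult_mult M.left_right_assoc)
  have "j \<in> bimod_iso R M (transport j M)"
    using assms(2) by (intro bimod_isoI) (auto simp: transport_def Let_def bij_betw_def)
  then show "bimodule_isomorphic R (transport j M) M"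
    using assms(1) bimodule_isomorphicI bimodule_isomorphic_sym by blast
qed

text \<open>An element a is encoded as the singleton of the constant function with value a. In this
  way D_g and (D_g)_{g^{-1}} obtain representatives on the standard type.\<close>

lemma bimodule_class_nonempty:
  fixes M :: "('a, 'a, 'm) bimodule_scheme"
  assumes "bimodule R M"
  shows "bimodule_class R M \<noteq> {}"
proof -
  have "inj_on (\<lambda>a. {\<lambda>_::nat. a}) (carrier M)"
    by (auto simp: inj_on_def dest: fun_cong)
  then show ?thesis
    using transport[OF assms] unfolding bimodule_class_def by blast
qed

section \<open>Changing the actions of a bimodule\<close>

definition centralize :: "('a, 'b, 'm) bimodule_scheme \<Rightarrow> ('a, 'b, 'm) bimodule_scheme"
  where "centralize M = M\<lparr>rsmult := \<lambda>x r. r \<odot>\<^bsub>M\<^esub> x\<rparr>"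

text \<open>For M = Gamma_{gh} and i = 1_g this is the target of the factor set map; for a central M
  it is also a model of the tensor product of M with R i.\<close>

definition idem_part :: "'a \<Rightarrow> ('a, 'b, 'm) bimodule_scheme \<Rightarrow> ('a, 'b, 'm) bimodule_scheme"
  where "idem_part i M = M\<lparr>carrier := {i \<odot>\<^bsub>M\<^esub> x | x. x \<in> carrier M}\<rparr>"

lemma centralize_simps [simp]:
  "carrier (centralize M) = carrier M"
  "add (centralize M) = add M"
  "ring.zero (centralize M) = ring.zero M"
  "smult (centralize M) = smult M"
  "x \<triangleleft>\<^bsub>centralize M\<^esub> r = r \<odot>\<^bsub>M\<^esub> x"
  by (simp_all add: centralize_def)

lemma idem_part_simps [simp]:
  "add (idem_part i M) = add M"
  "ring.zero (idem_part i M) = ring.zero M"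
  "smult (idem_part i M) = smult M"
  "rsmult (idem_part i M) = rsmult M"
  by (simp_all add: idem_part_def)

lemma idem_part_centralize: "idem_part i (centralize M) = centralize (idem_part i M)"
  by (simp add: idem_part_def centralize_def)

lemma (in module) smult_commute:
  "\<lbrakk>a \<in> carrier R; b \<in> carrier R; x \<in> carrier M\<rbrakk> \<Longrightarrow> a \<odot>\<^bsub>M\<^esub> (b \<odot>\<^bsub>M\<^esub> x) = b \<odot>\<^bsub>M\<^esub> (a \<odot>\<^bsub>M\<^esub> x)"
  using R.m_comm by (simp flip: smult_assoc1)

text \<open>Commutativity of R lets an additive and multiplicative map \<sigma> define a right
  action through the left one. Instead of preserving 1, \<sigma> has to send it to something acting
  as the identity, because the maps \<open>tau g\<close> below send 1 to the idempotent 1_g.\<close>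

lemma bimodule_rsmult_if_ring_map:
  assumes "module R M"
    and \<sigma>: "\<And>r. r \<in> carrier R \<Longrightarrow> \<sigma> r \<in> carrier R"
    and \<sigma>_add: "\<And>r s. \<lbrakk>r \<in> carrier R; s \<in> carrier R\<rbrakk> \<Longrightarrow> \<sigma> (r \<oplus>\<^bsub>R\<^esub> s) = \<sigma> r \<oplus>\<^bsub>R\<^esub> \<sigma> s"
    and \<sigma>_mult: "\<And>r s. \<lbrakk>r \<in> carrier R; s \<in> carrier R\<rbrakk> \<Longrightarrow> \<sigma> (r \<otimes>\<^bsub>R\<^esub> s) = \<sigma> r \<otimes>\<^bsub>R\<^esub> \<sigma> s"
    and \<sigma>_one: "\<And>x. x \<in> carrier M \<Longrightarrow> \<sigma> \<one>\<^bsub>R\<^esub> \<odot>\<^bsub>M\<^esub> x = x"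
  shows "bimodule R (M\<lparr>rsmult := \<lambda>x r. \<sigma> r \<odot>\<^bsub>M\<^esub> x\<rparr>)"
proof -
  interpret M: module R M by fact
  show ?thesis
  proof (rule bimoduleI)
    show "abelian_group (M\<lparr>rsmult := \<lambda>x r. \<sigma> r \<odot>\<^bsub>M\<^esub> x\<rparr>)"
      by (rule abelian_group_cong[OF M.M.abelian_group_axioms]) simp_all
  qed (simp_all add: M.is_cring M.smult_l_distr M.smult_r_distr M.smult_assoc1 assms M.smult_commute)
qed

lemma bimodule_centralize:
  assumes "module R M"
  shows "bimodule R (centralize M)"
proof -
  interpret module R M by fact
  show ?thesis
    unfolding centralize_def by (rule bimodule_rsmult_if_ring_map) (auto simp: assms)
qed

lemma (in module) submoduleI_smult:
  assumes "H \<subseteq> carrier M" "\<zero>\<^bsub>M\<^esub> \<in> H"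
    and "\<And>a b. \<lbrakk>a \<in> H; b \<in> H\<rbrakk> \<Longrightarrow> a \<oplus>\<^bsub>M\<^esub> b \<in> H"
    and smult: "\<And>a x. \<lbrakk>a \<in> carrier R; x \<in> H\<rbrakk> \<Longrightarrow> a \<odot>\<^bsub>M\<^esub> x \<in> H"
  shows "submodule H R M"
proof (rule submoduleI)
  fix a assume "a \<in> H"
  then show "\<ominus>\<^bsub>M\<^esub> a \<in> H"
    using smult[of "\<ominus>\<^bsub>R\<^esub> \<one>\<^bsub>R\<^esub>" a] assms(1) by (auto simp: smult_l_minus)
qed (use assms in auto)

text \<open>Idempotence makes the multiples of i the elements fixed by i, so membership becomes an
  equation that the operations visibly preserve.\<close>

lemma mem_idem_part_iff:
  assumes "module R M" "i \<in> carrier R" "i \<otimes>\<^bsub>R\<^esub> i = i"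
  shows "x \<in> carrier (idem_part i M) \<longleftrightarrow> x \<in> carrier M \<and> i \<odot>\<^bsub>M\<^esub> x = x"
proof -
  interpret module R M by fact
  have "i \<odot>\<^bsub>M\<^esub> (i \<odot>\<^bsub>M\<^esub> y) = i \<odot>\<^bsub>M\<^esub> y" if "y \<in> carrier M" for y
    using that assms smult_assoc1[of i i y] by simp
  then show ?thesis
    unfolding idem_part_def using assms(2) by simp (metis smult_closed)
qed

lemma bimodule_idem_part:
  assumes "bimodule R M" "i \<in> carrier R" "i \<otimes>\<^bsub>R\<^esub> i = i"
  shows "bimodule R (idem_part i M)"
proof -
  interpret M: bimodule R M by fact
  note mem = mem_idem_part_iff[OF M.module_axioms assms(2,3)]
  have [simp]: "i \<odot>\<^bsub>M\<^esub> (r \<odot>\<^bsub>M\<^esub> x) = r \<odot>\<^bsub>M\<^esub> x" "i \<odot>\<^bsub>M\<^esub> (x \<triangleleft>\<^bsub>M\<^esub> r) = x \<triangleleft>\<^bsub>M\<^esub> r"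
    if "x \<in> carrier M" "i \<odot>\<^bsub>M\<^esub> x = x" "r \<in> carrier R" for x r
    using that assms(2) by (metis M.smult_commute, metis M.left_right_assoc)
  have "submodule (carrier (idem_part i M)) R M"
    by (rule M.submoduleI_smult) (auto simp: mem M.smult_r_distr assms(2))
  then have "module R (idem_part i M)"
    using submodule.submodule_is_module[OF _ M.module_axioms] by (fastforce simp: idem_part_def)
  then have "abelian_group (idem_part i M)"
    by (rule module.axioms(2))
  then show ?thesis
    by (intro bimoduleI) (simp_all add: mem M.is_cring M.smult_l_distr M.smult_r_distr M.smult_assoc1
        M.rsmult_add_left M.rsmult_add_right M.rsmult_mult M.left_right_assoc assms(2))
qed

section \<open>Ideals generated by idempotents, and tensoring with them\<close>

lemma mem_PIdl_iff:
  assumes "cring R" "i \<in> carrier R" "i \<otimes>\<^bsub>R\<^esub> i = i"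
  shows "d \<in> PIdl\<^bsub>R\<^esub> i \<longleftrightarrow> d \<in> carrier R \<and> i \<otimes>\<^bsub>R\<^esub> d = d"
proof -
  interpret cring R by fact
  have "i \<otimes>\<^bsub>R\<^esub> (x \<otimes>\<^bsub>R\<^esub> i) = x \<otimes>\<^bsub>R\<^esub> i" if "x \<in> carrier R" for x
    using that assms m_lcomm[of i x i] by simp
  then show ?thesis
    using assms(2) m_comm by (force simp: cgenideal_def)
qed

lemma ideal_bimodule_simps [simp]:
  "carrier (ideal_bimodule R I) = I"
  "add (ideal_bimodule R I) = add R"
  "ring.zero (ideal_bimodule R I) = ring.zero R"
  "smult (ideal_bimodule R I) = monoid.mult R"
  "rsmult (ideal_bimodule R I) = monoid.mult R"
  by (simp_all add: ideal_bimodule_def)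

lemma bimodule_ideal_bimodule:
  assumes "cring R" "i \<in> carrier R" "i \<otimes>\<^bsub>R\<^esub> i = i"
  shows "bimodule R (ideal_bimodule R (PIdl\<^bsub>R\<^esub> i))"
proof -
  interpret cring R by fact
  note mem = mem_PIdl_iff[OF assms]
  have "abelian_group (ideal_bimodule R (PIdl\<^bsub>R\<^esub> i))"
    by (rule abelian_groupI)
      (auto simp: mem r_distr assms(2) a_ac l_neg r_neg r_minus intro!: bexI[of _ "\<ominus>\<^bsub>R\<^esub> _"])
  then show ?thesis
    by (intro bimoduleI) (auto simp: mem assms l_distr r_distr m_ac)
qed

text \<open>The map p \<otimes> d \<mapsto> d p has inverse q \<mapsto> q \<otimes> i. The parameter
  \<sigma> covers both D_g, with \<sigma> the identity, and (D_g)_{g^{-1}}, with \<sigma> equal to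
  \<open>tau g\<close>; that \<sigma> defines an action is contained in D and Q being
  bimodules.\<close>

lemma tensor_ideal_bimodule:
  assumes "bimodule R P" and i: "i \<in> carrier R" "i \<otimes>\<^bsub>R\<^esub> i = i"
    and central: "\<And>p r. \<lbrakk>p \<in> carrier P; r \<in> carrier R\<rbrakk> \<Longrightarrow> p \<triangleleft>\<^bsub>P\<^esub> r = r \<odot>\<^bsub>P\<^esub> p"
    and \<sigma>: "\<And>r. r \<in> carrier R \<Longrightarrow> \<sigma> r \<in> carrier R"
    and D: "D = (ideal_bimodule R (PIdl\<^bsub>R\<^esub> i))\<lparr>rsmult := \<lambda>d r. d \<otimes>\<^bsub>R\<^esub> \<sigma> r\<rparr>" "bimodule R D"
    and Q: "Q = (idem_part i P)\<lparr>rsmult := \<lambda>p r. \<sigma> r \<odot>\<^bsub>P\<^esub> p\<rparr>" "bimodule R Q"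
  shows "bimodule_isomorphic R (tensor R P D) Q"
proof -
  interpret P: bimodule R P by fact
  interpret Q: bimodule R Q by fact
  note mem = mem_idem_part_iff[OF P.module_axioms i] mem_PIdl_iff[OF P.is_cring i]
  have D_simps: "carrier D = PIdl\<^bsub>R\<^esub> i" "add D = add R" "smult D = monoid.mult R"
    "\<And>d r. d \<triangleleft>\<^bsub>D\<^esub> r = d \<otimes>\<^bsub>R\<^esub> \<sigma> r"
    by (simp_all add: D)
  have Q_simps: "carrier Q = carrier (idem_part i P)" "add Q = add P" "smult Q = smult P"
    "\<And>p r. p \<triangleleft>\<^bsub>Q\<^esub> r = \<sigma> r \<odot>\<^bsub>P\<^esub> p"
    by (simp_all add: Q)
  have closed: "d \<odot>\<^bsub>P\<^esub> p \<in> carrier Q" if "p \<in> carrier P" "d \<in> carrier D" for p d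
    using that i P.smult_assoc1[of i d p] by (simp add: Q_simps D_simps mem)
  obtain h where h: "h \<in> hom (add_monoid (tensor R P D)) (add_monoid Q)"
    and h_pure: "\<And>p d. \<lbrakk>p \<in> carrier P; d \<in> carrier D\<rbrakk> \<Longrightarrow> h (pure_tensor R P D p d) = d \<odot>\<^bsub>P\<^esub> p"
  proof (rule tensor_lift[OF assms(1) D(2) Q.abelian_group_axioms closed])
    fix p r d assume "p \<in> carrier P" "r \<in> carrier R" "d \<in> carrier D"
    then show "d \<odot>\<^bsub>P\<^esub> (p \<triangleleft>\<^bsub>P\<^esub> r) = (r \<odot>\<^bsub>D\<^esub> d) \<odot>\<^bsub>P\<^esub> p"
      by (simp add: D_simps mem central P.smult_assoc1 P.smult_commute)
  qed (auto simp: D_simps Q_simps mem P.smult_l_distr P.smult_r_distr)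
  define k where "k = (\<lambda>q. pure_tensor R P D q i)"
  have iD: "i \<in> carrier D"
    using i by (simp add: D_simps mem)
  have k: "k \<in> hom (add_monoid Q) (add_monoid (tensor R P D))"
    unfolding hom_add_monoid_iff k_def using iD
    by (auto simp: Q_simps mem pure_tensor_add_left[OF assms(1) D(2)] intro: pure_tensor_closed)
  have "h \<in> bimod_iso R (tensor R P D) Q"
  proof (rule tensor_bimod_isoI[OF assms(1) D(2) Q(2) h k])
    fix p d assume p: "p \<in> carrier P" and d: "d \<in> carrier D"
    \<comment> \<open>Since d = d i and P is central, d can be moved to the left factor: p \<otimes>
      d = (d p) \<otimes> i.\<close>
    have "pure_tensor R P D (p \<triangleleft>\<^bsub>P\<^esub> d) i = pure_tensor R P D p (d \<odot>\<^bsub>D\<^esub> i)"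
      using p d by (intro pure_tensor_balanced assms D iD) (auto simp: D_simps mem)
    moreover have "d \<odot>\<^bsub>D\<^esub> i = d"
      using d i P.R.m_comm[of d i] by (simp add: D_simps mem)
    ultimately show "k (h (pure_tensor R P D p d)) = pure_tensor R P D p d"
      using p d by (simp add: h_pure k_def central D_simps mem)
  next
    fix q assume "q \<in> carrier Q"
    then show "h (k q) = q"
      using iD by (simp add: k_def h_pure Q_simps mem)
  next
    fix r p d assume r: "r \<in> carrier R" and p: "p \<in> carrier P" and d: "d \<in> carrier D"
    have dR: "d \<in> carrier R" using d by (simp add: D_simps mem)
    show "h (pure_tensor R P D (r \<odot>\<^bsub>P\<^esub> p) d) = r \<odot>\<^bsub>Q\<^esub> h (pure_tensor R P D p d)"
      using r p d dR by (simp add: h_pure Q_simps P.smult_commute)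
    have "d \<triangleleft>\<^bsub>D\<^esub> r \<in> carrier D"
      using d r bimodule.rsmult_closed[OF D(2)] by simp
    then show "h (pure_tensor R P D p (d \<triangleleft>\<^bsub>D\<^esub> r)) = h (pure_tensor R P D p d) \<triangleleft>\<^bsub>Q\<^esub> r"
      using r p d dR \<sigma>[OF r] P.R.m_comm[of d "\<sigma> r"] by (simp add: h_pure Q_simps D_simps P.smult_assoc1)
  qed
  then show ?thesis by (rule bimodule_isomorphicI)
qed

lemma tensor_central_ideal_bimodule:
  assumes "bimodule R P" and i: "i \<in> carrier R" "i \<otimes>\<^bsub>R\<^esub> i = i"
    and central: "\<And>p r. \<lbrakk>p \<in> carrier P; r \<in> carrier R\<rbrakk> \<Longrightarrow> p \<triangleleft>\<^bsub>P\<^esub> r = r \<odot>\<^bsub>P\<^esub> p"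
  shows "bimodule_isomorphic R (tensor R P (ideal_bimodule R (PIdl\<^bsub>R\<^esub> i))) (idem_part i P)"
proof -
  interpret P: bimodule R P by fact
  interpret C: bimodule R "idem_part i P" by (rule bimodule_idem_part) fact+
  \<comment> \<open>With \<sigma> the identity the general lemma yields the right action r p in
    place of p r; the two agree because P is central.\<close>
  have "bimodule_isomorphic R (tensor R P (ideal_bimodule R (PIdl\<^bsub>R\<^esub> i))) (centralize (idem_part i P))"
    by (rule tensor_ideal_bimodule[where \<sigma> = "\<lambda>r. r", OF assms(1) i central])
      (auto simp: ideal_bimodule_def centralize_def
        intro: bimodule_ideal_bimodule[OF P.is_cring i, unfolded ideal_bimodule_def]
          bimodule_centralize[OF C.module_axioms, unfolded centralize_def idem_part_simps])
  moreover have "bimodule_isomorphic R (centralize (idem_part i P)) (idem_part i P)"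
    by (rule bimodule_isomorphic_same) (auto simp: mem_idem_part_iff[OF P.module_axioms i] central)
  ultimately show ?thesis by (rule bimodule_isomorphic_trans)
qed

section \<open>Direct powers and finitely generated projective modules\<close>

lemma direct_power_simps:
  "carrier (direct_power n M) = {..<n} \<rightarrow>\<^sub>E carrier M"
  "u \<oplus>\<^bsub>direct_power n M\<^esub> v = (\<lambda>i\<in>{..<n}. u i \<oplus>\<^bsub>M\<^esub> v i)"
  "\<zero>\<^bsub>direct_power n M\<^esub> = (\<lambda>i\<in>{..<n}. \<zero>\<^bsub>M\<^esub>)"
  "r \<odot>\<^bsub>direct_power n M\<^esub> u = (\<lambda>i\<in>{..<n}. r \<odot>\<^bsub>M\<^esub> u i)"
  "u \<triangleleft>\<^bsub>direct_power n M\<^esub> r = (\<lambda>i\<in>{..<n}. u i \<triangleleft>\<^bsub>M\<^esub> r)"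
  by (simp_all add: direct_power_def)

lemma bimodule_direct_power:
  assumes "bimodule R M"
  shows "bimodule R (direct_power n M)"
proof -
  interpret M: bimodule R M by fact
  have [simp]: "u i \<in> carrier M" if "u \<in> {..<n} \<rightarrow>\<^sub>E carrier M" "i < n" for u i
    using that by auto
  have "abelian_group (direct_power n M)"
  proof (rule abelian_groupI)
    fix u assume "u \<in> carrier (direct_power n M)"
    then show "\<exists>v\<in>carrier (direct_power n M). v \<oplus>\<^bsub>direct_power n M\<^esub> u = \<zero>\<^bsub>direct_power n M\<^esub>"
      by (intro bexI[of _ "\<lambda>i\<in>{..<n}. \<ominus>\<^bsub>M\<^esub> u i"])
        (simp_all add: direct_power_simps M.M.l_neg cong: restrict_cong)
  qed (simp_all add: direct_power_simps M.M.a_ac PiE_restrict cong: restrict_cong)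
  then show ?thesis
    by (intro bimoduleI) (simp_all add: direct_power_simps M.is_cring M.smult_l_distr M.smult_r_distr
        M.smult_assoc1 M.rsmult_add_left M.rsmult_add_right M.rsmult_mult M.left_right_assoc
        PiE_restrict cong: restrict_cong)
qed

lemma fg_projective_mod_iso:
  fixes R :: "('a, 'p) ring_scheme"
  assumes "h \<in> mod_iso R M' M" "fg_projective R M"
  shows "fg_projective R M'"
proof -
  have "\<exists>k. k \<in> mod_iso R M' N" if "k \<in> mod_iso R M N" for N :: "('a, nat \<Rightarrow> 'a) bimodule" and k
  proof
    show "(\<lambda>x. k (h x)) \<in> mod_iso R M' N"
      using assms(1) that bij_betw_trans[of h "carrier M'" "carrier M" k "carrier N"]
      by (auto simp: mod_iso_def mod_hom_def comp_def Pi_iff)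
  qed
  then show ?thesis
    using assms(2) unfolding fg_projective_def Let_def by blast
qed

lemma fg_projective_same:
  assumes "fg_projective R M" "carrier M' = carrier M" "add M' = add M"
    and "\<And>r x. \<lbrakk>r \<in> carrier R; x \<in> carrier M\<rbrakk> \<Longrightarrow> r \<odot>\<^bsub>M'\<^esub> x = r \<odot>\<^bsub>M\<^esub> x"
  shows "fg_projective R M'"
  by (rule fg_projective_mod_iso[of "\<lambda>x. x" R M' M])
    (use assms in \<open>auto simp: mod_iso_def mod_hom_def bij_betw_def inj_on_def\<close>)

text \<open>In a central bimodule the two module structures coincide, and with them the left and the
  right linear endomorphisms; each pair of conditions collapses to a single one.\<close>

lemma partially_invertible_centralI:
  assumes "bimodule R M" "fg_projective R M"
    and central: "\<And>x r. \<lbrakk>x \<in> carrier M; r \<in> carrier R\<rbrakk> \<Longrightarrow> x \<triangleleft>\<^bsub>M\<^esub> r = r \<odot>\<^bsub>M\<^esub> x"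
    and endo: "\<And>h. h \<in> mod_hom R M M \<Longrightarrow> \<exists>r\<in>carrier R. \<forall>x\<in>carrier M. h x = r \<odot>\<^bsub>M\<^esub> x"
  shows "partially_invertible R M"
proof -
  have hom: "mod_hom R (right_module M) (right_module M) = mod_hom R M M"
    unfolding mod_hom_def by (auto simp: central Pi_iff)
  have "fg_projective R (right_module M)"
    by (rule fg_projective_same[OF assms(2)]) (auto simp: central)
  moreover have "\<exists>r\<in>carrier R. \<forall>x\<in>carrier M. h x = x \<triangleleft>\<^bsub>M\<^esub> r" if "h \<in> mod_hom R M M" for h
    using endo[OF that] central by metis
  ultimately show ?thesis
    unfolding partially_invertible_def hom using assms(1,2) endo by blast
qed

section \<open>Bimodules twisted by a partial action\<close>

context unital_partial_action
begin

text \<open>Projecting to D_{g^{-1}} first extends \<open>\<alpha> g\<close> to an additive and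
  multiplicative map on R, which sends 1 to 1_g. No domain conditions then have to be carried
  through the module computations.\<close>

definition tau :: "'g \<Rightarrow> 'a \<Rightarrow> 'a"
  where "tau g r = \<alpha> g (r \<otimes>\<^bsub>R\<^esub> e (inv g))"

lemma mem_dom_iff: "g \<in> carrier G \<Longrightarrow> d \<in> PIdl\<^bsub>R\<^esub> (e g) \<longleftrightarrow> d \<in> carrier R \<and> e g \<otimes>\<^bsub>R\<^esub> d = d"
  by (simp add: mem_PIdl_iff R.is_cring e_closed e_idem)

lemma e_one: "e \<one> = \<one>\<^bsub>R\<^esub>"
  using mem_dom_iff[of "\<one>" "\<one>\<^bsub>R\<^esub>"] dom_one e_closed[of "\<one>"] by simp

lemma act_closed: "\<lbrakk>g \<in> carrier G; d \<in> PIdl\<^bsub>R\<^esub> (e (inv g))\<rbrakk> \<Longrightarrow> \<alpha> g d \<in> PIdl\<^bsub>R\<^esub> (e g)"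
  using act_iso[of g] by (auto simp: ring_iso_def ring_hom_def)

lemma restrict_dom: "\<lbrakk>g \<in> carrier G; r \<in> carrier R\<rbrakk> \<Longrightarrow> r \<otimes>\<^bsub>R\<^esub> e g \<in> PIdl\<^bsub>R\<^esub> (e g)"
  by (auto simp: cgenideal_def)

lemma tau_in_dom: "\<lbrakk>g \<in> carrier G; r \<in> carrier R\<rbrakk> \<Longrightarrow> tau g r \<in> PIdl\<^bsub>R\<^esub> (e g)"
  unfolding tau_def by (intro act_closed restrict_dom) auto

lemma tau_closed [simp]: "\<lbrakk>g \<in> carrier G; r \<in> carrier R\<rbrakk> \<Longrightarrow> tau g r \<in> carrier R"
  using tau_in_dom mem_dom_iff by blast

lemma tau_add:
  assumes "g \<in> carrier G" "r \<in> carrier R" "s \<in> carrier R"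
  shows "tau g (r \<oplus>\<^bsub>R\<^esub> s) = tau g r \<oplus>\<^bsub>R\<^esub> tau g s"
  using act_iso[OF assms(1)] assms restrict_dom[of "inv g"] e_closed
  by (simp add: tau_def R.l_distr ring_iso_def ring_hom_def)

lemma tau_mult:
  assumes "g \<in> carrier G" "r \<in> carrier R" "s \<in> carrier R"
  shows "tau g (r \<otimes>\<^bsub>R\<^esub> s) = tau g r \<otimes>\<^bsub>R\<^esub> tau g s"
proof -
  \<comment> \<open>Doubling the idempotent splits the projection of a product into a product of
    projections.\<close>
  have "r \<otimes>\<^bsub>R\<^esub> s \<otimes>\<^bsub>R\<^esub> e (inv g) = (r \<otimes>\<^bsub>R\<^esub> s) \<otimes>\<^bsub>R\<^esub> (e (inv g) \<otimes>\<^bsub>R\<^esub> e (inv g))"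
    using assms by (simp add: e_idem)
  also have "\<dots> = (r \<otimes>\<^bsub>R\<^esub> e (inv g)) \<otimes>\<^bsub>R\<^esub> (s \<otimes>\<^bsub>R\<^esub> e (inv g))"
    using assms e_closed by (simp add: R.m_ac)
  finally show ?thesis
    using act_iso[OF assms(1)] assms restrict_dom[of "inv g"]
    by (simp add: tau_def ring_iso_def ring_hom_def)
qed

lemma tau_e: "g \<in> carrier G \<Longrightarrow> tau g (e (inv g)) = e g"
  using act_iso[of g] by (simp add: tau_def e_idem ring_iso_def ring_hom_def)

lemma tau_one_right: "g \<in> carrier G \<Longrightarrow> tau g \<one>\<^bsub>R\<^esub> = e g"
  using tau_e by (simp add: tau_def e_idem e_closed)

lemma tau_one: "r \<in> carrier R \<Longrightarrow> tau \<one> r = r"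
  by (simp add: tau_def e_one act_one)

text \<open>On D_g the two partial isomorphisms compose to the action of the group identity, so only
  the projection to D_g survives. On elements of a module fixed by 1_g the two maps therefore
  cancel.\<close>

lemma tau_tau_inv:
  assumes g: "g \<in> carrier G" and r: "r \<in> carrier R"
  shows "tau g (tau (inv g) r) = e g \<otimes>\<^bsub>R\<^esub> r"
proof -
  let ?d = "r \<otimes>\<^bsub>R\<^esub> e g"
  have d: "?d \<in> PIdl\<^bsub>R\<^esub> (e g)"
    using g r by (rule restrict_dom)
  have t: "tau (inv g) r = \<alpha> (inv g) ?d"
    using g by (simp add: tau_def)
  have in_dom: "tau (inv g) r \<in> PIdl\<^bsub>R\<^esub> (e (inv g))"
    using g r by (intro tau_in_dom) auto
  then have "tau (inv g) r \<otimes>\<^bsub>R\<^esub> e (inv g) = tau (inv g) r"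
    using g r e_closed R.m_comm by (metis G.inv_closed mem_dom_iff)
  then have "tau g (tau (inv g) r) = \<alpha> g (\<alpha> (inv g) ?d)"
    by (simp add: tau_def[of g] t)
  also have "\<dots> = \<alpha> (g \<otimes> inv g) ?d"
    using g d in_dom t by (intro act_mult) auto
  also have "\<dots> = e g \<otimes>\<^bsub>R\<^esub> r"
    using g r e_closed by (simp add: act_one R.m_comm)
  finally show ?thesis .
qed

lemma tau_inv_tau: "\<lbrakk>g \<in> carrier G; r \<in> carrier R\<rbrakk> \<Longrightarrow> tau (inv g) (tau g r) = e (inv g) \<otimes>\<^bsub>R\<^esub> r"
  using tau_tau_inv[of "inv g" r] by simp

section \<open>Bimodules determined by their left structure, and their twists\<close>

definition skew :: "'g \<Rightarrow> ('a, 'b, 'm) bimodule_scheme \<Rightarrow> bool"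
  where "skew g M \<longleftrightarrow> bimodule R M \<and> (\<forall>x\<in>carrier M. e g \<odot>\<^bsub>M\<^esub> x = x) \<and>
    (\<forall>x\<in>carrier M. \<forall>r\<in>carrier R. x \<triangleleft>\<^bsub>M\<^esub> r = tau g r \<odot>\<^bsub>M\<^esub> x)"

definition skewize :: "'g \<Rightarrow> ('a, 'b, 'm) bimodule_scheme \<Rightarrow> ('a, 'b, 'm) bimodule_scheme"
  where "skewize g M = M\<lparr>rsmult := \<lambda>x r. tau g r \<odot>\<^bsub>M\<^esub> x\<rparr>"

lemma skewize_simps [simp]:
  "carrier (skewize g M) = carrier M"
  "add (skewize g M) = add M"
  "ring.zero (skewize g M) = ring.zero M"
  "smult (skewize g M) = smult M"
  "x \<triangleleft>\<^bsub>skewize g M\<^esub> r = tau g r \<odot>\<^bsub>M\<^esub> x"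
  by (simp_all add: skewize_def)

lemma skewD:
  assumes "skew g M"
  shows "bimodule R M" "module R M"
    and "x \<in> carrier M \<Longrightarrow> e g \<odot>\<^bsub>M\<^esub> x = x"
    and "\<lbrakk>x \<in> carrier M; r \<in> carrier R\<rbrakk> \<Longrightarrow> x \<triangleleft>\<^bsub>M\<^esub> r = tau g r \<odot>\<^bsub>M\<^esub> x"
  using assms by (auto simp: skew_def bimodule_def)

lemma skew_skewize:
  assumes g: "g \<in> carrier G" and M: "module R M" and "\<And>x. x \<in> carrier M \<Longrightarrow> e g \<odot>\<^bsub>M\<^esub> x = x"
  shows "skew g (skewize g M)"
proof -
  have "bimodule R (skewize g M)"
    unfolding skewize_def using assms
    by (intro bimodule_rsmult_if_ring_map) (simp_all add: tau_add tau_mult tau_one_right)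
  then show ?thesis
    using assms(3) by (simp add: skew_def)
qed

lemma twist_simps [simp]:
  "carrier (twist G R e \<alpha> g M) = carrier M"
  "add (twist G R e \<alpha> g M) = add M"
  "ring.zero (twist G R e \<alpha> g M) = ring.zero M"
  by (simp_all add: twist_def)

lemma twist_smult [simp]:
  assumes "g \<in> carrier G"
  shows "r \<odot>\<^bsub>twist G R e \<alpha> g M\<^esub> x = tau (inv g) r \<odot>\<^bsub>M\<^esub> x"
    and "x \<triangleleft>\<^bsub>twist G R e \<alpha> g M\<^esub> r = tau (inv g) r \<odot>\<^bsub>M\<^esub> x"
  using assms by (simp_all add: twist_def tau_def)

text \<open>A twist reads only the left action and does not see how the right one was replaced.
  Hence the twist of a cocycle value can be computed on the component Gamma_h itself.\<close>

lemma twist_centralize: "twist G R e \<alpha> g (centralize M) = twist G R e \<alpha> g M"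
  and twist_skewize: "twist G R e \<alpha> g (skewize h M) = twist G R e \<alpha> g M"
  by (simp_all add: twist_def centralize_def skewize_def)

text \<open>On the twist, 1 acts as its image 1_{g^{-1}} under \<open>tau (inv g)\<close>, which is
  why that idempotent must fix M.\<close>

lemma bimodule_twist:
  assumes g: "g \<in> carrier G" and M: "module R M"
    and unital: "\<And>x. x \<in> carrier M \<Longrightarrow> e (inv g) \<odot>\<^bsub>M\<^esub> x = x"
  shows "bimodule R (twist G R e \<alpha> g M)"
proof -
  interpret M: module R M by fact
  have "abelian_group (twist G R e \<alpha> g M)"
    by (rule abelian_group_cong[OF M.M.abelian_group_axioms]) simp_all
  then show ?thesis
    using g by (intro bimoduleI)
      (simp_all add: R.is_cring M.smult_l_distr M.smult_r_distr M.smult_assoc1 tau_add tau_mult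
        tau_one_right unital M.smult_commute)
qed

lemma bimodule_twist_idem_part:
  assumes g: "g \<in> carrier G" and Q: "bimodule R Q"
  shows "bimodule R (twist G R e \<alpha> g (idem_part (e (inv g)) Q))"
proof (rule bimodule_twist[OF g])
  have i: "e (inv g) \<in> carrier R" "e (inv g) \<otimes>\<^bsub>R\<^esub> e (inv g) = e (inv g)"
    using g e_closed e_idem by simp_all
  show "module R (idem_part (e (inv g)) Q)"
    by (rule bimodule.axioms(1)[OF bimodule_idem_part[OF Q i]])
  show "e (inv g) \<odot>\<^bsub>idem_part (e (inv g)) Q\<^esub> x = x" if "x \<in> carrier (idem_part (e (inv g)) Q)" for x
    using that mem_idem_part_iff[OF bimodule.axioms(1)[OF Q] i] by simp
qed

lemma twist_isomorphic:
  assumes g: "g \<in> carrier G" and iso: "bimodule_isomorphic R M N"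
  shows "bimodule_isomorphic R (twist G R e \<alpha> g M) (twist G R e \<alpha> g N)"
proof -
  obtain h where "h \<in> bimod_iso R M N"
    using iso by (rule bimodule_isomorphicE)
  then have "h \<in> bimod_iso R (twist G R e \<alpha> g M) (twist G R e \<alpha> g N)"
    using g by (intro bimod_isoI) (simp_all add: bimod_isoD)
  then show ?thesis by (rule bimodule_isomorphicI)
qed

section \<open>The twisted ideals and their divisors\<close>

lemma twisted_dom_eq:
  "twisted_dom G R e \<alpha> g = (ideal_bimodule R (PIdl\<^bsub>R\<^esub> (e g)))\<lparr>rsmult := \<lambda>d r. d \<otimes>\<^bsub>R\<^esub> tau g r\<rparr>"
  by (simp add: twisted_dom_def dom_bimodule_def tau_def)

lemma bimodule_dom: "g \<in> carrier G \<Longrightarrow> bimodule R (dom_bimodule R e g)"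
  unfolding dom_bimodule_def by (intro bimodule_ideal_bimodule R.is_cring e_closed e_idem)

lemma twisted_dom_simps [simp]:
  "carrier (twisted_dom G R e \<alpha> g) = PIdl\<^bsub>R\<^esub> (e g)"
  "add (twisted_dom G R e \<alpha> g) = add R"
  "ring.zero (twisted_dom G R e \<alpha> g) = ring.zero R"
  "smult (twisted_dom G R e \<alpha> g) = monoid.mult R"
  "d \<triangleleft>\<^bsub>twisted_dom G R e \<alpha> g\<^esub> r = d \<otimes>\<^bsub>R\<^esub> tau g r"
  by (simp_all add: twisted_dom_eq)

lemma skew_twisted_dom:
  assumes g: "g \<in> carrier G"
  shows "skew g (twisted_dom G R e \<alpha> g)"
proof -
  interpret D: bimodule R "ideal_bimodule R (PIdl\<^bsub>R\<^esub> (e g))"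
    using bimodule_dom[OF g] by (simp add: dom_bimodule_def)
  have sk: "skew g (skewize g (ideal_bimodule R (PIdl\<^bsub>R\<^esub> (e g))))"
    by (rule skew_skewize[OF g D.module_axioms]) (use g mem_dom_iff in auto)
  interpret S: bimodule R "skewize g (ideal_bimodule R (PIdl\<^bsub>R\<^esub> (e g)))"
    using sk by (rule skewD)
  \<comment> \<open>\<open>twisted_dom\<close> multiplies by \<open>tau g r\<close> on the right,
    \<open>skewize\<close> on the left; the two formulas are matched on the elements of the ideal,
    so that the axioms of S carry over.\<close>
  have comm: "d \<otimes>\<^bsub>R\<^esub> tau g r = tau g r \<otimes>\<^bsub>R\<^esub> d" if "d \<in> PIdl\<^bsub>R\<^esub> (e g)" "r \<in> carrier R" for d r
    using that g mem_dom_iff R.m_comm tau_closed by blast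
  have "bimodule R (twisted_dom G R e \<alpha> g)"
  proof (rule bimoduleI)
    show "abelian_group (twisted_dom G R e \<alpha> g)"
      by (rule abelian_group_cong[OF D.M.abelian_group_axioms]) simp_all
  qed (use D.M.a_closed S.rsmult_closed S.rsmult_add_left S.rsmult_add_right S.rsmult_mult S.rsmult_one
      S.left_right_assoc S.smult_closed S.smult_l_distr S.smult_r_distr S.smult_assoc1 S.smult_one
      in \<open>simp_all add: comm R.is_cring\<close>)
  then show ?thesis
    using g by (auto simp: skew_def comm mem_dom_iff)
qed

text \<open>Both identities hold in every coordinate of the power, since the coordinates lie in D_g,
  and the injective map into the power reflects them to M.\<close>

lemma skew_if_bimodule_divides:
  assumes g: "g \<in> carrier G" and M: "bimodule R M"
    and "bimodule_divides R M (twisted_dom G R e \<alpha> g)"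
  shows "skew g M"
proof -
  interpret M: bimodule R M by fact
  obtain n K L h where K: "submodule K R (direct_power n (twisted_dom G R e \<alpha> g))"
    and h: "h \<in> bimod_iso R M ((direct_power n (twisted_dom G R e \<alpha> g))\<lparr>carrier := K\<rparr>)"
    using assms(3) unfolding bimodule_divides_def Let_def by (auto elim!: bimodule_isomorphicE)
  have "K \<subseteq> carrier (direct_power n (twisted_dom G R e \<alpha> g))"
    using subgroup.subset[OF submodule.axioms(1)[OF K]] by simp
  then have h_PiE: "h x \<in> {..<n} \<rightarrow>\<^sub>E PIdl\<^bsub>R\<^esub> (e g)" if "x \<in> carrier M" for x
    using bimod_isoD(1)[OF h that] by (auto simp: direct_power_simps)
  then have h_dom: "h x i \<in> carrier R" "e g \<otimes>\<^bsub>R\<^esub> h x i = h x i" if "x \<in> carrier M" "i < n" for x i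
    using that mem_dom_iff[OF g] by (meson PiE_mem lessThan_iff)+
  have inj: "x = y" if "h x = h y" "x \<in> carrier M" "y \<in> carrier M" for x y
    using bimod_isoD(5)[OF h] that by (auto simp: bij_betw_def inj_on_def)
  have smult: "h (r \<odot>\<^bsub>M\<^esub> x) = (\<lambda>i\<in>{..<n}. r \<otimes>\<^bsub>R\<^esub> h x i)" if "r \<in> carrier R" "x \<in> carrier M" for r x
    using bimod_isoD(3)[OF h that] by (simp add: direct_power_def)
  have rsmult: "h (x \<triangleleft>\<^bsub>M\<^esub> r) = (\<lambda>i\<in>{..<n}. h x i \<otimes>\<^bsub>R\<^esub> tau g r)" if "r \<in> carrier R" "x \<in> carrier M" for r x
    using bimod_isoD(4)[OF h that] by (simp add: direct_power_def)
  have "e g \<odot>\<^bsub>M\<^esub> x = x" if x: "x \<in> carrier M" for x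
  proof (rule inj)
    show "h (e g \<odot>\<^bsub>M\<^esub> x) = h x"
      using x g e_closed by (simp add: smult h_dom PiE_restrict[OF h_PiE] cong: restrict_cong)
  qed (use x g e_closed in auto)
  moreover have "x \<triangleleft>\<^bsub>M\<^esub> r = tau g r \<odot>\<^bsub>M\<^esub> x" if x: "x \<in> carrier M" and r: "r \<in> carrier R" for x r
  proof (rule inj)
    show "h (x \<triangleleft>\<^bsub>M\<^esub> r) = h (tau g r \<odot>\<^bsub>M\<^esub> x)"
      using x r g by (simp add: smult rsmult h_dom R.m_comm[of "tau g r"] cong: restrict_cong)
  qed (use x r g in auto)
  ultimately show ?thesis
    using M by (simp add: skew_def)
qed

text \<open>A left splitting of R^n suffices: as 1_g fixes M, the image of M lies in D_g^n, and
  there the right action is the left one through \<open>tau g\<close>, so whatever respects the left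
  action respects the right one.\<close>

lemma bimodule_divides_if_skew:
  assumes g: "g \<in> carrier G" and M: "skew g M" and fg: "fg_projective R M"
  shows "bimodule_divides R M (twisted_dom G R e \<alpha> g)"
proof -
  interpret M: bimodule R M using M by (rule skewD)
  define F where "F n = direct_power n (ideal_bimodule R (carrier R))" for n
  define N where "N n = direct_power n (twisted_dom G R e \<alpha> g)" for n
  obtain n K L f where K: "submodule K R (F n)" and L: "submodule L R (F n)"
    and compl: "complementary (F n) K L" and f: "f \<in> mod_iso R M ((F n)\<lparr>carrier := K\<rparr>)"
    using fg unfolding fg_projective_def Let_def F_def by blast
  interpret N: bimodule R "N n"
    unfolding N_def by (rule bimodule_direct_power[OF skewD(1)[OF skew_twisted_dom[OF g]]])
  interpret K: submodule K R "F n" by fact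
  interpret L: submodule L R "F n" by fact
  have F_carrier: "carrier (F n) = {..<n} \<rightarrow>\<^sub>E carrier R"
    by (simp add: F_def direct_power_simps)
  have N_carrier: "u \<in> carrier (N n) \<longleftrightarrow> u \<in> carrier (F n) \<and> (\<forall>i<n. e g \<otimes>\<^bsub>R\<^esub> u i = u i)" for u
    using g by (auto simp: N_def F_def direct_power_simps PiE_iff mem_dom_iff)
  have ops: "add (N n) = add (F n)" "ring.zero (N n) = ring.zero (F n)" "smult (N n) = smult (F n)"
    by (simp_all add: N_def F_def direct_power_def)
  have N_right: "u \<triangleleft>\<^bsub>N n\<^esub> r = tau g r \<odot>\<^bsub>F n\<^esub> u" if "u \<in> carrier (N n)" "r \<in> carrier R" for u r
    using that g unfolding N_carrier F_carrier
    by (auto simp: N_def F_def direct_power_simps PiE_iff R.m_comm intro!: restrict_ext)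
  have f_K: "f x \<in> K" if "x \<in> carrier M" for x
    using f that by (auto simp: mod_iso_def mod_hom_def)
  have f_add: "f (x \<oplus>\<^bsub>M\<^esub> y) = f x \<oplus>\<^bsub>F n\<^esub> f y" if "x \<in> carrier M" "y \<in> carrier M" for x y
    using f that by (auto simp: mod_iso_def mod_hom_def)
  have f_smult: "f (r \<odot>\<^bsub>M\<^esub> x) = r \<odot>\<^bsub>F n\<^esub> f x" if "r \<in> carrier R" "x \<in> carrier M" for r x
    using f that by (auto simp: mod_iso_def mod_hom_def)
  have f_bij: "bij_betw f (carrier M) K"
    using f by (simp add: mod_iso_def)
  have K_N: "K \<subseteq> carrier (N n)"
  proof
    fix u assume u: "u \<in> K"
    then obtain x where x: "x \<in> carrier M" "u = f x"
      using f_bij by (auto simp: bij_betw_def)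
    then have "e g \<odot>\<^bsub>F n\<^esub> u = u"
      using f_smult[of "e g" x] g e_closed skewD(3)[OF M] by simp
    then have "e g \<otimes>\<^bsub>R\<^esub> u i = u i" if "i < n" for i
      using that by (auto simp: F_def direct_power_simps dest!: fun_cong[of _ u i])
    then show "u \<in> carrier (N n)"
      using u K.subset by (auto simp: N_carrier)
  qed
  \<comment> \<open>Intersecting with D_g^n turns the complement of K in R^n into a complement of K
    in D_g^n.\<close>
  define L' where "L' = L \<inter> carrier (N n)"
  have K_sub: "submodule K R (N n)"
    by (rule N.submoduleI_smult) (use K_N K.one_closed K.m_closed K.smult_closed in \<open>auto simp: ops\<close>)
  have L'_sub: "submodule L' R (N n)"
  proof (rule N.submoduleI_smult)
    show "\<zero>\<^bsub>N n\<^esub> \<in> L'"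
      using L.one_closed N.M.zero_closed by (simp add: L'_def ops)
    show "u \<oplus>\<^bsub>N n\<^esub> v \<in> L'" if "u \<in> L'" "v \<in> L'" for u v
      using that L.m_closed N.M.a_closed[of u v] by (auto simp: L'_def ops)
    show "r \<odot>\<^bsub>N n\<^esub> v \<in> L'" if "r \<in> carrier R" "v \<in> L'" for r v
      using that L.smult_closed N.smult_closed[of r v] by (auto simp: L'_def ops)
  qed (simp add: L'_def)
  have right: "submodule H R (right_module (N n))" if H: "submodule H R (N n)" for H
  proof (rule module.submoduleI_smult[OF N.right_module])
    interpret H: submodule H R "N n" by fact
    show "H \<subseteq> carrier (right_module (N n))" "\<zero>\<^bsub>right_module (N n)\<^esub> \<in> H"
      using H.subset H.one_closed by simp_all
    show "u \<oplus>\<^bsub>right_module (N n)\<^esub> v \<in> H" if "u \<in> H" "v \<in> H" for u v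
      using that H.m_closed by simp
    show "r \<odot>\<^bsub>right_module (N n)\<^esub> v \<in> H" if "r \<in> carrier R" "v \<in> H" for r v
    proof -
      have "v \<in> carrier (N n)"
        using that(2) H.subset by auto
      then have "v \<triangleleft>\<^bsub>N n\<^esub> r = tau g r \<odot>\<^bsub>N n\<^esub> v"
        using N_right that(1) by (simp add: ops)
      then show ?thesis
        using H.smult_closed[of "tau g r" v] that g by simp
    qed
  qed
  have "complementary (N n) K L'"
    unfolding complementary_def
  proof
    show "K \<inter> L' = {\<zero>\<^bsub>N n\<^esub>}"
      using compl K_N by (auto simp: complementary_def L'_def ops)
    show "K <+>\<^bsub>N n\<^esub> L' = carrier (N n)"
    proof
      show "K <+>\<^bsub>N n\<^esub> L' \<subseteq> carrier (N n)"
        using K_N N.M.a_closed by (auto simp: set_add_def' L'_def)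
      show "carrier (N n) \<subseteq> K <+>\<^bsub>N n\<^esub> L'"
      proof
        fix u assume u: "u \<in> carrier (N n)"
        then have "u \<in> K <+>\<^bsub>F n\<^esub> L"
          using compl by (simp add: complementary_def N_carrier)
        then obtain k l where kl: "k \<in> K" "l \<in> L" "u = k \<oplus>\<^bsub>F n\<^esub> l"
          by (auto simp: set_add_def')
        \<comment> \<open>1_g fixes u and its K-part k, so cancelling k in 1_g u = u leaves the
          claim for l.\<close>
        have "e g \<otimes>\<^bsub>R\<^esub> l i = l i" if i: "i < n" for i
        proof -
          have c: "k i \<in> carrier R" "l i \<in> carrier R"
            using kl K.subset L.subset i by (auto simp: F_carrier PiE_iff)
          have eq: "u i = k i \<oplus>\<^bsub>R\<^esub> l i"
            using kl(3) i by (simp add: F_def direct_power_simps)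
          have "e g \<otimes>\<^bsub>R\<^esub> u i = u i" "e g \<otimes>\<^bsub>R\<^esub> k i = k i"
            using u kl(1) K_N i by (auto simp: N_carrier)
          then have "k i \<oplus>\<^bsub>R\<^esub> e g \<otimes>\<^bsub>R\<^esub> l i = k i \<oplus>\<^bsub>R\<^esub> l i"
            using c e_closed[OF g] by (simp add: eq R.r_distr)
          then show ?thesis
            using c e_closed[OF g] by simp
        qed
        then have "l \<in> L'"
          using kl(2) L.subset by (auto simp: L'_def N_carrier)
        then show "u \<in> K <+>\<^bsub>N n\<^esub> L'"
          using kl by (auto simp: set_add_def' ops)
      qed
    qed
  qed
  moreover have "f \<in> bimod_iso R M ((N n)\<lparr>carrier := K\<rparr>)"
  proof (rule bimod_isoI)
    fix r x assume "r \<in> carrier R" "x \<in> carrier M"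
    then show "f (x \<triangleleft>\<^bsub>M\<^esub> r) = f x \<triangleleft>\<^bsub>(N n)\<lparr>carrier := K\<rparr>\<^esub> r"
      using N_right[OF subsetD[OF K_N f_K], of x r] g skewD(4)[OF M, of x r] f_smult by simp
  qed (use f_K f_add f_smult f_bij in \<open>auto simp: ops\<close>)
  ultimately show ?thesis
    using K_sub L'_sub right bimodule_isomorphicI
    unfolding bimodule_divides_def Let_def N_def by blast
qed

text \<open>A left linear endomorphism is right multiplication by some r, which on a skew bimodule
  is left multiplication by \<open>tau g r\<close>.\<close>

lemma partially_invertible_centralize:
  assumes g: "g \<in> carrier G" and M: "skew g M" and "partially_invertible R M"
  shows "partially_invertible R (centralize M)"
proof (rule partially_invertible_centralI)
  show "bimodule R (centralize M)"
    by (rule bimodule_centralize[OF skewD(2)[OF M]])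
  show "fg_projective R (centralize M)"
    by (rule fg_projective_same[of R M]) (use assms(3) in \<open>auto simp: partially_invertible_def\<close>)
  fix h assume "h \<in> mod_hom R (centralize M) (centralize M)"
  then have "h \<in> mod_hom R M M"
    by (simp add: mod_hom_def)
  then obtain r where "r \<in> carrier R" "\<And>x. x \<in> carrier M \<Longrightarrow> h x = x \<triangleleft>\<^bsub>M\<^esub> r"
    using assms(3) unfolding partially_invertible_def by blast
  then show "\<exists>r\<in>carrier R. \<forall>x\<in>carrier (centralize M). h x = r \<odot>\<^bsub>centralize M\<^esub> x"
    using skewD(4)[OF M] g by (intro bexI[of _ "tau g r"]) auto
qed simp

text \<open>On the twist r acts as \<open>tau (inv g) r\<close> from the left, which for this M is
  the old right action of r. So the twist inherits its projectivity and its endomorphisms from the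
  right module M.\<close>

lemma partially_invertible_twist:
  assumes g: "g \<in> carrier G" and M: "skew (inv g) M" and "partially_invertible R M"
  shows "partially_invertible R (twist G R e \<alpha> g M)"
proof (rule partially_invertible_centralI)
  interpret M: bimodule R M using M by (rule skewD)
  show "bimodule R (twist G R e \<alpha> g M)"
    using g by (intro bimodule_twist skewD[OF M])
  show "fg_projective R (twist G R e \<alpha> g M)"
    by (rule fg_projective_same[of R "right_module M"])
      (use assms(3) g skewD(4)[OF M] in \<open>auto simp: partially_invertible_def\<close>)
  fix h assume "h \<in> mod_hom R (twist G R e \<alpha> g M) (twist G R e \<alpha> g M)"
  then have "h \<in> mod_hom R (right_module M) (right_module M)"
    using g skewD(4)[OF M] by (auto simp: mod_hom_def Pi_iff)
  then obtain r where r: "r \<in> carrier R" "\<And>x. x \<in> carrier M \<Longrightarrow> h x = r \<odot>\<^bsub>M\<^esub> x"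
    using assms(3) unfolding partially_invertible_def by blast
  \<comment> \<open>A scalar s acts on the twist through \<open>tau (inv g) s\<close>; the choice s
    = \<open>tau g r\<close> gives 1_{g^{-1}} r, which acts on M as r.\<close>
  have "r \<odot>\<^bsub>M\<^esub> x = tau (inv g) (tau g r) \<odot>\<^bsub>M\<^esub> x" if "x \<in> carrier M" for x
    using that g r e_closed skewD(3)[OF M]
    by (simp add: tau_inv_tau M.smult_assoc1 M.smult_commute[of "e (inv g)" r])
  then show "\<exists>r\<in>carrier R. \<forall>x\<in>carrier (twist G R e \<alpha> g M). h x = r \<odot>\<^bsub>twist G R e \<alpha> g M\<^esub> x"
    using r g by (intro bexI[of _ "tau g r"]) auto
qed (use g in simp)

text \<open>Balancing carries \<open>tau (inv g) r\<close> to the right of x, where skewness applies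
  \<open>tau g\<close> to it; the result 1_g r acts on P as r. Read backwards, a scalar on the first
  factor becomes a twisted scalar on the second.\<close>

lemma pure_tensor_smult_skew:
  assumes g: "g \<in> carrier G" and P: "skew g P" and Q: "bimodule R Q"
    and "x \<in> carrier P" "y \<in> carrier Q" "r \<in> carrier R"
  shows "pure_tensor R P Q x (tau (inv g) r \<odot>\<^bsub>Q\<^esub> y) = pure_tensor R P Q (r \<odot>\<^bsub>P\<^esub> x) y"
proof -
  interpret P: bimodule R P using P by (rule skewD)
  have "pure_tensor R P Q x (tau (inv g) r \<odot>\<^bsub>Q\<^esub> y) = pure_tensor R P Q (x \<triangleleft>\<^bsub>P\<^esub> tau (inv g) r) y"
    using assms by (intro pure_tensor_balanced[symmetric] skewD(1)[OF P]) auto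
  also have "x \<triangleleft>\<^bsub>P\<^esub> tau (inv g) r = r \<odot>\<^bsub>P\<^esub> x"
    using assms e_closed skewD(3)[OF P]
    by (simp add: skewD(4)[OF P] tau_tau_inv P.smult_assoc1 P.smult_commute[of "e g" r])
  finally show ?thesis .
qed

text \<open>The swap y \<otimes> x \<mapsto> x \<otimes> y has inverse x \<otimes> y \<mapsto>
  1_{g^{-1}} y \<otimes> x; the idempotent puts y into the bimodule that is twisted and is invisible
  in the tensor product with P. The product of the two central bimodules on the left is central, so
  only the left structure of the tensor product of P and Q can be matched, whence the outer
  \<open>centralize\<close>.\<close>

lemma tensor_twist_isomorphic:
  assumes g: "g \<in> carrier G" and P: "skew g P" and Q: "bimodule R Q"
  shows "bimodule_isomorphic R (tensor R (twist G R e \<alpha> g (idem_part (e (inv g)) Q)) (centralize P))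
    (centralize (tensor R P Q))"
proof -
  define A where "A = twist G R e \<alpha> g (idem_part (e (inv g)) Q)"
  define B where "B = centralize P"
  let ?T = "tensor R P Q" and ?i = "e (inv g)"
  have i: "?i \<in> carrier R" "?i \<otimes>\<^bsub>R\<^esub> ?i = ?i"
    using g e_closed e_idem by simp_all
  have bP: "bimodule R P" using P by (rule skewD)
  interpret P: bimodule R P by fact
  interpret Q: bimodule R Q by fact
  note mem = mem_idem_part_iff[OF Q.module_axioms i]
  have bA: "bimodule R A"
    unfolding A_def by (rule bimodule_twist_idem_part[OF g Q])
  have bB: "bimodule R B"
    unfolding B_def by (rule bimodule_centralize) (rule P.module_axioms)
  have bT: "bimodule R ?T"
    by (rule bimodule_tensor) fact+
  interpret T: bimodule R ?T by fact
  have bC: "bimodule R (centralize ?T)"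
    by (rule bimodule_centralize) (rule T.module_axioms)
  have A_simps: "y \<in> carrier A \<longleftrightarrow> y \<in> carrier Q \<and> ?i \<odot>\<^bsub>Q\<^esub> y = y" "add A = add Q"
    "r \<odot>\<^bsub>A\<^esub> y = tau (inv g) r \<odot>\<^bsub>Q\<^esub> y" "y \<triangleleft>\<^bsub>A\<^esub> r = tau (inv g) r \<odot>\<^bsub>Q\<^esub> y" for y r
    using g by (simp_all add: A_def mem)
  have B_simps: "carrier B = carrier P" "add B = add P" "r \<odot>\<^bsub>B\<^esub> x = r \<odot>\<^bsub>P\<^esub> x" "x \<triangleleft>\<^bsub>B\<^esub> r = r \<odot>\<^bsub>P\<^esub> x" for x r
    by (simp_all add: B_def)
  note move = pure_tensor_smult_skew[OF g P Q]
  \<comment> \<open>The case r = 1_g of the rule above: \<open>tau (inv g)\<close> maps 1_g to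
    1_{g^{-1}}, and 1_g fixes x.\<close>
  have unital: "pure_tensor R P Q x (?i \<odot>\<^bsub>Q\<^esub> y) = pure_tensor R P Q x y"
    if "x \<in> carrier P" "y \<in> carrier Q" for x y
    using move[of x y "e g"] that g e_closed skewD(3)[OF P] tau_e[of "inv g"] by simp
  obtain h where h: "h \<in> hom (add_monoid (tensor R A B)) (add_monoid ?T)"
    and h_pure: "\<And>y x. \<lbrakk>y \<in> carrier A; x \<in> carrier B\<rbrakk> \<Longrightarrow> h (pure_tensor R A B y x) = pure_tensor R P Q x y"
    by (rule tensor_lift[OF bA bB T.abelian_group_axioms, of "\<lambda>y x. pure_tensor R P Q x y"])
      (auto simp: A_simps B_simps pure_tensor_closed move
        pure_tensor_add_left[OF bP Q] pure_tensor_add_right[OF bP Q])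
  have iQ: "?i \<odot>\<^bsub>Q\<^esub> y \<in> carrier A" if "y \<in> carrier Q" for y
    using that i Q.smult_assoc1[of ?i ?i y] by (simp add: A_simps)
  have iQ': "?i \<odot>\<^bsub>Q\<^esub> y \<in> carrier A" "x \<in> carrier B" if "y \<in> carrier Q" "x \<in> carrier P" for x y
    using iQ that by (simp_all add: B_simps)
  obtain k where k: "k \<in> hom (add_monoid ?T) (add_monoid (tensor R A B))"
    and k_pure: "\<And>x y. \<lbrakk>x \<in> carrier P; y \<in> carrier Q\<rbrakk> \<Longrightarrow>
      k (pure_tensor R P Q x y) = pure_tensor R A B (?i \<odot>\<^bsub>Q\<^esub> y) x"
  proof (rule tensor_lift[OF bP Q abelian_group_tensor[OF bA bB], of "\<lambda>x y. pure_tensor R A B (?i \<odot>\<^bsub>Q\<^esub> y) x"])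
    fix x r y assume x: "x \<in> carrier P" and r: "r \<in> carrier R" and y: "y \<in> carrier Q"
    \<comment> \<open>Balancing for k: x r is \<open>tau g r\<close> times x, and this scalar
      crosses to A, where it acts through \<open>tau (inv g)\<close> and becomes 1_{g^{-1}}
      r.\<close>
    have "?i \<odot>\<^bsub>Q\<^esub> y \<triangleleft>\<^bsub>A\<^esub> tau g r = ?i \<odot>\<^bsub>Q\<^esub> (r \<odot>\<^bsub>Q\<^esub> y)"
      using r y g i Q.smult_assoc1[of ?i ?i y]
      by (simp add: A_simps tau_inv_tau Q.smult_assoc1 Q.smult_commute[of ?i r])
    then show "pure_tensor R A B (?i \<odot>\<^bsub>Q\<^esub> y) (x \<triangleleft>\<^bsub>P\<^esub> r) = pure_tensor R A B (?i \<odot>\<^bsub>Q\<^esub> (r \<odot>\<^bsub>Q\<^esub> y)) x"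
      using pure_tensor_balanced[OF bA bB iQ'[OF y x], of "tau g r"] x r g
      by (simp add: skewD(4)[OF P] B_simps)
  qed (use i in \<open>auto simp: iQ' pure_tensor_closed Q.smult_r_distr
      pure_tensor_add_left[OF bA bB, unfolded A_simps(2)]
      pure_tensor_add_right[OF bA bB, unfolded B_simps(2)]\<close>)
  have "h \<in> bimod_iso R (tensor R A B) (centralize ?T)"
  proof (rule tensor_bimod_isoI[OF bA bB bC])
    show "h \<in> hom (add_monoid (tensor R A B)) (add_monoid (centralize ?T))"
      "k \<in> hom (add_monoid (centralize ?T)) (add_monoid (tensor R A B))"
      using h k by (simp_all add: hom_add_monoid_iff)
  next
    fix y x assume "y \<in> carrier A" "x \<in> carrier B"
    then show "k (h (pure_tensor R A B y x)) = pure_tensor R A B y x"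
      by (simp add: h_pure) (simp add: k_pure A_simps B_simps)
  next
    fix t assume "t \<in> carrier (centralize ?T)"
    then have "t \<in> carrier ?T" by simp
    with bP Q show "h (k t) = t"
    proof (induction t rule: tensor_induct)
      case (pure x y)
      then show ?case by (simp add: k_pure h_pure iQ' unital)
    next
      case (add s t)
      then show ?case using h k unfolding hom_add_monoid_iff by (simp add: Pi_iff)
    qed
  next
    fix r y x assume r: "r \<in> carrier R" and y: "y \<in> carrier A" and x: "x \<in> carrier B"
    have "r \<odot>\<^bsub>A\<^esub> y \<in> carrier A"
      using module.smult_closed[OF bimodule.axioms(1)[OF bA] r y] .
    then show "h (pure_tensor R A B (r \<odot>\<^bsub>A\<^esub> y) x) = r \<odot>\<^bsub>centralize ?T\<^esub> h (pure_tensor R A B y x)"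
      using r y x by (simp add: h_pure) (simp add: A_simps B_simps move tensor_smult_pure bP Q)
    show "h (pure_tensor R A B y (x \<triangleleft>\<^bsub>B\<^esub> r)) = h (pure_tensor R A B y x) \<triangleleft>\<^bsub>centralize ?T\<^esub> r"
      using r y x bimodule.rsmult_closed[OF bB x r]
      by (simp add: h_pure) (simp add: A_simps B_simps tensor_smult_pure bP Q)
  qed
  then show ?thesis
    unfolding A_def B_def by (rule bimodule_isomorphicI)
qed

end

section \<open>Cocycles and crossed products\<close>

lemma idem_part_eq:
  assumes "\<And>x. x \<in> carrier M \<Longrightarrow> i \<odot>\<^bsub>M\<^esub> x = x"
  shows "idem_part i M = M"
proof -
  have "{i \<odot>\<^bsub>M\<^esub> x | x. x \<in> carrier M} = carrier M"
    using assms by force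
  then show ?thesis by (simp add: idem_part_def)
qed

lemma centralize_isomorphic:
  assumes "bimodule_isomorphic R M N"
  shows "bimodule_isomorphic R (centralize M) (centralize N)"
proof -
  obtain h where "h \<in> bimod_iso R M N"
    using assms by (rule bimodule_isomorphicE)
  then have "h \<in> bimod_iso R (centralize M) (centralize N)"
    by (intro bimod_isoI) (simp_all add: bimod_isoD)
  then show ?thesis by (rule bimodule_isomorphicI)
qed

text \<open>The preimage of j is fixed by i, so i fixes j; by symmetry j fixes i, and commutativity
  gives i = i j = j.\<close>

lemma idempotent_eq_if_isomorphic:
  assumes "cring R" and i: "i \<in> carrier R" "i \<otimes>\<^bsub>R\<^esub> i = i" and j: "j \<in> carrier R" "j \<otimes>\<^bsub>R\<^esub> j = j"
    and "bimodule_isomorphic R (ideal_bimodule R (PIdl\<^bsub>R\<^esub> i)) (ideal_bimodule R (PIdl\<^bsub>R\<^esub> j))"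
  shows "i = j"
proof -
  interpret cring R by fact
  have absorb: "j \<otimes>\<^bsub>R\<^esub> i = j"
    if i: "i \<in> carrier R" "i \<otimes>\<^bsub>R\<^esub> i = i" and j: "j \<in> carrier R" "j \<otimes>\<^bsub>R\<^esub> j = j"
      and iso: "bimodule_isomorphic R (ideal_bimodule R (PIdl\<^bsub>R\<^esub> i)) (ideal_bimodule R (PIdl\<^bsub>R\<^esub> j))"
    for i j
  proof -
    note mem = mem_PIdl_iff[OF \<open>cring R\<close>]
    obtain h where h: "h \<in> bimod_iso R (ideal_bimodule R (PIdl\<^bsub>R\<^esub> i)) (ideal_bimodule R (PIdl\<^bsub>R\<^esub> j))"
      using iso by (rule bimodule_isomorphicE)
    have "j \<in> PIdl\<^bsub>R\<^esub> j"
      using j by (simp add: mem)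
    then obtain x where x: "x \<in> PIdl\<^bsub>R\<^esub> i" "j = h x"
      using bimod_isoD(5)[OF h] by (auto simp: bij_betw_def)
    then have "h (i \<otimes>\<^bsub>R\<^esub> x) = i \<otimes>\<^bsub>R\<^esub> j"
      using bimod_isoD(3)[OF h, of i x] i by simp
    moreover have "i \<otimes>\<^bsub>R\<^esub> x = x"
      using x i by (simp add: mem)
    ultimately show ?thesis
      using x i j m_comm[of i j] by simp
  qed
  have "bimodule_isomorphic R (ideal_bimodule R (PIdl\<^bsub>R\<^esub> j)) (ideal_bimodule R (PIdl\<^bsub>R\<^esub> i))"
    by (rule bimodule_isomorphic_sym[OF bimodule_ideal_bimodule[OF assms(1) i] assms(6)])
  then have "i \<otimes>\<^bsub>R\<^esub> j = i" "j \<otimes>\<^bsub>R\<^esub> i = j"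
    using absorb[OF j i] absorb[OF i j] assms(6) by simp_all
  then show ?thesis
    using m_comm[of i j] i j by simp
qed

lemma mult_PicS [simp]: "U \<otimes>\<^bsub>PicS R\<^esub> V = class_tensor R U V"
  by (simp add: PicS_def)

lemma mem_PicS_over_iff:
  fixes R :: "('a, 'p) ring_scheme"
  shows
  "U \<in> carrier (PicS_over (carrier R) R) \<longleftrightarrow> (\<exists>P :: 'a std_bimodule. U = bimodule_class R P \<and> partially_invertible R P \<and>
    central_over (carrier R) P)"
  by (auto simp: PicS_over_def)

section \<open>Central tensor products and the case of the group identity\<close>

context unital_partial_action
begin

lemma skew_isomorphic:
  assumes g: "g \<in> carrier G" and M: "bimodule R M" and iso: "bimodule_isomorphic R M N" and N: "skew g N"
  shows "skew g M"
proof -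
  interpret M: bimodule R M by fact
  obtain h where h: "h \<in> bimod_iso R M N"
    using iso by (rule bimodule_isomorphicE)
  have inj: "x = y" if "h x = h y" "x \<in> carrier M" "y \<in> carrier M" for x y
    using bimod_isoD(5)[OF h] that by (auto simp: bij_betw_def inj_on_def)
  have "e g \<odot>\<^bsub>M\<^esub> x = x" if "x \<in> carrier M" for x
    by (rule inj) (use that g e_closed bimod_isoD[OF h] skewD[OF N] in auto)
  moreover have "x \<triangleleft>\<^bsub>M\<^esub> r = tau g r \<odot>\<^bsub>M\<^esub> x" if "x \<in> carrier M" "r \<in> carrier R" for x r
    by (rule inj) (use that g bimod_isoD[OF h] skewD[OF N] in auto)
  ultimately show ?thesis
    using M by (simp add: skew_def)
qed

text \<open>At the group identity \<open>tau\<close> is the identity of R and the idempotent is 1,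
  so skewness reduces to centrality. One predicate thus covers the values of f and the components
  Gamma_g.\<close>

lemma skew_one_iff:
  "skew \<one> M \<longleftrightarrow> bimodule R M \<and> (\<forall>x\<in>carrier M. \<forall>r\<in>carrier R. x \<triangleleft>\<^bsub>M\<^esub> r = r \<odot>\<^bsub>M\<^esub> x)"
  by (auto simp: skew_def e_one tau_one bimodule_def module.smult_one)

text \<open>Right multiplication of y by r is left multiplication by \<open>tau (inv g) r\<close>,
  which crosses to r on the first factor. Centralizing Gamma_g \<otimes> Gamma_{g^{-1}} therefore
  changes nothing.\<close>

lemma tensor_central:
  assumes g: "g \<in> carrier G" and P: "skew g P" and Q: "skew (inv g) Q"
    and "t \<in> carrier (tensor R P Q)" and r: "r \<in> carrier R"
  shows "t \<triangleleft>\<^bsub>tensor R P Q\<^esub> r = r \<odot>\<^bsub>tensor R P Q\<^esub> t"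
proof -
  interpret P: bimodule R P using P by (rule skewD)
  interpret T: bimodule R "tensor R P Q"
    by (rule bimodule_tensor[OF skewD(1)[OF P] skewD(1)[OF Q]])
  show ?thesis
    using skewD(1)[OF P] skewD(1)[OF Q] assms(4)
  proof (induction t rule: tensor_induct)
    case (pure x y)
    then show ?case
      using r pure_tensor_smult_skew[OF g P skewD(1)[OF Q]]
      by (simp add: tensor_smult_pure tensor_rsmult_pure skewD(1)[OF P] skewD(1)[OF Q] skewD(4)[OF Q])
  next
    case (add s t)
    then show ?case
      using r by (simp add: T.smult_r_distr T.rsmult_add_left)
  qed
qed

lemma centralize_tensor_isomorphic:
  assumes "g \<in> carrier G" "skew g P" "skew (inv g) Q"
  shows "bimodule_isomorphic R (centralize (tensor R P Q)) (tensor R P Q)"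
  by (rule bimodule_isomorphic_same) (simp_all add: tensor_central[OF assms])

text \<open>The swap at the group identity, where twisting, centralizing and projecting change
  nothing. It makes the inverses in \<open>PicS_ideal\<close> two-sided, as \<open>Units\<close>
  demands.\<close>

lemma tensor_commute:
  assumes P: "skew \<one> P" and Q: "skew \<one> Q"
  shows "bimodule_isomorphic R (tensor R Q P) (tensor R P Q)"
proof -
  have idem_part: "idem_part (e (inv \<one>)) Q = Q"
    by (rule idem_part_eq) (use skewD[OF Q] in simp)
  have "bimodule_isomorphic R Q (twist G R e \<alpha> \<one> Q)"
    by (rule bimodule_isomorphic_same) (use Q in \<open>simp_all add: tau_one skew_one_iff\<close>)
  moreover have "bimodule_isomorphic R P (centralize P)"
    by (rule bimodule_isomorphic_same) (use P in \<open>simp_all add: skew_one_iff\<close>)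
  moreover have "bimodule R (twist G R e \<alpha> \<one> Q)"
    by (rule bimodule_twist) (use skewD[OF Q] in auto)
  ultimately have "bimodule_isomorphic R (tensor R Q P) (tensor R (twist G R e \<alpha> \<one> Q) (centralize P))"
    using skewD[OF P] skewD[OF Q] by (intro tensor_isomorphic bimodule_centralize)
  moreover have "bimodule_isomorphic R (tensor R (twist G R e \<alpha> \<one> Q) (centralize P)) (centralize (tensor R P Q))"
    using tensor_twist_isomorphic[of "\<one>" P Q] P skewD[OF Q] by (simp add: idem_part[simplified])
  moreover have "bimodule_isomorphic R (centralize (tensor R P Q)) (tensor R P Q)"
    using centralize_tensor_isomorphic[of "\<one>" P Q] assms by simp
  ultimately show ?thesis
    by (rule bimodule_isomorphic_trans[OF bimodule_isomorphic_trans])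
qed

section \<open>Products and twists of isomorphism classes\<close>

lemma bimodule_class_std_nonempty:
  fixes P :: "'a std_bimodule"
  shows "bimodule R P \<Longrightarrow> bimodule_class R P \<noteq> {}"
  using bimodule_class_self by blast

lemma class_tensor_dom:
  fixes P :: "'a std_bimodule"
  assumes g: "g \<in> carrier G" and P: "skew \<one> P"
  shows "class_tensor R (bimodule_class R P) (bimodule_class R (dom_bimodule R e g))
    = bimodule_class R (idem_part (e g) P)"
proof -
  have "class_tensor R (bimodule_class R P) (bimodule_class R (dom_bimodule R e g))
      = bimodule_class R (tensor R P (dom_bimodule R e g))"
    by (intro class_tensor_bimodule_class bimodule_class_std_nonempty bimodule_class_nonempty
        bimodule_dom g skewD(1)[OF P])
  also have "\<dots> = bimodule_class R (idem_part (e g) P)"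
  proof (rule bimodule_class_eqI')
    show "bimodule R (tensor R P (dom_bimodule R e g))"
      by (intro bimodule_tensor bimodule_dom g skewD(1)[OF P])
    show "bimodule_isomorphic R (tensor R P (dom_bimodule R e g)) (idem_part (e g) P)"
      unfolding dom_bimodule_def
      by (rule tensor_central_ideal_bimodule) (use P g e_closed e_idem in \<open>auto simp: skew_one_iff\<close>)
  qed
  finally show ?thesis .
qed

text \<open>Under p \<otimes> d \<mapsto> d p the twisted ideal contributes only its right action,
  so f(g) and f(g) Theta(g) share their left module.\<close>

lemma class_tensor_Theta:
  fixes P :: "'a std_bimodule"
  assumes g: "g \<in> carrier G" and P: "skew \<one> P" and unital: "\<And>x. x \<in> carrier P \<Longrightarrow> e g \<odot>\<^bsub>P\<^esub> x = x"
  shows "class_tensor R (bimodule_class R P) (Theta G R e \<alpha> g) = bimodule_class R (skewize g P)"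
proof -
  have sk: "skew g (skewize g P)"
    by (rule skew_skewize[OF g skewD(2)[OF P] unital])
  have D: "bimodule R (twisted_dom G R e \<alpha> g)"
    by (rule skewD[OF skew_twisted_dom[OF g]])
  have "class_tensor R (bimodule_class R P) (Theta G R e \<alpha> g)
      = bimodule_class R (tensor R P (twisted_dom G R e \<alpha> g))"
    unfolding Theta_def
    by (intro class_tensor_bimodule_class bimodule_class_std_nonempty bimodule_class_nonempty
        D skewD(1)[OF P])
  also have "\<dots> = bimodule_class R (skewize g P)"
  proof (rule bimodule_class_eqI')
    show "bimodule R (tensor R P (twisted_dom G R e \<alpha> g))"
      by (intro bimodule_tensor D skewD(1)[OF P])
    show "bimodule_isomorphic R (tensor R P (twisted_dom G R e \<alpha> g)) (skewize g P)"
    proof (rule tensor_ideal_bimodule[where i = "e g" and \<sigma> = "tau g"])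
      show "skewize g P = (idem_part (e g) P)\<lparr>rsmult := \<lambda>p r. tau g r \<odot>\<^bsub>P\<^esub> p\<rparr>"
        by (simp add: idem_part_eq unital skewize_def)
    qed (use P g e_closed e_idem twisted_dom_eq D skewD(1)[OF sk] in \<open>auto simp: skew_one_iff\<close>)
  qed
  finally show ?thesis .
qed

text \<open>Twisting respects isomorphism, so all classes in the union coincide with the one
  contributed by P itself.\<close>

lemma act_star_bimodule_class:
  fixes P :: "'a std_bimodule"
  assumes g: "g \<in> carrier G" and P: "bimodule R P"
  shows "act_star G R e \<alpha> g (bimodule_class R P) = bimodule_class R (twist G R e \<alpha> g P)"
proof
  show "act_star G R e \<alpha> g (bimodule_class R P) \<subseteq> bimodule_class R (twist G R e \<alpha> g P)"
    using twist_isomorphic[OF g]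
    by (auto simp: act_star_def bimodule_class_def intro: bimodule_isomorphic_trans)
  show "bimodule_class R (twist G R e \<alpha> g P) \<subseteq> act_star G R e \<alpha> g (bimodule_class R P)"
    using bimodule_class_self[OF P] by (auto simp: act_star_def)
qed

lemma class_in_PicS_over:
  fixes P :: "'a std_bimodule"
  shows "\<lbrakk>skew \<one> P; partially_invertible R P\<rbrakk> \<Longrightarrow> bimodule_class R P \<in> carrier (PicS_over (carrier R) R)"
  unfolding mem_PicS_over_iff central_over_def skew_one_iff by metis

text \<open>If 1_g acts as the identity, multiplying [P] by [D_g] gives back [P], so [P] is its own
  witness in the definition of the ideal.\<close>

lemma class_in_PicS_ideal:
  fixes P :: "'a std_bimodule"
  assumes "g \<in> carrier G" "skew \<one> P" "partially_invertible R P"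
    and "\<And>x. x \<in> carrier P \<Longrightarrow> e g \<odot>\<^bsub>P\<^esub> x = x"
  shows "bimodule_class R P \<in> carrier (PicS_ideal R e g)"
proof -
  have "bimodule_class R P \<in> carrier (PicS_over (carrier R) R)"
    using assms(2,3) by (rule class_in_PicS_over)
  moreover have "bimodule_class R P = class_tensor R (bimodule_class R P) (bimodule_class R (dom_bimodule R e g))"
    using class_tensor_dom[OF assms(1,2)] by (simp add: idem_part_eq assms(4))
  ultimately show ?thesis
    by (auto simp: PicS_ideal_def)
qed

lemma skew_one_centralize: "module R M \<Longrightarrow> skew \<one> (centralize M)"
  by (simp add: skew_one_iff bimodule_centralize)

lemma skew_one_twist:
  assumes "g \<in> carrier G" "module R M" "\<And>x. x \<in> carrier M \<Longrightarrow> e (inv g) \<odot>\<^bsub>M\<^esub> x = x"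
  shows "skew \<one> (twist G R e \<alpha> g M)"
  using bimodule_twist[OF assms] assms(1) by (simp add: skew_one_iff)


lemma cocycle_if_divides:
  assumes C: "crossed_product G R C"
    and divides: "\<And>g. g \<in> carrier G \<Longrightarrow> bimodule_divides R (component C g) (twisted_dom G R e \<alpha> g)"
    and iso: "\<And>g. g \<in> carrier G \<Longrightarrow>
      bimodule_isomorphic R (tensor R (component C g) (component C (inv g))) (dom_bimodule R e g)"
  shows "\<exists>f\<in>Z1 G R e \<alpha>. \<forall>g\<in>carrier G.
    bimodule_class R (component C g) = f g \<otimes>\<^bsub>PicS R\<^esub> Theta G R e \<alpha> g"
proof -
  let ?\<Gamma> = "component C" and ?D = "dom_bimodule R e"
  have pinv: "partially_invertible R (?\<Gamma> g)" if "g \<in> carrier G" for g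
    using C that by (simp add: crossed_product_def)
  then have bimod: "bimodule R (?\<Gamma> g)" if "g \<in> carrier G" for g
    using that by (simp add: partially_invertible_def)
  have skew: "skew g (?\<Gamma> g)" if "g \<in> carrier G" for g
    using that bimod divides by (intro skew_if_bimodule_divides)
  have mult_iso: "bimodule_isomorphic R (tensor R (?\<Gamma> g) (?\<Gamma> h)) (idem_part (e g) (?\<Gamma> (g \<otimes> h)))"
    if g: "g \<in> carrier G" and h: "h \<in> carrier G" for g h
  proof -
    \<comment> \<open>\<open>crossed_product\<close> hides its idempotents behind an existential
      quantifier. They are compared with \<open>e g\<close> through Gamma_g \<otimes>
      Gamma_{g^{-1}}, which is isomorphic to both ideals.\<close>
    obtain i where i: "i g \<in> carrier R" "i g \<otimes>\<^bsub>R\<^esub> i g = i g"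
      "bimodule_isomorphic R (tensor R (?\<Gamma> g) (?\<Gamma> (inv g))) (dom_bimodule R i g)"
      and fs: "factor_set G R i C"
      using C g unfolding crossed_product_def by blast
    have "bimodule_isomorphic R (dom_bimodule R i g) (tensor R (?\<Gamma> g) (?\<Gamma> (inv g)))"
      by (rule bimodule_isomorphic_sym[OF bimodule_tensor[OF bimod[OF g] bimod[OF G.inv_closed[OF g]]] i(3)])
    then have "bimodule_isomorphic R (dom_bimodule R i g) (?D g)"
      using iso[OF g] by (rule bimodule_isomorphic_trans)
    then have "i g = e g"
      unfolding dom_bimodule_def
      by (rule idempotent_eq_if_isomorphic[OF R.is_cring i(1,2) e_closed[OF g] e_idem[OF g]])
    moreover have "fset C g h \<in> bimod_iso R (tensor R (?\<Gamma> g) (?\<Gamma> h)) (idem_part (i g) (?\<Gamma> (g \<otimes> h)))"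
      using fs g h unfolding factor_set_def idem_part_def by blast
    ultimately have "fset C g h \<in> bimod_iso R (tensor R (?\<Gamma> g) (?\<Gamma> h)) (idem_part (e g) (?\<Gamma> (g \<otimes> h)))"
      by simp
    then show ?thesis by (rule bimodule_isomorphicI)
  qed
  have tensor_bimod: "bimodule R (tensor R (?\<Gamma> g) (?\<Gamma> h))" if "g \<in> carrier G" "h \<in> carrier G" for g h
    using that by (intro bimodule_tensor bimod)
  define f where "f = (\<lambda>g\<in>carrier G. bimodule_class R (centralize (?\<Gamma> g)))"
  have central: "skew \<one> (centralize (?\<Gamma> g))" if "g \<in> carrier G" for g
    using that skewD(2)[OF skew] by (intro skew_one_centralize)
  have pinv_c: "partially_invertible R (centralize (?\<Gamma> g))" if "g \<in> carrier G" for g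
    using that skew pinv by (intro partially_invertible_centralize)
  \<comment> \<open>The swap read on classes. It evaluates the left side of the cocycle identity for
    all g and h, and for h = g^{-1} the product of f(g) with its inverse.\<close>
  have twist_prod: "class_tensor R (bimodule_class R (twist G R e \<alpha> g (idem_part (e (inv g)) (?\<Gamma> h)))) (f g)
      = bimodule_class R (centralize (tensor R (?\<Gamma> g) (?\<Gamma> h)))"
    if g: "g \<in> carrier G" and h: "h \<in> carrier G" for g h
  proof -
    let ?A = "twist G R e \<alpha> g (idem_part (e (inv g)) (?\<Gamma> h))"
    have A: "bimodule R ?A"
      by (rule bimodule_twist_idem_part[OF g bimod[OF h]])
    have B: "bimodule R (centralize (?\<Gamma> g))"
      using central[OF g] by (rule skewD)
    have "class_tensor R (bimodule_class R ?A) (f g) = bimodule_class R (tensor R ?A (centralize (?\<Gamma> g)))"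
      using g A B unfolding f_def
      by (simp add: class_tensor_bimodule_class bimodule_class_std_nonempty)
    also have "\<dots> = bimodule_class R (centralize (tensor R (?\<Gamma> g) (?\<Gamma> h)))"
      using g h skew bimod A B
      by (intro bimodule_class_eqI' bimodule_tensor tensor_twist_isomorphic)
    finally show ?thesis .
  qed
  have unit: "f g \<in> Units (PicS_ideal R e g)" if g: "g \<in> carrier G" for g
  proof -
    \<comment> \<open>The cocycle identity at h = g^{-1} predicts the twist of f(g^{-1}) as inverse
      of f(g); twisting ignores the right action, so Gamma_{g^{-1}} itself can be twisted.\<close>
    let ?U = "twist G R e \<alpha> g (?\<Gamma> (inv g))"
    have sk: "skew (inv g) (?\<Gamma> (inv g))"
      using g skew by simp
    have unital: "e (inv g) \<odot>\<^bsub>?\<Gamma> (inv g)\<^esub> x = x" if "x \<in> carrier (?\<Gamma> (inv g))" for x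
      using skewD(3)[OF sk that] .
    have U: "skew \<one> ?U"
      by (rule skew_one_twist[OF g skewD(2)[OF sk] unital])
    have "e g \<odot>\<^bsub>?U\<^esub> x = x" if "x \<in> carrier ?U" for x
      using that g unital tau_e[of "inv g"] by simp
    moreover have "partially_invertible R ?U"
      using g sk pinv by (intro partially_invertible_twist) auto
    ultimately have U_in: "bimodule_class R ?U \<in> carrier (PicS_ideal R e g)"
      using g U by (intro class_in_PicS_ideal)
    have f_in: "f g \<in> carrier (PicS_ideal R e g)"
      using g central pinv_c skewD(3)[OF skew[OF g]] by (auto simp: f_def intro!: class_in_PicS_ideal)
    have UP: "class_tensor R (bimodule_class R ?U) (f g) = bimodule_class R (?D g)"
    proof -
      have "class_tensor R (bimodule_class R ?U) (f g)
          = bimodule_class R (centralize (tensor R (?\<Gamma> g) (?\<Gamma> (inv g))))"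
        using twist_prod[OF g, of "inv g"] g by (simp add: idem_part_eq unital)
      also have "\<dots> = bimodule_class R (tensor R (?\<Gamma> g) (?\<Gamma> (inv g)))"
        using g skew sk bimodule.axioms(1)[OF tensor_bimod[OF g, of "inv g"]]
        by (intro bimodule_class_eqI' bimodule_centralize centralize_tensor_isomorphic) auto
      also have "\<dots> = bimodule_class R (?D g)"
        using g iso bimod by (intro bimodule_class_eqI' bimodule_tensor) auto
      finally show ?thesis .
    qed
    have "class_tensor R (f g) (bimodule_class R ?U) = class_tensor R (bimodule_class R ?U) (f g)"
      using g central[OF g] U skewD(1)[OF U] skewD(1)[OF central[OF g]]
      by (simp add: f_def class_tensor_bimodule_class bimodule_class_std_nonempty)
        (intro bimodule_class_eqI' bimodule_tensor tensor_commute; assumption)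
    then show ?thesis
      using f_in U_in UP unfolding Units_def by (auto simp: PicS_ideal_def intro!: bexI[of _ "bimodule_class R ?U"])
  qed
  have cocycle: "act_star G R e \<alpha> g (class_tensor R (f h) (bimodule_class R (?D (inv g))))
      \<otimes>\<^bsub>PicS R\<^esub> f g = class_tensor R (f (g \<otimes> h)) (bimodule_class R (?D g))"
    if g: "g \<in> carrier G" and h: "h \<in> carrier G" for g h
  proof -
    have "class_tensor R (f h) (bimodule_class R (?D (inv g)))
        = bimodule_class R (idem_part (e (inv g)) (centralize (?\<Gamma> h)))"
      using g h central by (simp add: f_def class_tensor_dom)
    moreover have "bimodule R (idem_part (e (inv g)) (centralize (?\<Gamma> h)))"
      using g h skewD(1)[OF central[OF h]] e_closed e_idem by (intro bimodule_idem_part) auto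
    ultimately have "act_star G R e \<alpha> g (class_tensor R (f h) (bimodule_class R (?D (inv g))))
        = bimodule_class R (twist G R e \<alpha> g (idem_part (e (inv g)) (?\<Gamma> h)))"
      using g by (simp add: act_star_bimodule_class) (simp add: idem_part_centralize twist_centralize)
    then have "act_star G R e \<alpha> g (class_tensor R (f h) (bimodule_class R (?D (inv g)))) \<otimes>\<^bsub>PicS R\<^esub> f g
        = bimodule_class R (centralize (tensor R (?\<Gamma> g) (?\<Gamma> h)))"
      using twist_prod[OF g h] by simp
    also have "\<dots> = bimodule_class R (centralize (idem_part (e g) (?\<Gamma> (g \<otimes> h))))"
      by (intro bimodule_class_eqI' bimodule_centralize centralize_isomorphic mult_iso g h
          bimodule.axioms(1)[OF tensor_bimod])
    also have "\<dots> = class_tensor R (f (g \<otimes> h)) (bimodule_class R (?D g))"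
      using g h central by (simp add: f_def class_tensor_dom idem_part_centralize)
    finally show ?thesis .
  qed
  have "f \<in> carrier G \<rightarrow>\<^sub>E carrier (PicS_over (carrier R) R)"
    using central pinv_c by (auto simp: f_def intro!: class_in_PicS_over)
  then have "f \<in> Z1 G R e \<alpha>"
    using unit cocycle by (simp add: Z1_def)
  moreover have "bimodule_class R (?\<Gamma> g) = f g \<otimes>\<^bsub>PicS R\<^esub> Theta G R e \<alpha> g" if g: "g \<in> carrier G" for g
  proof -
    have "f g \<otimes>\<^bsub>PicS R\<^esub> Theta G R e \<alpha> g = bimodule_class R (skewize g (centralize (?\<Gamma> g)))"
      using class_tensor_Theta[OF g central[OF g]] skewD(3)[OF skew[OF g]] g by (simp add: f_def)
    also have "bimodule_class R (?\<Gamma> g) = \<dots>"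
      by (rule bimodule_class_eqI'[OF bimod[OF g]], rule bimodule_isomorphic_same)
        (simp_all add: skewD(4)[OF skew[OF g]])
    finally show ?thesis by simp
  qed
  ultimately show ?thesis by blast
qed

text \<open>Each Gamma_g is recognized as a representative of f(g) with its right action replaced,
  so skewness together with left projectivity gives the divisibility. The isomorphism with D_g is
  the cocycle identity at the pair g, g^{-1}, pulled back through the swap.\<close>

lemma divides_if_cocycle:
  assumes C: "crossed_product G R C" and f: "f \<in> Z1 G R e \<alpha>"
    and prod: "\<And>g. g \<in> carrier G \<Longrightarrow>
      bimodule_class R (component C g) = f g \<otimes>\<^bsub>PicS R\<^esub> Theta G R e \<alpha> g"
    and g: "g \<in> carrier G"
  shows "bimodule_divides R (component C g) (twisted_dom G R e \<alpha> g)"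
    and "bimodule_isomorphic R (tensor R (component C g) (component C (inv g))) (dom_bimodule R e g)"
proof -
  let ?\<Gamma> = "component C" and ?D = "dom_bimodule R e"
  let ?R = "ideal_bimodule R (carrier R)"
  have pinv: "partially_invertible R (?\<Gamma> g)" if "g \<in> carrier G" for g
    using C that by (simp add: crossed_product_def)
  then have bimod: "bimodule R (?\<Gamma> g)" if "g \<in> carrier G" for g
    using that by (simp add: partially_invertible_def)
  have over: "\<exists>P :: 'a std_bimodule. U = bimodule_class R P \<and> skew \<one> P"
    if "U \<in> carrier (PicS_over (carrier R) R)" for U
    using that unfolding mem_PicS_over_iff central_over_def skew_one_iff partially_invertible_def by metis
  have "f \<in> carrier G \<rightarrow> carrier (PicS_over (carrier R) R)"
    using f by (auto simp: Z1_def)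
  then have "\<forall>g\<in>carrier G. \<exists>P :: 'a std_bimodule. f g = bimodule_class R P \<and> skew \<one> P"
    using over by blast
  then obtain P :: "'g \<Rightarrow> 'a std_bimodule" where f_eq: "\<And>g. g \<in> carrier G \<Longrightarrow> f g = bimodule_class R (P g)"
    and P: "\<And>g. g \<in> carrier G \<Longrightarrow> skew \<one> (P g)"
    by metis
  \<comment> \<open>Membership in \<open>PicS_ideal\<close> means f(g) = [V][D_g] for some central
    V, so P g is isomorphic to the part of V fixed by 1_g, and the isomorphism reflects this
    identity to P g.\<close>
  have unital: "e g \<odot>\<^bsub>P g\<^esub> x = x" if g: "g \<in> carrier G" and x: "x \<in> carrier (P g)" for g x
  proof -
    have "f g \<in> carrier (PicS_ideal R e g)"
      using f g by (auto simp: Z1_def Units_def)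
    then obtain U where U: "U \<in> carrier (PicS_over (carrier R) R)"
      "f g = class_tensor R U (bimodule_class R (?D g))"
      by (auto simp: PicS_ideal_def)
    then obtain V :: "'a std_bimodule" where V: "skew \<one> V"
      "f g = class_tensor R (bimodule_class R V) (bimodule_class R (?D g))"
      using over by blast
    then have "bimodule_class R (P g) = bimodule_class R (idem_part (e g) V)"
      using g f_eq class_tensor_dom by simp
    then have "bimodule_isomorphic R (P g) (idem_part (e g) V)"
      using P[OF g] by (intro bimodule_class_eqD bimodule_class_std_nonempty skewD)
    then obtain h where h: "h \<in> bimod_iso R (P g) (idem_part (e g) V)"
      by (rule bimodule_isomorphicE)
    interpret P: bimodule R "P g" using P[OF g] by (rule skewD)
    have "h (e g \<odot>\<^bsub>P g\<^esub> x) = e g \<odot>\<^bsub>V\<^esub> h x"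
      using bimod_isoD(3)[OF h] x g e_closed by simp
    also have "\<dots> = h x"
      using bimod_isoD(1)[OF h x] mem_idem_part_iff[OF skewD(2)[OF V(1)] e_closed[OF g] e_idem[OF g]] by simp
    finally show ?thesis
      using bimod_isoD(5)[OF h] x g e_closed by (auto simp: bij_betw_def inj_on_def)
  qed
  have \<Gamma>_iso: "bimodule_isomorphic R (?\<Gamma> g) (skewize g (P g))" if g: "g \<in> carrier G" for g
  proof (rule bimodule_class_eqD)
    show "bimodule_class R (?\<Gamma> g) = bimodule_class R (skewize g (P g))"
      using g prod f_eq P unital class_tensor_Theta by simp
    show "bimodule_class R (?\<Gamma> g) \<noteq> {}"
      using g bimod by (intro bimodule_class_std_nonempty)
  qed
  have skew: "skew g (?\<Gamma> g)" if g: "g \<in> carrier G" for g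
    by (rule skew_isomorphic[OF g bimod[OF g] \<Gamma>_iso[OF g]])
      (intro skew_skewize g skewD(2)[OF P[OF g]] unital)
  show "bimodule_divides R (?\<Gamma> g) (twisted_dom G R e \<alpha> g)"
    using g skew pinv by (intro bimodule_divides_if_skew) (auto simp: partially_invertible_def)
  have R_eq: "?R = ?D \<one>"
    by (simp add: dom_bimodule_def dom_one)
  \<comment> \<open>Multiplication by Theta(1) leaves a central bimodule unchanged up to
    isomorphism, so f(1) = [Gamma_1], and a partial representation sends the identity to
    [R].\<close>
  have f_one: "f \<one> = bimodule_class R ?R"
  proof -
    have "bimodule_isomorphic R (P \<one>) (skewize \<one> (P \<one>))"
      by (rule bimodule_isomorphic_same) (use P[of "\<one>"] in \<open>auto simp: tau_one skew_one_iff\<close>)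
    then have "f \<one> = bimodule_class R (skewize \<one> (P \<one>))"
      using skewD(1)[OF P] by (simp add: f_eq bimodule_class_eqI')
    also have "\<dots> = bimodule_class R (?\<Gamma> \<one>)"
      using bimodule_class_eqI'[OF bimod \<Gamma>_iso, of "\<one>"] by simp
    also have "\<dots> = bimodule_class R ?R"
      using C by (simp add: crossed_product_def partial_representation_def PicS_def)
    finally show ?thesis .
  qed
  \<comment> \<open>This is the right side of the cocycle identity at the pair g, g^{-1}.\<close>
  have f_one_dom: "class_tensor R (f \<one>) (bimodule_class R (?D g)) = bimodule_class R (?D g)"
  proof -
    have R: "bimodule R ?R"
      unfolding R_eq by (rule bimodule_dom) simp
    have "class_tensor R (f \<one>) (bimodule_class R (?D g)) = bimodule_class R (tensor R ?R (?D g))"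
      unfolding f_one by (intro class_tensor_bimodule_class bimodule_class_nonempty R bimodule_dom g)
    also have "\<dots> = bimodule_class R (idem_part (e g) ?R)"
      unfolding dom_bimodule_def
      by (rule bimodule_class_eqI', rule bimodule_tensor[OF R bimodule_dom[OF g, unfolded dom_bimodule_def]],
          rule tensor_central_ideal_bimodule[OF R])
        (use g e_closed e_idem R.m_comm in auto)
    also have "\<dots> = bimodule_class R (?D g)"
    proof (rule bimodule_class_eqI')
      show "bimodule R (idem_part (e g) ?R)"
        by (intro bimodule_idem_part R e_closed e_idem g)
      show "bimodule_isomorphic R (idem_part (e g) ?R) (?D g)"
        by (rule bimodule_isomorphic_same)
          (use g mem_idem_part_iff[OF bimodule.axioms(1)[OF R] e_closed[OF g] e_idem[OF g]] mem_dom_iff[OF g]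
            in \<open>auto simp: dom_bimodule_def\<close>)
    qed
    finally show ?thesis .
  qed
  have g': "inv g \<in> carrier G" using g by simp
  let ?A = "twist G R e \<alpha> g (P (inv g))"
  have A: "bimodule R ?A"
    by (rule bimodule_twist[OF g skewD(2)[OF P[OF g']] unital[OF g']])
  have "class_tensor R (f (inv g)) (bimodule_class R (?D (inv g))) = bimodule_class R (P (inv g))"
    using g' P unital class_tensor_dom by (simp add: f_eq idem_part_eq)
  then have "act_star G R e \<alpha> g (class_tensor R (f (inv g)) (bimodule_class R (?D (inv g)))) = bimodule_class R ?A"
    using g g' skewD(1)[OF P] act_star_bimodule_class by simp
  moreover have "act_star G R e \<alpha> g (f (inv g) \<otimes>\<^bsub>PicS R\<^esub> bimodule_class R (?D (inv g))) \<otimes>\<^bsub>PicS R\<^esub> f g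
      = f (g \<otimes> inv g) \<otimes>\<^bsub>PicS R\<^esub> bimodule_class R (?D g)"
    using f g g' by (simp only: Z1_def mem_Collect_eq)
  ultimately have "class_tensor R (bimodule_class R ?A) (bimodule_class R (P g)) = bimodule_class R (?D g)"
    using g f_one_dom by (simp add: f_eq)
  then have "bimodule_class R (tensor R ?A (P g)) = bimodule_class R (?D g)"
    using A skewD(1)[OF P[OF g]] by (simp add: class_tensor_bimodule_class bimodule_class_std_nonempty)
  then have AP: "bimodule_isomorphic R (tensor R ?A (P g)) (?D g)"
    using bimodule_class_nonempty[OF bimodule_dom[OF g]] by (intro bimodule_class_eqD) auto
  \<comment> \<open>The swap relates Gamma_g \<otimes> Gamma_{g^{-1}} to a twisted product, whose
    factors are then replaced by the representatives of f; their product is already known to be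
    D_g.\<close>
  let ?T = "tensor R (?\<Gamma> g) (?\<Gamma> (inv g))" and ?B = "twist G R e \<alpha> g (?\<Gamma> (inv g))"
  have idem_part: "idem_part (e (inv g)) (?\<Gamma> (inv g)) = ?\<Gamma> (inv g)"
    by (rule idem_part_eq) (rule skewD(3)[OF skew[OF g']])
  have B: "bimodule R ?B"
    by (rule bimodule_twist[OF g skewD(2)[OF skew[OF g']] skewD(3)[OF skew[OF g']]])
  have c: "bimodule R (centralize (?\<Gamma> g))"
    by (rule bimodule_centralize[OF skewD(2)[OF skew[OF g]]])
  have T: "bimodule R ?T"
    by (intro bimodule_tensor bimod g g')
  have "bimodule_isomorphic R ?T (centralize ?T)"
    by (rule bimodule_isomorphic_sym[OF bimodule_centralize[OF bimodule.axioms(1)[OF T]]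
          centralize_tensor_isomorphic[OF g skew[OF g] skew[OF g']]])
  moreover have "bimodule_isomorphic R (centralize ?T) (tensor R ?B (centralize (?\<Gamma> g)))"
    by (rule bimodule_isomorphic_sym[OF bimodule_tensor[OF B c]
          tensor_twist_isomorphic[OF g skew[OF g] bimod[OF g'], unfolded idem_part]])
  moreover have "bimodule_isomorphic R (tensor R ?B (centralize (?\<Gamma> g))) (tensor R ?A (P g))"
  proof (rule tensor_isomorphic[OF B c A skewD(1)[OF P[OF g]]])
    show "bimodule_isomorphic R ?B ?A"
      using twist_isomorphic[OF g \<Gamma>_iso[OF g']] by (simp add: twist_skewize)
    have "bimodule_isomorphic R (centralize (skewize g (P g))) (P g)"
      by (rule bimodule_isomorphic_same) (use P[OF g] in \<open>auto simp: skew_one_iff\<close>)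
    then show "bimodule_isomorphic R (centralize (?\<Gamma> g)) (P g)"
      by (rule bimodule_isomorphic_trans[OF centralize_isomorphic[OF \<Gamma>_iso[OF g]]])
  qed
  ultimately show "bimodule_isomorphic R ?T (?D g)"
    using AP by (meson bimodule_isomorphic_trans)
qed

end

theorem theorem3p20:
  fixes G :: "('g, 'q) monoid_scheme" and R :: "('a, 'p) ring_scheme"
    and e :: "'g \<Rightarrow> 'a" and \<alpha> :: "'g \<Rightarrow> 'a \<Rightarrow> 'a"
  assumes "unital_partial_action G R e \<alpha>"
  shows "C_Theta G R e \<alpha> =
    {crossed_class G R C | C. crossed_product G R C \<and>
      (\<exists>f\<in>Z1 G R e \<alpha>. \<forall>g\<in>carrier G.
        bimodule_class R (component C g) = f g \<otimes>\<^bsub>PicS R\<^esub> Theta G R e \<alpha> g)}"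
proof -
  interpret unital_partial_action G R e \<alpha> by fact
  \<comment> \<open>Both sets collect the classes of the crossed products satisfying some condition,
    so it is enough that the two conditions agree on each crossed product.\<close>
  have "(\<forall>g\<in>carrier G. bimodule_divides R (component C g) (twisted_dom G R e \<alpha> g) \<and>
      bimodule_isomorphic R (tensor R (component C g) (component C (inv\<^bsub>G\<^esub> g))) (dom_bimodule R e g)) \<longleftrightarrow>
    (\<exists>f\<in>Z1 G R e \<alpha>. \<forall>g\<in>carrier G.
        bimodule_class R (component C g) = f g \<otimes>\<^bsub>PicS R\<^esub> Theta G R e \<alpha> g)"
    if "crossed_product G R C" for C
    using cocycle_if_divides[OF that] divides_if_cocycle[OF that] by blast
  then show ?thesis
    unfolding C_Theta_def by blast
qed

end
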